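(* Let $\nu_1\ne\nu_2$ be positive integers and $s_{2\nu_1},s_{2\nu_2}\le0$, with $s_{2\nu_i}=2k^{\nu_i-1}\xi_{2\nu_i}$. In the limit $k\to\infty$, $b_k(\xi_{2\nu_1},\xi_{2\nu_2})^2$ has a valid asymptotic expansion of the form $$b_k(\xi_{2\nu_1},\xi_{2\nu_2})^2\simeq k\Bigl(z_0(s_{2\nu_1},s_{2\nu_2})+\frac1{k^2}z_1(s_{2\nu_1},s_{2\nu_2})+\frac1{k^4}z_2(s_{2\nu_1},s_{2\nu_2})+\cdots\Bigr).$$ Put $$f_g(s_{2\nu_1},s_{2\nu_2};w)=w^{1-2g}z_g(w^{\nu_1-1}s_{2\nu_1},w^{\nu_2-1}s_{2\nu_2}),\qquad f=f_0+\frac1{k^2}f_1+\frac1{k^4}f_2+\cdots .$$ The terms of the expansion are determined by the following partial differential scheme, for $i=1,2$ (an identity of formal series in $k^{-2}$, coefficient by coefficient, evaluated at $w=1$): $$f_{s_{2\nu_i}}=c_{\nu_i}f^{\nu_i}f_w+\frac1{k^2}F_1^{(\nu_i)}(f,f_w,f_{ww},f_{www})+\cdots+\frac1{k^{2g}}F_g^{(\nu_i)}(f,f_w,\dots,f_{w^{(2g+1)}})+\cdots\Big|_{w=1},$$ where $c_\nu=2\nu\binom{2\nu-1}{\nu-1}$ and the $F_g^{(\nu)}$ are the same differential polynomials as in the single-time case (see context).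
   Context: For $\xi_{2\nu_1},\xi_{2\nu_2}\le0$, $b_k(\xi_{2\nu_1},\xi_{2\nu_2})>0$ are the recurrence coefficients $\lambda p_n=b_{n+1}p_{n+1}+b_np_{n-1}$ of the orthonormal polynomials for the weight $\exp(-\tfrac12\lambda^2+2\xi_{2\nu_1}\lambda^{2\nu_1}+2\xi_{2\nu_2}\lambda^{2\nu_2})\,d\lambda$ on $\mathbb R$; so $b_k(0,0)^2=k$, which gives the initial values $z_0(0,0)=1$, $z_g(0,0)=0$ for $g\ge1$. They solve the Toda lattice flows of levels $2\nu_1$ and $2\nu_2$. The expansion is for fixed $(s_{2\nu_1},s_{2\nu_2})$, with truncation errors of the order of the first omitted term. Differential polynomials $F_g^{(\nu)}$: for a function $f$ of $w$, $F_g^{(\nu)}(f,f_w,\dots,f_{w^{(2g+1)}})$ is the coefficient of $\epsilon^{2g+1}$ in the formal Taylor expansion in $\epsilon$ of $$\sum_{1\le j_1<\cdots<j_{\nu+1}\le2\nu}\Bigl[\prod_{m=1}^{\nu+1}f(w+\epsilon(\ell_m+1))-\prod_{m=1}^{\nu+1}f(w+\epsilon\ell_m)\Bigr],\qquad\ell_m=j_m-2m+1,$$ (subscripts $w^{(j)}$ denote $j$-fold $w$-derivatives). *)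

theory Defs
  imports
    "HOL-Analysis.Analysis"
    "HOL-Library.FuncSet"
    "HOL-Library.Landau_Symbols"
    "HOL-Computational_Algebra.Polynomial"
    "HOL-Computational_Algebra.Formal_Power_Series"
begin

section \<open>Recurrence coefficients of orthonormal polynomials\<close>

definition orthonormal_polys :: "(real \<Rightarrow> real) \<Rightarrow> (nat \<Rightarrow> real poly) \<Rightarrow> bool" where
  "orthonormal_polys w p \<longleftrightarrow>
     (\<forall>n. degree (p n) = n \<and> lead_coeff (p n) > 0) \<and>
     (\<forall>m n. has_bochner_integral lborel (\<lambda>x. poly (p m) x * poly (p n) x * w x)
              (if m = n then 1 else 0))"

text \<open>
  The recurrence is \<open>\<lambda> p\<^sub>n = b\<^sub>n\<^sub>+\<^sub>1 p\<^sub>n\<^sub>+\<^sub>1 + b\<^sub>n p\<^sub>n\<^sub>-\<^sub>1\<close> with \<open>p\<^sub>-\<^sub>1 = 0\<close>;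
  the value \<open>b 0\<close> is therefore irrelevant.
\<close>

definition recurrence_coeffs :: "(real \<Rightarrow> real) \<Rightarrow> (nat \<Rightarrow> real) \<Rightarrow> bool" where
  "recurrence_coeffs w b \<longleftrightarrow>
     (\<forall>k\<ge>1. b k > 0) \<and>
     (\<exists>p. orthonormal_polys w p \<and>
        (\<forall>n. [:0, 1:] * p n =
           smult (b (n + 1)) (p (n + 1)) + (if n = 0 then 0 else smult (b n) (p (n - 1)))))"

definition toda_weight :: "nat \<Rightarrow> nat \<Rightarrow> real \<Rightarrow> real \<Rightarrow> real \<Rightarrow> real" where
  "toda_weight \<nu>1 \<nu>2 \<xi>1 \<xi>2 x =
     exp (- (1/2) * x ^ 2 + 2 * \<xi>1 * x ^ (2 * \<nu>1) + 2 * \<xi>2 * x ^ (2 * \<nu>2))"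

section \<open>The differential polynomials\<close>

text \<open>
  A jet \<open>a\<close> lists the derivatives \<open>a j = f\<^bsup>(j)\<^esup>(w)\<close> at a fixed point. Since
  \<open>f = f\<^sub>0 + k\<^bsup>-2\<^esup> f\<^sub>1 + \<dots>\<close> is itself a formal series, the entries of the jet are
  formal power series in \<open>h = k\<^bsup>-2\<^esup>\<close>. The outer power series below is in \<open>\<epsilon>\<close>:
  \<open>taylor_shift a l\<close> is the formal Taylor expansion of \<open>f(w + \<epsilon> l)\<close>.
\<close>

definition taylor_shift :: "(nat \<Rightarrow> real fps) \<Rightarrow> int \<Rightarrow> real fps fps" where
  "taylor_shift a l = Abs_fps (\<lambda>j. fps_const (of_int l ^ j / fact j) * a j)"

text \<open>Index tuples \<open>1 \<le> j\<^sub>1 < \<dots> < j\<^bsub>\<nu>+1\<^esub> \<le> 2\<nu>\<close>.\<close>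

definition down_steps :: "nat \<Rightarrow> (nat \<Rightarrow> nat) set" where
  "down_steps \<nu> =
     {j \<in> {1..\<nu>+1} \<rightarrow>\<^sub>E {1..2*\<nu>}. strict_mono_on {1..\<nu>+1} j}"

definition level :: "(nat \<Rightarrow> nat) \<Rightarrow> nat \<Rightarrow> int" where
  "level j m = int (j m) - 2 * int m + 1"

definition diff_poly :: "nat \<Rightarrow> nat \<Rightarrow> (nat \<Rightarrow> real fps) \<Rightarrow> real fps" where
  "diff_poly \<nu> g a =
     fps_nth (\<Sum>j\<in>down_steps \<nu>.
        (\<Prod>m=1..\<nu>+1. taylor_shift a (level j m + 1)) -
        (\<Prod>m=1..\<nu>+1. taylor_shift a (level j m))) (2 * g + 1)"

definition toda_const :: "nat \<Rightarrow> real" where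
  "toda_const \<nu> = 2 * real \<nu> * real ((2 * \<nu> - 1) choose (\<nu> - 1))"

text \<open>
  The coefficient of \<open>h\<^sup>n\<close> in
  \<open>c\<^sub>\<nu> f\<^sup>\<nu> f\<^sub>w + h F\<^sub>1(f, f\<^sub>w, \<dots>) + h\<^sup>2 F\<^sub>2(f, f\<^sub>w, \<dots>) + \<dots>\<close>, where \<open>a\<close> is the jet of \<open>f\<close>.
\<close>

definition toda_rhs :: "nat \<Rightarrow> (nat \<Rightarrow> real fps) \<Rightarrow> nat \<Rightarrow> real" where
  "toda_rhs \<nu> a n =
     fps_nth (fps_const (toda_const \<nu>) * a 0 ^ \<nu> * a 1) n +
     (\<Sum>g=1..n. fps_nth (diff_poly \<nu> g a) (n - g))"

section \<open>The scheme\<close>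

definition scaled_term ::
    "nat \<Rightarrow> nat \<Rightarrow> (nat \<Rightarrow> real \<Rightarrow> real \<Rightarrow> real) \<Rightarrow> nat \<Rightarrow> real \<Rightarrow> real \<Rightarrow> real \<Rightarrow> real" where
  "scaled_term \<nu>1 \<nu>2 z g s1 s2 w =
     w powi (1 - 2 * int g) * z g (w ^ (\<nu>1 - 1) * s1) (w ^ (\<nu>2 - 1) * s2)"

definition scaled_jet ::
    "nat \<Rightarrow> nat \<Rightarrow> (nat \<Rightarrow> real \<Rightarrow> real \<Rightarrow> real) \<Rightarrow> real \<Rightarrow> real \<Rightarrow> real \<Rightarrow> nat \<Rightarrow> real fps" where
  "scaled_jet \<nu>1 \<nu>2 z s1 s2 w j =
     Abs_fps (\<lambda>g. (deriv ^^ j) (scaled_term \<nu>1 \<nu>2 z g s1 s2) w)"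

text \<open>
  The times only range over the closed quadrant \<open>s\<^sub>1, s\<^sub>2 \<le> 0\<close>, so derivatives in the
  times are one-sided on its boundary. \<open>D i j\<close> is the partial derivative of order \<open>i\<close>
  in the first and \<open>j\<close> in the second time.
\<close>

definition smooth_on_quadrant :: "(real \<Rightarrow> real \<Rightarrow> real) \<Rightarrow> bool" where
  "smooth_on_quadrant u \<longleftrightarrow>
     (\<exists>D :: nat \<Rightarrow> nat \<Rightarrow> real \<Rightarrow> real \<Rightarrow> real.
        (\<forall>s\<le>0. \<forall>t\<le>0. D 0 0 s t = u s t) \<and>
        (\<forall>i j. continuous_on ({..0} \<times> {..0}) (\<lambda>(s, t). D i j s t) \<and>
          (\<forall>s\<le>0. \<forall>t\<le>0.
             ((\<lambda>x. D i j x t) has_real_derivative D (Suc i) j s t) (at s within {..0}) \<and>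
             ((\<lambda>y. D i j s y) has_real_derivative D i (Suc j) s t) (at t within {..0}))))"

definition toda_scheme ::
    "nat \<Rightarrow> nat \<Rightarrow> (nat \<Rightarrow> real \<Rightarrow> real \<Rightarrow> real) \<Rightarrow> bool" where
  "toda_scheme \<nu>1 \<nu>2 z \<longleftrightarrow>
     (\<forall>s1\<le>0. \<forall>s2\<le>0. \<forall>n.
        ((\<lambda>s. scaled_term \<nu>1 \<nu>2 z n s s2 1) has_real_derivative
           toda_rhs \<nu>1 (scaled_jet \<nu>1 \<nu>2 z s1 s2 1) n) (at s1 within {..0}) \<and>
        ((\<lambda>s. scaled_term \<nu>1 \<nu>2 z n s1 s 1) has_real_derivative
           toda_rhs \<nu>2 (scaled_jet \<nu>1 \<nu>2 z s1 s2 1) n) (at s2 within {..0}))"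

definition toda_solution ::
    "nat \<Rightarrow> nat \<Rightarrow> (nat \<Rightarrow> real \<Rightarrow> real \<Rightarrow> real) \<Rightarrow> bool" where
  "toda_solution \<nu>1 \<nu>2 z \<longleftrightarrow>
     (\<forall>g. smooth_on_quadrant (z g)) \<and>
     z 0 0 0 = 1 \<and> (\<forall>g\<ge>1. z g 0 0 = 0) \<and>
     toda_scheme \<nu>1 \<nu>2 z"

end

theory Submission
  imports Defs
begin

text \<open>
  With \<open>w = n/k\<close> and \<open>\<epsilon> = 1/k\<close> the rescaled coefficients \<open>r\<^sub>n = b\<^sub>n\<^sup>2/k\<close> satisfy the string (Freud)
  equation \<open>r\<^sub>n - \<Sum>\<^sub>i 2\<nu>\<^sub>i s\<^sub>i (L\<^bsup>2\<nu>\<^sub>i-1\<^esup>)\<^bsub>n,n-1\<^esub> = w\<close>, where \<open>L\<close> is the Jacobi operator with entries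
  \<open>1\<close> above and \<open>r\<^sub>n\<close> below the diagonal. Solving it order by order in \<open>\<epsilon>\<close>, with \<open>r\<^bsub>n+l\<^esub>\<close> the formal
  Taylor shift \<open>f(w + l\<epsilon>)\<close>, gives coefficients \<open>f\<^sub>g\<close> that are smooth in \<open>w > 0\<close> and in the times;
  a reflection symmetry kills the odd orders.

  The formal solution is asymptotic to the true one: in the variables \<open>ln r\<^sub>n\<close> the string equation
  is the gradient of a sum of exponentials of linear forms with positive coefficients (all times
  are nonpositive), hence strictly monotone, and monotonicity on windows around \<open>k\<close> localizes by
  hole filling.

  The Toda vector field \<open>[L, (L\<^bsup>2\<nu>\<^esup>)\<^sub>-]\<close> and the time derivative of the formal solution satisfy the
  same linearized string equation, whose solution is unique; this is the scheme. Conversely, along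
  rays in the quadrant of times the scheme reduces to linear ordinary differential equations, which
  gives uniqueness.
\<close>

subsection \<open>Powers of a Jacobi operator\<close>

text \<open>Entries of powers of \<open>L\<close> are sums over walks: \<open>jpow r p n m\<close>
  runs over the walks of \<open>p\<close> unit steps from \<open>n\<close> to \<open>m\<close>, a
  down step from site \<open>l\<close> costing \<open>r l\<close>. Reading a tuple of the scheme as
  the times of \<open>\<nu>+1\<close> down steps makes \<open>level\<close> the site of each, so the
  sum over tuples is the entry \<open>(n, n-2)\<close> of \<open>L^(2\<nu>)\<close>, and the scheme
  is the Toda equation with \<open>r (n+l)\<close> replaced by a Taylor shift. The obstacle is that
  the expansion is only available for \<open>w = n/k\<close> bounded away from 0, whereas the string
  equation couples all sites down to 0. So truncated and true solution are compared on a window of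
  radius proportional to \<open>k\<close>. At its edge only crude bounds are known, which come from
  the sign of the times, but the contraction factor gained per layer, raised to a power of order
  \<open>k\<close>, beats every power of \<open>1/k\<close>. Homogeneity under scaling of
  \<open>w\<close>, the times and \<epsilon> has two uses: it identifies \<open>f_g(s; w)\<close>
  with the coefficients computed for all \<open>w > 0\<close>, and in the uniqueness part it trades
  \<open>f_w\<close> for time derivatives.\<close>

primrec jpow :: "(int \<Rightarrow> 'a::comm_ring_1) \<Rightarrow> nat \<Rightarrow> int \<Rightarrow> int \<Rightarrow> 'a" where
  "jpow r 0 n m = of_bool (n = m)"
| "jpow r (Suc p) n m = jpow r p (n + 1) m + r n * jpow r p (n - 1) m"

lemma jpow_Suc_right:
  "jpow r (Suc p) n m = jpow r p n (m - 1) + r (m + 1) * jpow r p n (m + 1)"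
proof (induction p arbitrary: n)
  case 0
  then show ?case by (auto simp: of_bool_def)
next
  case (Suc p)
  show ?case
    by (subst jpow.simps(2), subst (1 2) Suc) (simp add: algebra_simps)
qed

lemma jpow_band: "\<bar>n - m\<bar> > int p \<Longrightarrow> jpow r p n m = 0"
  by (induction p arbitrary: n) auto

lemma jpow_parity: "odd (int p + n - m) \<Longrightarrow> jpow r p n m = 0"
proof (induction p arbitrary: n)
  case (Suc p)
  have "odd (int p + (n + 1) - m)" "odd (int p + (n - 1) - m)"
    using Suc.prems by presburger+
  then show ?case by (simp add: Suc.IH)
qed auto

lemma jpow_cong:
  assumes "\<And>l. \<bar>l - n\<bar> \<le> int p \<Longrightarrow> r l = r' l"
  shows "jpow r p n m = jpow r' p n m"
  using assms
proof (induction p arbitrary: n)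
  case (Suc p)
  have "jpow r p (n + 1) m = jpow r' p (n + 1) m" "jpow r p (n - 1) m = jpow r' p (n - 1) m"
    by (intro Suc.IH Suc.prems; simp)+
  then show ?case using Suc.prems[of n] by simp
qed simp

lemma jpow_shift: "jpow (\<lambda>l. r (l + c)) p n m = jpow r p (n + c) (m + c)"
  by (induction p arbitrary: n) (simp_all add: algebra_simps)

text \<open>The number \<open>d\<close> counts down steps: every walk from \<open>n\<close> to
  \<open>m\<close> makes the same number of them, so it carries exactly \<open>d\<close> factors
  \<open>r\<close>.\<close>

lemma jpow_scale:
  "int p + n - m = 2 * int d \<Longrightarrow> jpow (\<lambda>l. c * r l) p n m = c ^ d * jpow r p n m"
proof (induction p arbitrary: n d)
  case (Suc p)
  have 1: "jpow (\<lambda>l. c * r l) p (n + 1) m = c ^ d * jpow r p (n + 1) m"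
    by (rule Suc.IH) (use Suc.prems in simp)
  show ?case
  proof (cases d)
    case 0
    then have "jpow r' p (n - 1) m = 0" for r' :: "int \<Rightarrow> 'a"
      by (intro jpow_band) (use Suc.prems in simp)
    then show ?thesis using 1 by simp
  next
    case (Suc d')
    have "jpow (\<lambda>l. c * r l) p (n - 1) m = c ^ d' * jpow r p (n - 1) m"
      by (rule Suc.IH) (use Suc.prems Suc in simp)
    then show ?thesis using 1 Suc by (simp add: algebra_simps)
  qed
qed (auto simp: of_bool_def)

text \<open>Reversing a walk and negating its sites turns a down step from \<open>l\<close> into a
  down step from \<open>1 - l\<close>. This symmetry is the source of the parity of the
  expansion.\<close>

lemma jpow_reflect: "jpow (\<lambda>l. r (1 - l)) p (- m) (- n) = jpow r p n m"
proof (induction p arbitrary: n)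
  case (Suc p)
  have "jpow (\<lambda>l. r (1 - l)) (Suc p) (- m) (- n)
      = jpow (\<lambda>l. r (1 - l)) p (- m) (- (n + 1)) + r n * jpow (\<lambda>l. r (1 - l)) p (- m) (- (n - 1))"
    unfolding jpow_Suc_right by (simp add: minus_add_distrib)
  then show ?case by (simp only: Suc jpow.simps)
qed (simp add: eq_commute)

text \<open>Reversing a walk exchanges up and down steps. A walk from \<open>n\<close> to
  \<open>m\<close> crosses the edge between \<open>j - 1\<close> and \<open>j\<close> downwards once
  more than upwards if m < j \<le> n, and equally often otherwise, so one factor \<open>r j\<close>
  remains per edge between the end points.\<close>

lemma jpow_transpose_step: "jpow r p (m + 1) m = r (m + 1) * jpow r p m (m + 1)"
  and jpow_transpose: "m \<le> n \<Longrightarrow> jpow r p n m = (\<Prod>j\<in>{m<..n}. r j) * jpow r p m n"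
proof -
  show *: "m \<le> n \<Longrightarrow> jpow r p n m = (\<Prod>j\<in>{m<..n}. r j) * jpow r p m n" for m n
  proof (induction p arbitrary: n)
    case 0
    then show ?case by (auto simp: of_bool_def)
  next
    case (Suc p)
    show ?case
    proof (cases "n = m")
      case False
      with Suc.prems have nm: "m < n" by simp
      have a: "{m<..n + 1} = insert (n + 1) {m<..n}" "{m<..n} = insert n {m<..n - 1}"
        using nm by auto
      have 1: "jpow r p (n + 1) m = r (n + 1) * (\<Prod>j\<in>{m<..n}. r j) * jpow r p m (n + 1)"
      proof -
        have "(\<Prod>j\<in>{m<..n + 1}. r j) = r (n + 1) * (\<Prod>j\<in>{m<..n}. r j)"
          by (subst a(1)) simp
        moreover have "jpow r p (n + 1) m = (\<Prod>j\<in>{m<..n + 1}. r j) * jpow r p m (n + 1)"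
          by (rule Suc.IH) (use nm in simp)
        ultimately show ?thesis by (simp only:)
      qed
      have 2: "jpow r p (n - 1) m = (\<Prod>j\<in>{m<..n - 1}. r j) * jpow r p m (n - 1)"
        using Suc.IH[of "n - 1"] nm by simp
      have 3: "(\<Prod>j\<in>{m<..n}. r j) = r n * (\<Prod>j\<in>{m<..n - 1}. r j)"
        by (subst a(2)) simp
      have "jpow r (Suc p) n m = (\<Prod>j\<in>{m<..n}. r j) * (jpow r p m (n - 1) + r (n + 1) * jpow r p m (n + 1))"
        unfolding jpow.simps(2) 1 2 using 3 by (simp only: algebra_simps)
      then show ?thesis by (simp only: jpow_Suc_right)
    qed simp
  qed
  show "jpow r p (m + 1) m = r (m + 1) * jpow r p m (m + 1)"
  proof -
    have "{m<..m + 1} = {m + 1}" by auto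
    then show ?thesis using *[of m "m + 1"] by simp
  qed
qed

lemma jpow_down: "jpow r p n (n - 1) = r n * jpow r p (n - 1) n"
  using jpow_transpose_step[of r p "n - 1"] by simp

lemma jpow_nonneg:
  fixes r :: "int \<Rightarrow> real"
  assumes "\<And>l. r l \<ge> 0"
  shows "jpow r p n m \<ge> 0"
  using assms by (induction p arbitrary: n) (auto simp: of_bool_def)

lemma jpow_hom:
  assumes "h 0 = 0" "h 1 = 1" "\<And>a b. h (a + b) = h a + h b" "\<And>a b. h (a * b) = h a * h b"
  shows "h (jpow r p n m) = jpow (\<lambda>l. h (r l)) p n m"
  using assms by (induction p arbitrary: n) (simp_all add: of_bool_def)

section \<open>The Jacobi operator on sequences, its variation, and commutators with lower
  triangular parts\<close>

definition jacobi :: "(int \<Rightarrow> 'a::comm_ring_1) \<Rightarrow> (int \<Rightarrow> 'a) \<Rightarrow> int \<Rightarrow> 'a" where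
  "jacobi r \<psi> n = \<psi> (n + 1) + r n * \<psi> (n - 1)"

lemma jacobi_pow:
  assumes "finite J" "{n - int p..n + int p} \<subseteq> J"
  shows "(jacobi r ^^ p) \<psi> n = (\<Sum>l\<in>J. jpow r p n l * \<psi> l)"
  using assms(2)
proof (induction p arbitrary: n)
  case 0
  have "(\<Sum>l\<in>J. jpow r 0 n l * \<psi> l) = (\<Sum>l\<in>J. if n = l then \<psi> l else 0)"
    by (intro sum.cong) auto
  then show ?case using assms(1) 0 by simp
next
  case (Suc p)
  have "(jacobi r ^^ p) \<psi> (n + 1) = (\<Sum>l\<in>J. jpow r p (n + 1) l * \<psi> l)"
       "(jacobi r ^^ p) \<psi> (n - 1) = (\<Sum>l\<in>J. jpow r p (n - 1) l * \<psi> l)"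
    by (rule Suc.IH, use Suc.prems in force)+
  then show ?case
    by (simp add: jacobi_def[of r "(jacobi r ^^ p) \<psi>"] sum_distrib_left sum.distrib algebra_simps)
qed

lemma jacobi_pow_delta: "(jacobi r ^^ p) (\<lambda>l. of_bool (l = m)) n = jpow r p n m"
  by (induction p arbitrary: n) (simp_all add: jacobi_def)

lemma jacobi_pow_jpow: "(jacobi r ^^ p) (\<lambda>l. jpow r q l m) n = jpow r (p + q) n m"
  by (induction p arbitrary: n) (simp_all add: jacobi_def)

lemma jpow_add:
  assumes "finite J" "{n - int p..n + int p} \<subseteq> J"
  shows "jpow r (p + q) n m = (\<Sum>l\<in>J. jpow r p n l * jpow r q l m)"
  using jacobi_pow[OF assms, of r "\<lambda>l. jpow r q l m"] by (simp add: jacobi_pow_jpow)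

text \<open>The derivative of \<open>jpow r p n m\<close> in the direction \<open>\<rho>\<close>,
  obtained by differentiating the recursion, hence available over every commutative ring.\<close>

primrec djpow :: "(int \<Rightarrow> 'a::comm_ring_1) \<Rightarrow> (int \<Rightarrow> 'a) \<Rightarrow> nat \<Rightarrow> int \<Rightarrow> int \<Rightarrow> 'a" where
  "djpow r \<rho> 0 n m = 0"
| "djpow r \<rho> (Suc p) n m =
     djpow r \<rho> p (n + 1) m + r n * djpow r \<rho> p (n - 1) m + \<rho> n * jpow r p (n - 1) m"

lemma djpow_diff: "djpow r (\<lambda>l. \<rho> l - \<sigma> l) p n m = djpow r \<rho> p n m - djpow r \<sigma> p n m"
proof (induction p arbitrary: n)
  case (Suc p)
  show ?case unfolding djpow.simps Suc by (simp add: algebra_simps)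
qed simp

lemma djpow_mult: "djpow r (\<lambda>l. c * \<rho> l) p n m = c * djpow r \<rho> p n m"
  by (induction p arbitrary: n) (simp_all add: algebra_simps)

lemma jpow_derivation:
  assumes "h 0 = 0" "h 1 = 0" "\<And>a b. h (a + b) = h a + h b" "\<And>a b. h (a * b) = h a * b + a * h b"
  shows "h (jpow r p n m) = djpow r (\<lambda>l. h (r l)) p n m"
proof (induction p arbitrary: n)
  case 0
  then show ?case using assms by (simp add: of_bool_def)
next
  case (Suc p)
  then show ?case by (simp add: assms(3,4) algebra_simps)
qed

text \<open>The Leibniz rule \<open>\<delta>(L^p) = \<Sum> L^i (\<delta>L) L^(p-1-i)\<close>, where
  \<open>\<delta>L\<close> has the entry \<open>\<rho> l\<close> at \<open>(l, l-1)\<close>.\<close>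

lemma djpow_expand:
  assumes "finite J" "\<And>l. l \<notin> J \<Longrightarrow> \<rho> l = 0"
  shows "djpow r \<rho> p n m = (\<Sum>i<p. \<Sum>l\<in>J. jpow r i n l * \<rho> l * jpow r (p - 1 - i) (l - 1) m)"
proof (induction p arbitrary: n)
  case (Suc p)
  have 0: "(\<Sum>l\<in>J. jpow r 0 n l * \<rho> l * jpow r (Suc p - 1 - 0) (l - 1) m) = \<rho> n * jpow r p (n - 1) m"
  proof -
    have "(\<Sum>l\<in>J. jpow r 0 n l * \<rho> l * jpow r (Suc p - 1 - 0) (l - 1) m)
        = (\<Sum>l\<in>J. if n = l then \<rho> n * jpow r p (n - 1) m else 0)"
      by (intro sum.cong) auto
    also have "\<dots> = \<rho> n * jpow r p (n - 1) m"
      using assms by (cases "n \<in> J") (simp_all)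
    finally show ?thesis .
  qed
  have "(\<Sum>i<Suc p. \<Sum>l\<in>J. jpow r i n l * \<rho> l * jpow r (Suc p - 1 - i) (l - 1) m)
      = \<rho> n * jpow r p (n - 1) m
        + (\<Sum>i<p. \<Sum>l\<in>J. jpow r (Suc i) n l * \<rho> l * jpow r (p - 1 - i) (l - 1) m)"
    unfolding sum.lessThan_Suc_shift 0 by simp
  then show ?case
    by (simp add: Suc sum_distrib_left sum.distrib algebra_simps)
qed simp

text \<open>The strictly lower triangular part \<open>M_-\<close> of a banded matrix, as an
  operator; the bandwidth \<open>K\<close> keeps the sum finite.\<close>

definition low :: "(int \<Rightarrow> int \<Rightarrow> 'a::comm_ring_1) \<Rightarrow> int \<Rightarrow> (int \<Rightarrow> 'a) \<Rightarrow> int \<Rightarrow> 'a" where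
  "low M K \<psi> n = (\<Sum>l\<in>{n - K..n - 1}. M n l * \<psi> l)"

lemma low_altdef:
  assumes "\<And>n l. \<bar>n - l\<bar> > K \<Longrightarrow> M n l = 0" "a \<le> n - K" "n - 1 \<le> b"
  shows "low M K \<psi> n = (\<Sum>l\<in>{a..b}. (if l < n then M n l else 0) * \<psi> l)"
  unfolding low_def
  by (rule sum.mono_neutral_cong_left) (use assms in \<open>auto\<close>)

text \<open>Because \<open>M\<close> commutes with \<open>L\<close>, \<open>[L, M_-]\<close> is
  minus the commutator of \<open>L\<close> with the rest of \<open>M\<close>. The former has no
  entries above the diagonal, the latter none below the first subdiagonal, so only two diagonals
  survive.\<close>

lemma jacobi_low_commutator:
  assumes band: "\<And>n l. \<bar>n - l\<bar> > K \<Longrightarrow> M n l = 0" and K: "K \<ge> 0"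
    and comm: "\<And>n l. M (n + 1) l + r n * M (n - 1) l = M n (l - 1) + r (l + 1) * M n (l + 1)"
  shows "jacobi r (low M K \<psi>) n = low M K (jacobi r \<psi>) n
     + (M (n + 1) n - M n (n - 1)) * \<psi> n + (M (n + 1) (n - 1) - M n (n - 2)) * \<psi> (n - 1)"
proof -
  define J where "J = {n - K - 3..n + 3}"
  \<comment> \<open>Column before row: \<open>c l n\<close> is the entry of \<open>M_-\<close> in
    row \<open>n\<close> and column \<open>l\<close>.\<close>
  define c where "c l n = (if l < n then M n l else 0)" for l n :: int
  have L1: "low M K \<psi> (n + 1) = (\<Sum>l\<in>J. c l (n + 1) * \<psi> l)"
    and L2: "low M K \<psi> (n - 1) = (\<Sum>l\<in>J. c l (n - 1) * \<psi> l)"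
    unfolding J_def c_def by (intro low_altdef band; simp)+
  have "low M K (jacobi r \<psi>) n = (\<Sum>l\<in>{n - K - 2..n + 2}. c l n * (\<psi> (l + 1) + r l * \<psi> (l - 1)))"
    unfolding c_def by (subst low_altdef[of K M "n - K - 2" n "n + 2"]) (simp_all add: jacobi_def band)
  also have "\<dots> = (\<Sum>l\<in>{n - K - 2..n + 2}. c l n * \<psi> (l + 1)) + (\<Sum>l\<in>{n - K - 2..n + 2}. c l n * r l * \<psi> (l - 1))"
    by (simp add: sum.distrib algebra_simps)
  also have "(\<Sum>l\<in>{n - K - 2..n + 2}. c l n * \<psi> (l + 1)) = (\<Sum>l\<in>{n - K - 1..n + 3}. c (l - 1) n * \<psi> l)"
    by (rule sum.reindex_bij_witness[of _ "\<lambda>l. l - 1" "\<lambda>l. l + 1"]) auto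
  also have "\<dots> = (\<Sum>l\<in>J. c (l - 1) n * \<psi> l)"
    unfolding J_def by (rule sum.mono_neutral_left) (auto simp: c_def band)
  also have "(\<Sum>l\<in>{n - K - 2..n + 2}. c l n * r l * \<psi> (l - 1)) = (\<Sum>l\<in>{n - K - 3..n + 1}. c (l + 1) n * r (l + 1) * \<psi> l)"
    by (rule sum.reindex_bij_witness[of _ "\<lambda>l. l + 1" "\<lambda>l. l - 1"]) auto
  also have "\<dots> = (\<Sum>l\<in>J. c (l + 1) n * r (l + 1) * \<psi> l)"
    unfolding J_def by (rule sum.mono_neutral_left) (auto simp: c_def)
  finally have R: "low M K (jacobi r \<psi>) n = (\<Sum>l\<in>J. (c (l - 1) n + c (l + 1) n * r (l + 1)) * \<psi> l)"
    by (simp add: sum.distrib algebra_simps)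
  have "jacobi r (low M K \<psi>) n - low M K (jacobi r \<psi>) n
     = (\<Sum>l\<in>J. (c l (n + 1) + r n * c l (n - 1) - c (l - 1) n - c (l + 1) n * r (l + 1)) * \<psi> l)"
    unfolding jacobi_def[of r "low M K \<psi>"] L1 L2 R
    by (simp add: sum.distrib sum_subtractf sum_distrib_left ring_distribs mult.assoc)
  \<comment> \<open>Above the diagonal all four terms vanish; below the first subdiagonal none is
    cut off and they cancel by \<open>comm\<close>.\<close>
  also have "\<dots> = (\<Sum>l\<in>J. (if l = n then (M (n + 1) n - M n (n - 1)) * \<psi> n else 0)
      + (if l = n - 1 then (M (n + 1) (n - 1) - M n (n - 2)) * \<psi> (n - 1) else 0))"
  proof (intro sum.cong refl, goal_cases)
    case (1 l)
    consider "l > n" | "l = n" | "l = n - 1" | "l < n - 1" by linarith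
    then show ?case
    proof cases
      case 4
      then show ?thesis using comm[of n l] by (simp add: c_def algebra_simps)
    qed (auto simp: c_def)
  qed
  also have "\<dots> = (M (n + 1) n - M n (n - 1)) * \<psi> n + (M (n + 1) (n - 1) - M n (n - 2)) * \<psi> (n - 1)"
    using K by (simp add: sum.distrib J_def)
  finally show ?thesis by (simp add: algebra_simps)
qed

subsection \<open>The Toda flow and the string equation\<close>

lemma low_add: "low M K (\<lambda>l. \<psi> l + \<phi> l) n = low M K \<psi> n + low M K \<phi> n"
  by (simp add: low_def sum.distrib algebra_simps)

lemma jacobi_add: "jacobi r (\<lambda>l. \<psi> l + \<phi> l) n = jacobi r \<psi> n + jacobi r \<phi> n"
  and jacobi_mult: "jacobi r (\<lambda>l. c * \<psi> l) n = c * jacobi r \<psi> n"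
  by (simp_all add: jacobi_def algebra_simps)

text \<open>With \<open>B = low M K\<close> this reads \<open>[L\<^sup>p, B] = \<Sum> L\<^sup>i [L, B] L\<^bsup>p-1-i\<^esup>\<close>,
  and for a scalar commutator \<open>\<epsilon>\<close> it is \<open>p \<epsilon> L\<^bsup>p-1\<^esup>\<close>.\<close>

lemma jacobi_pow_low_scalar:
  assumes "\<And>\<psi> n. jacobi r (low M K \<psi>) n = low M K (jacobi r \<psi>) n + e * \<psi> n"
  shows "(jacobi r ^^ p) (low M K \<psi>) n
     = low M K ((jacobi r ^^ p) \<psi>) n + of_nat p * e * (jacobi r ^^ (p - 1)) \<psi> n"
proof (induction p arbitrary: n)
  case (Suc p)
  have "(jacobi r ^^ Suc p) (low M K \<psi>) n = jacobi r ((jacobi r ^^ p) (low M K \<psi>)) n" by simp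
  also have "(jacobi r ^^ p) (low M K \<psi>) = (\<lambda>n. low M K ((jacobi r ^^ p) \<psi>) n + of_nat p * e * (jacobi r ^^ (p - 1)) \<psi> n)"
    using Suc by (intro ext)
  also have "jacobi r (\<lambda>n. low M K ((jacobi r ^^ p) \<psi>) n + of_nat p * e * (jacobi r ^^ (p - 1)) \<psi> n) n = low M K (jacobi r ((jacobi r ^^ p) \<psi>)) n + e * (jacobi r ^^ p) \<psi> n
      + of_nat p * e * jacobi r ((jacobi r ^^ (p - 1)) \<psi>) n"
    using assms by (simp add: jacobi_add jacobi_mult)
  also have "of_nat p * e * jacobi r ((jacobi r ^^ (p - 1)) \<psi>) n = of_nat p * e * (jacobi r ^^ p) \<psi> n"
    by (cases p) simp_all
  finally show ?case by (simp add: algebra_simps)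
qed simp

text \<open>The hypothesis says that the variation \<open>q\<close> of \<open>L\<close> is
  \<open>[L, B]\<close> with \<open>B = low M K\<close>. Commutation with \<open>B\<close> is a
  derivation, so the induced variation of \<open>L^p\<close> is \<open>[L^p, B]\<close>, here
  applied to the unit vector at \<open>m\<close>.\<close>

lemma djpow_commutator:
  assumes "\<And>\<psi> n. jacobi r (low M K \<psi>) n = low M K (jacobi r \<psi>) n + q n * \<psi> (n - 1)"
  shows "djpow r q p n m
     = (jacobi r ^^ p) (low M K (\<lambda>l. of_bool (l = m))) n - low M K (\<lambda>l. jpow r p l m) n"
proof (induction p arbitrary: n)
  case (Suc p)
  have "djpow r q (Suc p) n m = jacobi r (\<lambda>n. djpow r q p n m) n + q n * jpow r p (n - 1) m"
    by (simp add: jacobi_def)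
  also have "(\<lambda>n. djpow r q p n m)
     = (\<lambda>n. (jacobi r ^^ p) (low M K (\<lambda>l. of_bool (l = m))) n + (-1) * low M K (\<lambda>l. jpow r p l m) n)"
    by (simp add: Suc)
  also have "jacobi r (\<lambda>n. (jacobi r ^^ p) (low M K (\<lambda>l. of_bool (l = m))) n + (-1) * low M K (\<lambda>l. jpow r p l m) n) n + q n * jpow r p (n - 1) m = (jacobi r ^^ Suc p) (low M K (\<lambda>l. of_bool (l = m))) n
     - low M K (jacobi r (\<lambda>l. jpow r p l m)) n"
    unfolding jacobi_add jacobi_mult using assms[of "\<lambda>l. jpow r p l m" n] by simp
  also have "jacobi r (\<lambda>l. jpow r p l m) = (\<lambda>l. jpow r (Suc p) l m)"
    by (rule ext) (simp add: jacobi_def)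
  finally show ?case .
qed (simp add: of_bool_def)

text \<open>The Toda flow of \<open>L\<^sup>p\<close> preserves the string equation: with \<open>V = \<Sum> v\<^sub>i L\<^bsup>d\<^sub>i\<^esup>\<close>,
  the string equation says \<open>[L, V\<^sub>-] = \<epsilon>\<close>, while the flow is \<open>dL = [L, (L\<^sup>p)\<^sub>-]\<close>; then
  \<open>dV = [V, (L\<^sup>p)\<^sub>-]\<close>, and since \<open>V\<close> and \<open>L\<^sup>p\<close> commute, its entry at \<open>(n, n-1)\<close>
  is that of \<open>[L\<^sup>p, V\<^sub>-] = p \<epsilon> L\<^bsup>p-1\<^esup>\<close>.\<close>

lemma toda_flow_string:
  fixes r :: "int \<Rightarrow> 'a::comm_ring_1"
  assumes I: "finite I" and odd: "\<And>i. i \<in> I \<Longrightarrow> odd (d i)" and p: "even p"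
    and string: "\<And>n. (\<Sum>i\<in>I. v i * jpow r (d i) (n + 1) n) = (\<Sum>i\<in>I. v i * jpow r (d i) n (n - 1)) + e"
  shows "(\<Sum>i\<in>I. v i * djpow r (\<lambda>n. jpow r p (n + 1) (n - 1) - jpow r p n (n - 2)) (d i) n (n - 1))
     = of_nat p * e * jpow r (p - 1) n (n - 1)"
proof -
  \<comment> \<open>\<open>K\<close> bounds the bandwidth of \<open>L^p\<close> and of all the
    \<open>L^(d i)\<close> at once.\<close>
  define K where "K = int p + (\<Sum>i\<in>I. int (d i))"
  have Kp: "int p \<le> K" "K \<ge> 0" by (simp_all add: K_def sum_nonneg)
  have Kd: "int (d i) \<le> K" if "i \<in> I" for i
  proof -
    have "int (d i) \<le> (\<Sum>i\<in>I. int (d i))" by (rule member_le_sum) (use I that in auto)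
    then show ?thesis by (simp add: K_def)
  qed
  define V where "V n m = (\<Sum>i\<in>I. v i * jpow r (d i) n m)" for n m
  define A where "A = jpow r p"
  define q where "q n = A (n + 1) (n - 1) - A n (n - 2)" for n
  have Vband: "V n l = 0" if "\<bar>n - l\<bar> > K" for n l
    unfolding V_def by (intro sum.neutral ballI) (use Kd that in \<open>fastforce simp: jpow_band\<close>)
  have Aband: "A n l = 0" if "\<bar>n - l\<bar> > K" for n l
    unfolding A_def by (rule jpow_band) (use Kp that in linarith)
  have comm: "jpow r p (n + 1) l + r n * jpow r p (n - 1) l = jpow r p n (l - 1) + r (l + 1) * jpow r p n (l + 1)" for p n l
    by (simp only: jpow.simps(2)[symmetric] jpow_Suc_right[symmetric])
  have Vcomm: "V (n + 1) l + r n * V (n - 1) l = V n (l - 1) + r (l + 1) * V n (l + 1)" for n l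
  proof -
    have "V (n + 1) l + r n * V (n - 1) l = (\<Sum>i\<in>I. v i * (jpow r (d i) (n + 1) l + r n * jpow r (d i) (n - 1) l))"
      by (simp add: V_def sum_distrib_left sum.distrib algebra_simps)
    also have "\<dots> = V n (l - 1) + r (l + 1) * V n (l + 1)"
      unfolding comm by (simp add: V_def sum_distrib_left sum.distrib algebra_simps)
    finally show ?thesis .
  qed
  \<comment> \<open>Odd powers have no entries at even distance from the diagonal, so only the
    diagonal part of the commutator remains, and the string equation makes it the scalar
    \<open>e\<close>.\<close>
  have LP: "jacobi r (low V K \<psi>) n = low V K (jacobi r \<psi>) n + e * \<psi> n" for \<psi> n
  proof -
    have "V (n + 1) (n - 1) = 0" "V n (n - 2) = 0"
      unfolding V_def by (intro sum.neutral ballI; use odd in \<open>simp add: jpow_parity\<close>)+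
    then show ?thesis
      using jacobi_low_commutator[of K V r \<psi> n, OF Vband Kp(2) Vcomm] string[of n] by (simp add: V_def)
  qed
  \<comment> \<open>For an even power the diagonal part vanishes instead, and the subdiagonal part
    is the flow \<open>q\<close>.\<close>
  have LB: "jacobi r (low A K \<psi>) n = low A K (jacobi r \<psi>) n + q n * \<psi> (n - 1)" for \<psi> n
  proof -
    have "A (n + 1) n = 0" "A n (n - 1) = 0" using p by (simp_all add: A_def jpow_parity)
    then show ?thesis
      using jacobi_low_commutator[of K A r \<psi> n, OF Aband Kp(2)] comm by (simp add: A_def q_def)
  qed
  define J where "J = {n - K..n + K + 1}"
  have J: "finite J" "\<And>i. i \<in> I \<Longrightarrow> {n - int (d i)..n + int (d i)} \<subseteq> J" "{n - int p..n + int p} \<subseteq> J"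
    using Kd Kp by (auto simp: J_def) fastforce+
  have Lp: "(\<Sum>i\<in>I. v i * (jacobi r ^^ d i) \<psi> n) = (\<Sum>l\<in>J. V n l * \<psi> l)" for \<psi>
  proof -
    have "(\<Sum>i\<in>I. v i * (jacobi r ^^ d i) \<psi> n) = (\<Sum>i\<in>I. \<Sum>l\<in>J. v i * jpow r (d i) n l * \<psi> l)"
      by (intro sum.cong refl) (use J in \<open>simp add: jacobi_pow[of J] sum_distrib_left mult.assoc\<close>)
    also have "\<dots> = (\<Sum>l\<in>J. V n l * \<psi> l)"
      by (subst sum.swap) (simp add: V_def sum_distrib_right)
    finally show ?thesis .
  qed
  have Ap: "(jacobi r ^^ p) \<psi> n = (\<Sum>l\<in>J. A n l * \<psi> l)" for \<psi>
    unfolding A_def by (rule jacobi_pow) (use J in auto)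
  define \<delta> where "\<delta> = (\<lambda>l. of_bool (l = n - 1) :: 'a)"
  have lowJ: "low M K \<psi> n = (\<Sum>l\<in>J. if l < n then M n l * \<psi> l else 0)"
    if "\<And>n l. \<bar>n - l\<bar> > K \<Longrightarrow> M n l = 0" for M \<psi>
    unfolding J_def by (subst low_altdef[of K M "n - K" n "n + K + 1"]) (use that Kp in \<open>auto intro!: sum.cong\<close>)
  have lowdelta: "low M K \<delta> l = (if l \<ge> n then M l (n - 1) else 0)"
    if "\<And>n l. \<bar>n - l\<bar> > K \<Longrightarrow> M n l = 0" for M l
  proof -
    have "low M K \<delta> l = (\<Sum>j\<in>{l - K..l - 1}. if j = n - 1 then M l (n - 1) else 0)"
      unfolding low_def \<delta>_def by (intro sum.cong) auto
    also have "\<dots> = (if l \<ge> n then M l (n - 1) else 0)"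
      using that[of l "n - 1"] by auto
    finally show ?thesis .
  qed
  have pwd: "(\<lambda>l. jpow r (d i) l (n - 1)) = (jacobi r ^^ d i) \<delta>" for i
    unfolding \<delta>_def by (rule ext) (simp add: jacobi_pow_delta)
  have dV: "(\<Sum>i\<in>I. v i * djpow r q (d i) n (n - 1))
      = (\<Sum>l\<in>J. V n l * low A K \<delta> l) - low A K (\<lambda>l. V l (n - 1)) n"
  proof -
    have "(\<Sum>i\<in>I. v i * djpow r q (d i) n (n - 1))
       = (\<Sum>i\<in>I. v i * (jacobi r ^^ d i) (low A K \<delta>) n) - (\<Sum>i\<in>I. v i * low A K (\<lambda>l. jpow r (d i) l (n - 1)) n)"
      unfolding \<delta>_def by (simp add: djpow_commutator[OF LB] sum_subtractf algebra_simps)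
    also have "(\<Sum>i\<in>I. v i * low A K (\<lambda>l. jpow r (d i) l (n - 1)) n) = low A K (\<lambda>l. V l (n - 1)) n"
      unfolding low_def V_def sum_distrib_left
      by (subst sum.swap) (intro sum.cong refl, simp add: algebra_simps)
    finally show ?thesis by (simp only: Lp)
  qed
  have AP: "(\<Sum>l\<in>J. A n l * low V K \<delta> l) - low V K (\<lambda>l. A l (n - 1)) n = of_nat p * e * jpow r (p - 1) n (n - 1)"
  proof -
    have "(jacobi r ^^ p) \<delta> = (\<lambda>l. A l (n - 1))"
      unfolding \<delta>_def A_def by (rule ext) (simp add: jacobi_pow_delta)
    then show ?thesis
      using jacobi_pow_low_scalar[of r V K e p \<delta> n, OF LP]
      by (simp add: Ap[symmetric]) (simp add: \<delta>_def jacobi_pow_delta)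
  qed
  have VA: "(\<Sum>l\<in>J. V n l * A l (n - 1)) = (\<Sum>l\<in>J. A n l * V l (n - 1))"
  proof -
    have "(\<Sum>l\<in>J. V n l * A l (n - 1)) = (\<Sum>i\<in>I. v i * (jacobi r ^^ d i) (\<lambda>l. A l (n - 1)) n)"
      by (simp only: Lp)
    also have "\<dots> = (\<Sum>i\<in>I. v i * (jacobi r ^^ p) (\<lambda>l. jpow r (d i) l (n - 1)) n)"
      unfolding A_def jacobi_pow_jpow by (simp add: add.commute)
    also have "\<dots> = (\<Sum>i\<in>I. \<Sum>l\<in>J. A n l * (v i * jpow r (d i) l (n - 1)))"
      by (simp add: Ap sum_distrib_left algebra_simps)
    also have "\<dots> = (\<Sum>l\<in>J. A n l * V l (n - 1))"
      by (subst sum.swap) (simp add: V_def sum_distrib_left)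
    finally show ?thesis .
  qed
  have split: "(\<Sum>l\<in>J. f l) = (\<Sum>l\<in>J. if l \<ge> n then f l else 0) + (\<Sum>l\<in>J. if l < n then f l else 0)" for f :: "int \<Rightarrow> 'a"
    by (subst sum.distrib[symmetric]) (intro sum.cong, auto)
  have lA: "low A K \<delta> l = (if l \<ge> n then A l (n - 1) else 0)" for l
    by (rule lowdelta, rule Aband)
  have lV: "low V K \<delta> l = (if l \<ge> n then V l (n - 1) else 0)" for l
    by (rule lowdelta, rule Vband)
  have lAJ: "low A K \<psi> n = (\<Sum>l\<in>J. if l < n then A n l * \<psi> l else 0)" for \<psi>
    by (rule lowJ, rule Aband)
  have lVJ: "low V K \<psi> n = (\<Sum>l\<in>J. if l < n then V n l * \<psi> l else 0)" for \<psi>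
    by (rule lowJ, rule Vband)
  \<comment> \<open>Split at \<open>n\<close>: the left side is the part \<open>l \<ge> n\<close> of
    \<open>V A\<close> minus the part \<open>l < n\<close> of \<open>A V\<close>; the right side is
    the same with \<open>V\<close> and \<open>A\<close> exchanged. The two sides differ by the full
    entries of \<open>V A\<close> and \<open>A V\<close>, which agree by \<open>VA\<close>.\<close>
  have "(\<Sum>l\<in>J. V n l * low A K \<delta> l) - low A K (\<lambda>l. V l (n - 1)) n
      = (\<Sum>l\<in>J. A n l * low V K \<delta> l) - low V K (\<lambda>l. A l (n - 1)) n"
    using VA split[of "\<lambda>l. V n l * A l (n - 1)"] split[of "\<lambda>l. A n l * V l (n - 1)"]
    unfolding lA lV lAJ lVJ
    by (simp add: if_distrib[of "\<lambda>x. _ * x"] algebra_simps cong: if_cong)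
  with dV AP have "(\<Sum>i\<in>I. v i * djpow r q (d i) n (n - 1)) = of_nat p * e * jpow r (p - 1) n (n - 1)"
    by (simp only:)
  moreover have "q = (\<lambda>n. jpow r p (n + 1) (n - 1) - jpow r p n (n - 2))"
    by (rule ext) (simp add: q_def A_def)
  ultimately show ?thesis by (simp only:)
qed

subsection \<open>Walk expansions\<close>

text \<open>With constant weight every walk contributes \<open>y^d\<close>, and the binomial
  coefficient counts the positions of its \<open>d\<close> down steps.\<close>

lemma jpow_const: "m = n + int p - 2 * int d \<Longrightarrow> jpow (\<lambda>_. y) p n m = of_nat (p choose d) * y ^ d"
proof (induction p arbitrary: n d)
  case 0
  then show ?case by (cases d) auto
next
  case (Suc p)
  have 1: "jpow (\<lambda>_. y) p (n + 1) m = of_nat (p choose d) * y ^ d"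
    by (rule Suc.IH) (use Suc.prems in simp)
  show ?case
  proof (cases d)
    case 0
    then have "jpow (\<lambda>_. y) p (n - 1) m = 0"
      by (intro jpow_band) (use Suc.prems in simp)
    then show ?thesis using 1 0 by simp
  next
    case (Suc d')
    have "jpow (\<lambda>_. y) p (n - 1) m = of_nat (p choose d') * y ^ d'"
      by (rule Suc.IH) (use Suc.prems Suc in simp)
    then show ?thesis using 1 Suc by (simp add: algebra_simps)
  qed
qed

lemma djpow_band: "\<bar>n - m\<bar> > int p \<Longrightarrow> djpow r \<rho> p n m = 0"
  by (induction p arbitrary: n) (auto simp: jpow_band)

lemma djpow_const:
  "m = n + int p - 2 * int d \<Longrightarrow>
     djpow (\<lambda>_. y) (\<lambda>_. a) p n m = of_nat (d * (p choose d)) * y ^ (d - 1) * a"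
proof (induction p arbitrary: n d)
  case 0
  then show ?case by (cases d) auto
next
  case (Suc p)
  have 1: "djpow (\<lambda>_. y) (\<lambda>_. a) p (n + 1) m = of_nat (d * (p choose d)) * y ^ (d - 1) * a"
    by (rule Suc.IH) (use Suc.prems in simp)
  show ?case
  proof (cases d)
    case 0
    then have "djpow (\<lambda>_. y) (\<lambda>_. a) p (n - 1) m = 0" "jpow (\<lambda>_. y) p (n - 1) m = 0"
      by (intro djpow_band jpow_band; use Suc.prems in simp)+
    then show ?thesis using 1 0 by simp
  next
    case (Suc d')
    have 2: "djpow (\<lambda>_. y) (\<lambda>_. a) p (n - 1) m = of_nat (d' * (p choose d')) * y ^ (d' - 1) * a"
      by (rule Suc.IH) (use Suc.prems Suc in simp)
    have 3: "jpow (\<lambda>_. y) p (n - 1) m = of_nat (p choose d') * y ^ d'"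
      by (rule jpow_const) (use Suc.prems Suc in simp)
    have "y * (of_nat (d' * (p choose d')) * y ^ (d' - 1) * a) = of_nat (d' * (p choose d')) * y ^ d' * a"
      by (cases d') (simp_all add: algebra_simps)
    then show ?thesis unfolding djpow.simps 1 2 3 using Suc
      by (simp add: algebra_simps)
  qed
qed

text \<open>The remainder stays in the ring, so \<open>e\<close> may be a power of a formal variable
  whose coefficients are then compared.\<close>

lemma jpow_perturb: "\<exists>c. jpow (\<lambda>l. r l + e * \<rho> l) p n m = jpow r p n m + e * djpow r \<rho> p n m + e\<^sup>2 * c"
proof (induction p arbitrary: n)
  case 0
  then show ?case by (intro exI[of _ 0]) simp
next
  case (Suc p)
  obtain c1 where 1: "jpow (\<lambda>l. r l + e * \<rho> l) p (n + 1) m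
      = jpow r p (n + 1) m + e * djpow r \<rho> p (n + 1) m + e\<^sup>2 * c1" using Suc by blast
  obtain c2 where 2: "jpow (\<lambda>l. r l + e * \<rho> l) p (n - 1) m
      = jpow r p (n - 1) m + e * djpow r \<rho> p (n - 1) m + e\<^sup>2 * c2" using Suc by blast
  show ?case unfolding jpow.simps djpow.simps 1 2
    by (intro exI[of _ "c1 + r n * c2 + \<rho> n * djpow r \<rho> p (n - 1) m + e * \<rho> n * c2"])
       (simp add: algebra_simps power2_eq_square)
qed

lemma djpow_hom:
  assumes "h 0 = 0" "h 1 = 1" "\<And>a b. h (a + b) = h a + h b" "\<And>a b. h (a * b) = h a * h b"
  shows "h (djpow r \<rho> p n m) = djpow (\<lambda>l. h (r l)) (\<lambda>l. h (\<rho> l)) p n m"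
  by (induction p arbitrary: n) (simp_all add: assms(1,3,4) jpow_hom[of h, OF assms])

text \<open>The times of the \<open>d\<close> down steps in a walk of \<open>p\<close>
  steps.\<close>

definition incr_tuples :: "nat \<Rightarrow> nat \<Rightarrow> (nat \<Rightarrow> nat) set" where
  "incr_tuples p d = {j \<in> {1..d} \<rightarrow>\<^sub>E {1..p}. strict_mono_on {1..d} j}"

lemma finite_incr_tuples: "finite (incr_tuples p d)"
  unfolding incr_tuples_def by (rule finite_subset[of _ "{1..d} \<rightarrow>\<^sub>E {1..p}"]) (auto intro: finite_PiE)

text \<open>The last step of a walk of length \<open>Suc p\<close> is either up, and then
  \<open>Suc p\<close> is not among the times, or down, and then it is the largest of them.\<close>

lemma incr_tuples_Suc:
  "incr_tuples (Suc p) (Suc d) = incr_tuples p (Suc d) \<union> (\<lambda>j. j(Suc d := Suc p)) ` incr_tuples p d"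
  (is "?A = ?B \<union> ?C")
proof (intro equalityI subsetI)
  fix j assume j: "j \<in> ?A"
  then have jP: "j \<in> {1..Suc d} \<rightarrow>\<^sub>E {1..Suc p}" and mono: "strict_mono_on {1..Suc d} j"
    by (auto simp: incr_tuples_def)
  have lt: "j m < j (Suc d)" if "m \<in> {1..d}" for m
    using strict_mono_onD[OF mono, of m "Suc d"] that by auto
  have last: "j (Suc d) \<in> {1..Suc p}" using jP by (auto simp: PiE_iff)
  show "j \<in> ?B \<union> ?C"
  proof (cases "j (Suc d) = Suc p")
    case True
    define i where "i = restrict j {1..d}"
    have "i \<in> incr_tuples p d"
    proof -
      have "i \<in> {1..d} \<rightarrow>\<^sub>E {1..p}"
        using jP lt True by (force simp: i_def PiE_iff)
      moreover have "strict_mono_on {1..d} i"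
        using mono by (auto simp: i_def strict_mono_on_def)
      ultimately show ?thesis by (simp add: incr_tuples_def)
    qed
    moreover have "j = i(Suc d := Suc p)"
    proof
      fix x
      show "j x = (i(Suc d := Suc p)) x"
        using True jP by (cases "x \<in> {1..Suc d}") (auto simp: i_def PiE_iff extensional_def)
    qed
    ultimately show ?thesis by blast
  next
    case False
    then have "j (Suc d) \<le> p" using last by auto
    then have "j \<in> {1..Suc d} \<rightarrow>\<^sub>E {1..p}"
      using jP lt by (force simp: PiE_iff le_Suc_eq)
    then show ?thesis using mono by (simp add: incr_tuples_def)
  qed
next
  fix j assume "j \<in> ?B \<union> ?C"
  then show "j \<in> ?A"
  proof
    assume "j \<in> ?B"
    then show ?thesis by (force simp: incr_tuples_def PiE_iff)
  next
    assume "j \<in> ?C"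
    then obtain i where i: "i \<in> incr_tuples p d" and ji: "j = i(Suc d := Suc p)" by blast
    have iP: "i m \<in> {1..p}" if "m \<in> {1..d}" for m using i that by (auto simp: incr_tuples_def PiE_iff)
    have "j \<in> {1..Suc d} \<rightarrow>\<^sub>E {1..Suc p}"
      using i iP unfolding ji by (force simp: incr_tuples_def PiE_iff extensional_def)
    moreover have "strict_mono_on {1..Suc d} j"
      unfolding strict_mono_on_def
    proof (intro allI impI, elim conjE)
      fix a b assume ab: "a \<in> {1..Suc d}" "b \<in> {1..Suc d}" "a < b"
      show "j a < j b"
      proof (cases "b = Suc d")
        case True
        then show ?thesis using ab iP[of a] by (auto simp: ji)
      next
        case False
        then show ?thesis using ab i strict_mono_onD[of "{1..d}" i a b] by (auto simp: ji incr_tuples_def)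
      qed
    qed
    ultimately show ?thesis by (simp add: incr_tuples_def)
  qed
qed

text \<open>Just before its down step number \<open>m\<close>, at time \<open>j m\<close>, the
  walker has made \<open>j m - m\<close> up steps and \<open>m - 1\<close> down steps, so it stands
  at \<open>n + (j m - 2 m + 1)\<close>.\<close>

lemma sum_incr_tuples:
  fixes r :: "int \<Rightarrow> 'a::comm_ring_1"
  shows "(\<Sum>j\<in>incr_tuples p d. \<Prod>m=1..d. r (n + (int (j m) - 2 * int m + 1)))
     = jpow r p n (n + int p - 2 * int d)"
proof (induction p arbitrary: d)
  case 0
  show ?case
  proof (cases d)
    case 0
    then show ?thesis by (simp add: incr_tuples_def strict_mono_on_def)
  next
    case (Suc d')
    then have "incr_tuples 0 d = {}" by (auto simp: incr_tuples_def PiE_iff)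
    then show ?thesis using Suc by simp
  qed
next
  case (Suc p)
  show ?case
  proof (cases d)
    case 0
    have "jpow r (Suc p) n (n + int (Suc p)) = 1" for p
    proof -
      have "m = n + int q \<Longrightarrow> jpow r q n m = 1" for q n m
        by (induction q arbitrary: n) (simp_all add: jpow_band)
      then show ?thesis by blast
    qed
    then show ?thesis using 0 by (simp add: incr_tuples_def strict_mono_on_def)
  next
    case (Suc d')
    let ?f = "\<lambda>d j. \<Prod>m=1..d. r (n + (int (j m) - 2 * int m + 1))"
    have inj: "inj_on (\<lambda>j. j(Suc d' := Suc p)) (incr_tuples p d')"
    proof (rule inj_onI)
      fix i j assume ij: "i \<in> incr_tuples p d'" "j \<in> incr_tuples p d'"
        "i(Suc d' := Suc p) = j(Suc d' := Suc p)"
      have "i x = j x" for x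
      proof (cases "x = Suc d'")
        case True
        then show ?thesis using ij(1,2) by (auto simp: incr_tuples_def PiE_iff extensional_def)
      next
        case False
        then show ?thesis using fun_cong[OF ij(3), of x] by simp
      qed
      then show "i = j" by blast
    qed
    have disj: "incr_tuples p (Suc d') \<inter> (\<lambda>j. j(Suc d' := Suc p)) ` incr_tuples p d' = {}"
      by (force simp: incr_tuples_def PiE_iff)
    have "(\<Sum>j\<in>incr_tuples (Suc p) (Suc d'). ?f (Suc d') j)
       = (\<Sum>j\<in>incr_tuples p (Suc d'). ?f (Suc d') j)
         + (\<Sum>j\<in>incr_tuples p d'. ?f (Suc d') (j(Suc d' := Suc p)))"
      unfolding incr_tuples_Suc
      by (subst sum.union_disjoint) (simp_all add: finite_incr_tuples disj sum.reindex[OF inj] del: fun_upd_apply)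
    also have "(\<Sum>j\<in>incr_tuples p d'. ?f (Suc d') (j(Suc d' := Suc p)))
        = (\<Sum>j\<in>incr_tuples p d'. r (n + int p - 2 * int d') * ?f d' j)"
      by (intro sum.cong refl) (simp add: prod.nat_ivl_Suc' algebra_simps)
    also have "\<dots> = r (n + int p - 2 * int d') * jpow r p n (n + int p - 2 * int d')"
      by (simp only: sum_distrib_left[symmetric] Suc.IH)
    also have "(\<Sum>j\<in>incr_tuples p (Suc d'). ?f (Suc d') j) = jpow r p n (n + int p - 2 * int (Suc d'))"
      by (rule Suc.IH)
    finally show ?thesis unfolding Suc jpow_Suc_right by (simp add: algebra_simps)
  qed
qed

text \<open>A tuple of the scheme has \<open>\<nu> + 1\<close> down steps among
  \<open>2 \<nu>\<close>, a net descent of 2.\<close>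

lemma sum_down_steps:
  "(\<Sum>j\<in>down_steps \<nu>. \<Prod>m=1..\<nu>+1. r (n + level j m)) = jpow r (2 * \<nu>) n (n - 2)"
  using sum_incr_tuples[where p = "2 * \<nu>" and d = "\<nu> + 1" and r = r and n = n]
  by (simp add: down_steps_def incr_tuples_def level_def)

subsection \<open>Integration by parts against the weight\<close>

lemma poly_mult_gauss_tendsto_0:
  fixes q :: "real poly" and w :: "real \<Rightarrow> real"
  assumes w: "\<And>x. \<bar>w x\<bar> \<le> exp (- (1/2) * x\<^sup>2)"
  shows "((\<lambda>x. poly q x * w x) \<longlongrightarrow> 0) at_top" "((\<lambda>x. poly q x * w x) \<longlongrightarrow> 0) at_bot"
proof -
  have *: "((\<lambda>x. poly q x * w x) \<longlongrightarrow> 0) at_top" if w: "\<And>x. \<bar>w x\<bar> \<le> exp (- (1/2) * x\<^sup>2)"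
    for q :: "real poly" and w :: "real \<Rightarrow> real"
  proof -
    have "((\<lambda>x. x ^ k * w x) \<longlongrightarrow> 0) at_top" for k :: nat
    proof (rule Lim_null_comparison[OF _ tendsto_power_div_exp_0[of k]])
      show "\<forall>\<^sub>F x in at_top. norm (x ^ k * w x) \<le> x ^ k / exp x"
        using eventually_ge_at_top[of 2]
      proof eventually_elim
        case (elim x)
        \<comment> \<open>From 2 on the Gaussian is dominated by \<open>exp (- x)\<close>, which
          beats every power.\<close>
        have "x \<le> 1/2 * x\<^sup>2" using elim by (simp add: power2_eq_square)
        then have "exp (- (1/2) * x\<^sup>2) \<le> exp (- x)" by simp
        then have "\<bar>w x\<bar> \<le> exp (- x)" using w[of x] by linarith
        then show ?case using elim by (simp add: abs_mult exp_minus field_simps)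
      qed
    qed
    then have "((\<lambda>x. \<Sum>i\<le>degree q. coeff q i * (x ^ i * w x)) \<longlongrightarrow> (\<Sum>i\<le>degree q. coeff q i * 0)) at_top"
      by (intro tendsto_intros)
    then show ?thesis by (simp add: poly_altdef sum_distrib_right mult.assoc)
  qed
  show "((\<lambda>x. poly q x * w x) \<longlongrightarrow> 0) at_top" by (rule *[OF w])
  have "((\<lambda>x. poly (pcompose q [:0, -1:]) x * w (- x)) \<longlongrightarrow> 0) at_top"
    by (rule *) (use w[of "- _"] in simp)
  then show "((\<lambda>x. poly q x * w x) \<longlongrightarrow> 0) at_bot"
    by (simp add: filterlim_at_bot_mirror poly_pcompose)
qed

text \<open>The difference of the integrands is the derivative of \<open>q w\<close>, which vanishes
  at both infinities.\<close>

lemma integral_deriv_poly_weight: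
  fixes q V :: "real poly" and w :: "real \<Rightarrow> real"
  assumes int: "\<And>q. integrable lborel (\<lambda>x. poly q x * w x)"
    and w: "\<And>x. \<bar>w x\<bar> \<le> exp (- (1/2) * x\<^sup>2)"
    and w': "\<And>x. (w has_real_derivative - poly V x * w x) (at x)"
  shows "(LINT x|lborel. poly (pderiv q) x * w x) = (LINT x|lborel. poly (q * V) x * w x)"
proof -
  let ?F = "\<lambda>x. poly q x * w x" and ?f = "\<lambda>x. poly (pderiv q - q * V) x * w x"
  have cw: "isCont w x" for x using w'[of x] by (rule DERIV_isCont)
  have "(LBINT x=-\<infinity>..\<infinity>. ?f x) = 0 - 0"
  proof (rule interval_integral_FTC_integrable[where F = ?F])
    show "(?F has_vector_derivative ?f x) (at x)" for x
      unfolding has_real_derivative_iff_has_vector_derivative[symmetric]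
      by (auto intro!: derivative_eq_intros poly_DERIV w' simp: algebra_simps)
    show "isCont ?f x" for x by (intro isCont_mult cw poly_isCont)
    show "set_integrable lborel (einterval (- \<infinity>) \<infinity>) ?f"
      using int[of "pderiv q - q * V"] by (simp add: set_integrable_def einterval_def)
    show "((?F \<circ> real_of_ereal) \<longlongrightarrow> 0) (at_right (- \<infinity>))" "((?F \<circ> real_of_ereal) \<longlongrightarrow> 0) (at_left \<infinity>)"
      using poly_mult_gauss_tendsto_0[of w q, OF w]
      by (simp_all add: ereal_tendsto_simps)
  qed auto
  then have "(LINT x|lborel. ?f x) = 0"
    by (simp add: interval_lebesgue_integral_def set_lebesgue_integral_def einterval_def)
  moreover have "?f = (\<lambda>x. poly (pderiv q) x * w x - poly (q * V) x * w x)"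
    by (simp add: algebra_simps)
  ultimately show ?thesis
    using Bochner_Integration.integral_diff[OF int[of "pderiv q"] int[of "q * V"]] by simp
qed

text \<open>As \<open>p n\<close> has degree \<open>n\<close>, the polynomials
  \<open>p 0, ..., p N\<close> span all of degree at most \<open>N\<close>; linear statements about
  the functional can be checked on them.\<close>

lemma degree_induct_poly:
  fixes P :: "real poly \<Rightarrow> bool" and p :: "nat \<Rightarrow> real poly"
  assumes p: "\<And>n. degree (p n) = n" "\<And>n. lead_coeff (p n) > 0"
    and P0: "P 0" and add: "\<And>n c q. n \<le> N \<Longrightarrow> P q \<Longrightarrow> P (smult c (p n) + q)"
  shows "degree q \<le> N \<Longrightarrow> P q"
proof (induction "degree q" arbitrary: q rule: less_induct)
  case less
  define c where "c = lead_coeff q / lead_coeff (p (degree q))"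
  define q' where "q' = q - smult c (p (degree q))"
  have co: "coeff q' (degree q) = 0" using p[of "degree q"] by (simp add: q'_def c_def)
  have le: "degree q' \<le> degree q"
    unfolding q'_def by (intro degree_diff_le) (use p in auto)
  have eq: "q = smult c (p (degree q)) + q'" by (simp add: q'_def)
  show ?case
  proof (cases "q' = 0")
    case True
    then show ?thesis using add[of "degree q" 0 c] P0 less.prems eq by simp
  next
    case False
    then have "degree q' \<noteq> degree q" using co by (metis leading_coeff_0_iff)
    then have "P q'" using le less by (intro less.hyps) auto
    then show ?thesis using add[of "degree q" q' c] less.prems eq by simp
  qed
qed

lemma orthonormal_polys_integrable:
  assumes "orthonormal_polys w p"
  shows "integrable lborel (\<lambda>x. poly q x * w x)"
proof (rule degree_induct_poly[where p = p and N = "degree q" and P = "\<lambda>q. integrable lborel (\<lambda>x. poly q x * w x)"])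
  have p: "degree (p n) = n" "lead_coeff (p n) > 0" for n
    using assms unfolding orthonormal_polys_def by blast+
  show "degree (p n) = n" "lead_coeff (p n) > 0" for n by (rule p)+
  \<comment> \<open>As \<open>p 0\<close> is a nonzero constant, integrability of
    \<open>p n p 0 w\<close> is integrability of \<open>p n w\<close>.\<close>
  obtain c where c: "p 0 = [:c:]" "c \<noteq> 0"
    using p[of 0] by (metis degree_0_id leading_coeff_0_iff less_irrefl pCons_0_0 degree_eq_zeroE)
  fix n a q assume q: "integrable lborel (\<lambda>x. poly q x * w x)"
  have "integrable lborel (\<lambda>x. poly (p n) x * poly (p 0) x * w x)"
    using assms unfolding orthonormal_polys_def by (blast intro: has_bochner_integral_integrable integrable.intros)
  then have "integrable lborel (\<lambda>x. (a / c) * (poly (p n) x * poly (p 0) x * w x))"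
    by (rule integrable_mult_right)
  then have "integrable lborel (\<lambda>x. a * poly (p n) x * w x)"
    using c by (simp add: field_simps)
  then have "integrable lborel (\<lambda>x. a * poly (p n) x * w x + poly q x * w x)"
    using q by (rule Bochner_Integration.integrable_add)
  then show "integrable lborel (\<lambda>x. poly (smult a (p n) + q) x * w x)"
    by (simp add: algebra_simps)
qed auto

subsection \<open>The string equation of the recurrence coefficients\<close>

text \<open>The extension by 0 decouples the half-line: a step down from site 0 has weight 0, so the
  two-sided Jacobi operator can be used throughout.\<close>

definition sqseq :: "(nat \<Rightarrow> real) \<Rightarrow> int \<Rightarrow> real" where
  "sqseq b l = (if l \<ge> 1 then (b (nat l))\<^sup>2 else 0)"

lemma toda_weight_deriv:
  assumes "\<nu>1 \<ge> 1" "\<nu>2 \<ge> 1"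
  shows "(toda_weight \<nu>1 \<nu>2 \<xi>1 \<xi>2 has_real_derivative
     - poly (monom 1 1 - monom (4 * real \<nu>1 * \<xi>1) (2 * \<nu>1 - 1) - monom (4 * real \<nu>2 * \<xi>2) (2 * \<nu>2 - 1)) x
       * toda_weight \<nu>1 \<nu>2 \<xi>1 \<xi>2 x) (at x)"
  unfolding toda_weight_def[abs_def]
  by (auto intro!: derivative_eq_intros simp: poly_monom algebra_simps)

lemma toda_weight_le:
  assumes "\<xi>1 \<le> 0" "\<xi>2 \<le> 0"
  shows "\<bar>toda_weight \<nu>1 \<nu>2 \<xi>1 \<xi>2 x\<bar> \<le> exp (- (1/2) * x\<^sup>2)"
proof -
  have "2 * \<xi>1 * x ^ (2 * \<nu>1) \<le> 0" "2 * \<xi>2 * x ^ (2 * \<nu>2) \<le> 0"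
    using assms by (simp_all add: mult_nonpos_nonneg zero_le_even_power)
  then show ?thesis by (simp add: toda_weight_def)
qed

text \<open>Integrate the derivative of \<open>\<pi> n * \<pi> (n - 1)\<close> against the weight,
  where \<open>\<pi>\<close> are the monic orthogonal polynomials. Directly this is
  \<open>n h\<close>, since the derivative of \<open>\<pi> n\<close> is
  \<open>n \<pi> (n - 1)\<close> plus lower degree. By parts it is the integral of
  \<open>\<pi> n \<pi> (n - 1) V\<close>, and multiplication by the variable acts on the
  \<open>\<pi> l\<close> as the Jacobi operator.\<close>

lemma recurrence_coeffs_string:
  assumes \<nu>: "\<nu>1 \<ge> 1" "\<nu>2 \<ge> 1" and \<xi>: "\<xi>1 \<le> 0" "\<xi>2 \<le> 0"
    and rc: "recurrence_coeffs (toda_weight \<nu>1 \<nu>2 \<xi>1 \<xi>2) b" and n: "n \<ge> 1"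
  shows "sqseq b n - 4 * real \<nu>1 * \<xi>1 * jpow (sqseq b) (2 * \<nu>1 - 1) n (n - 1)
     - 4 * real \<nu>2 * \<xi>2 * jpow (sqseq b) (2 * \<nu>2 - 1) n (n - 1) = of_int n"
proof -
  define w where "w = toda_weight \<nu>1 \<nu>2 \<xi>1 \<xi>2"
  define R where "R = sqseq b"
  obtain p where b: "\<forall>k\<ge>1. b k > 0" and on: "orthonormal_polys w p"
    and rec: "\<And>n. [:0, 1:] * p n = smult (b (n + 1)) (p (n + 1)) + (if n = 0 then 0 else smult (b n) (p (n - 1)))"
    using rc unfolding recurrence_coeffs_def w_def by blast
  have p: "degree (p n) = n" "lead_coeff (p n) > 0" for n
    using on unfolding orthonormal_polys_def by blast+
  define g where "g n = coeff (p n) n" for n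
  have g: "g n > 0" for n using p[of n] by (simp add: g_def)
  have g_rec: "g n = b (n + 1) * g (n + 1)" for n
  proof -
    have "coeff ([:0, 1:] * p n) (Suc n) = b (n + 1) * g (n + 1)"
      unfolding rec using p[of "n - 1"] by (cases n) (auto simp: g_def coeff_eq_0)
    then show ?thesis by (simp add: g_def)
  qed
  define I where "I q = (LINT x|lborel. poly q x * w x)" for q
  note int = orthonormal_polys_integrable[OF on]
  have I_add: "I (q1 + q2) = I q1 + I q2" for q1 q2
    using Bochner_Integration.integral_add[OF int int, of q1 q2] by (simp add: I_def algebra_simps)
  have I_smult: "I (smult c q) = c * I q" for c q
    by (simp add: I_def mult.assoc)
  have Ip: "I (p m * p n) = of_bool (m = n)" for m n
  proof -
    have "has_bochner_integral lborel (\<lambda>x. poly (p m) x * poly (p n) x * w x) (if m = n then 1 else 0)"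
      using on unfolding orthonormal_polys_def by blast
    from has_bochner_integral_integral_eq[OF this] show ?thesis by (simp add: I_def)
  qed
  have orth: "I (q * p n) = 0" if "degree q < n" for q n
  proof (rule degree_induct_poly[where p = p and N = "degree q" and P = "\<lambda>q. I (q * p n) = 0"])
    show "degree (p n) = n" "lead_coeff (p n) > 0" for n by (rule p)+
    show "I ((smult c (p m) + q') * p n) = 0" if "m \<le> degree q" "I (q' * p n) = 0" for m c q'
      using that \<open>degree q < n\<close> by (simp add: algebra_simps I_add I_smult Ip)
  qed (simp_all add: I_def)
  define \<pi> where "\<pi> l = (if l \<ge> 0 then smult (1 / g (nat l)) (p (nat l)) else 0)" for l :: int
  have \<pi>_rec: "[:0, 1:] * \<pi> l = \<pi> (l + 1) + smult (R l) (\<pi> (l - 1))" if l: "l \<ge> 0" for l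
  proof -
    define m where "m = nat l"
    have lm: "l = int m" using l by (simp add: m_def)
    have nm: "nat (l + 1) = m + 1" by (simp add: lm nat_add_distrib)
    have "[:0, 1:] * \<pi> l = smult (1 / g m) ([:0, 1:] * p m)"
      by (simp add: \<pi>_def lm)
    also have "\<dots> = smult (1 / g (m + 1)) (p (m + 1)) + (if m = 0 then 0 else smult (b m / g m) (p (m - 1)))"
    proof -
      have "b (m + 1) > 0" using b by simp
      then have "b (m + 1) / g m = 1 / g (m + 1)" using g[of "m + 1"] by (simp add: g_rec[of m])
      then show ?thesis unfolding rec smult_add_right smult_smult by simp
    qed
    also have "smult (1 / g (m + 1)) (p (m + 1)) = \<pi> (l + 1)"
      using nm by (simp add: \<pi>_def lm)
    also have "(if m = 0 then 0 else smult (b m / g m) (p (m - 1))) = smult (R l) (\<pi> (l - 1))"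
    proof (cases m)
      case 0
      then show ?thesis by (simp add: lm R_def sqseq_def)
    next
      case (Suc k)
      have "b m / g m = (b m)\<^sup>2 / g k"
        using g_rec[of k] g[of m] b Suc by (simp add: power2_eq_square)
      moreover have "nat (1 + int k) = Suc k" by simp
      ultimately show ?thesis using Suc by (simp add: \<pi>_def lm R_def sqseq_def)
    qed
    finally show ?thesis .
  qed
  define h where "h = I (\<pi> (n - 1) * \<pi> (n - 1))"
  have ortho\<pi>: "I (\<pi> l * \<pi> (n - 1)) = of_bool (l = n - 1) * h" if "l \<ge> 0" for l
  proof (cases "l = n - 1")
    case False
    then have "nat l \<noteq> nat (n - 1)" using that n by linarith
    then show ?thesis using False that n by (simp add: \<pi>_def I_smult Ip)
  qed (simp add: h_def)
  have h: "h \<noteq> 0" using n g[of "nat (n - 1)"] by (simp add: h_def \<pi>_def I_smult Ip)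
  have powI: "I (monom 1 q * \<pi> l * \<pi> (n - 1)) = jpow R q l (n - 1) * h" if "l \<ge> 0" for q l
    using that
  proof (induction q arbitrary: l)
    case 0
    then show ?case using ortho\<pi>[of l] by (simp add: monom_0 one_pCons[symmetric])
  next
    case (Suc q)
    have "monom 1 (Suc q) * \<pi> l * \<pi> (n - 1) = monom 1 q * ([:0, 1:] * \<pi> l) * \<pi> (n - 1)"
      by (simp add: monom_Suc)
    also have "\<dots> = monom 1 q * \<pi> (l + 1) * \<pi> (n - 1) + smult (R l) (monom 1 q * \<pi> (l - 1) * \<pi> (n - 1))"
      unfolding \<pi>_rec[OF Suc.prems] by (simp add: algebra_simps)
    finally have eq: "I (monom 1 (Suc q) * \<pi> l * \<pi> (n - 1))
        = I (monom 1 q * \<pi> (l + 1) * \<pi> (n - 1)) + R l * I (monom 1 q * \<pi> (l - 1) * \<pi> (n - 1))"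
      by (simp add: I_add I_smult)
    \<comment> \<open>At \<open>l = 0\<close> the induction hypothesis does not cover
      \<open>l - 1\<close>, but the factor \<open>R 0\<close> vanishes.\<close>
    show ?case
    proof (cases "l = 0")
      case True
      then have "R l = 0" by (simp add: R_def sqseq_def)
      then show ?thesis using eq Suc by simp
    next
      case False
      then show ?thesis using eq Suc.IH[of "l + 1"] Suc.IH[of "l - 1"] Suc.prems by (simp add: algebra_simps)
    qed
  qed
  define N where "N = nat n"
  have nN: "n = int N" and N1: "N \<ge> 1" using n by (simp_all add: N_def)
  have \<pi>N: "degree (\<pi> n) = N" "lead_coeff (\<pi> n) = 1" "degree (\<pi> (n - 1)) = N - 1" "coeff (\<pi> (n - 1)) (N - 1) = 1"
    using p g N1 by (simp_all add: \<pi>_def nN nat_diff_distrib g_def[symmetric])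
       (metis g less_irrefl nat_diff_distrib)+
  define V where "V = monom 1 1 - monom (4 * real \<nu>1 * \<xi>1) (2 * \<nu>1 - 1) - monom (4 * real \<nu>2 * \<xi>2) (2 * \<nu>2 - 1)"
  have ibp: "I (pderiv (\<pi> n * \<pi> (n - 1))) = I (\<pi> n * \<pi> (n - 1) * V)"
    unfolding I_def
  proof (rule integral_deriv_poly_weight[OF int])
    show "\<bar>w x\<bar> \<le> exp (- (1/2) * x\<^sup>2)" for x unfolding w_def by (rule toda_weight_le[OF \<xi>])
    show "(w has_real_derivative - poly V x * w x) (at x)" for x
      unfolding w_def V_def by (rule toda_weight_deriv[OF \<nu>])
  qed
  have "I (pderiv (\<pi> n * \<pi> (n - 1))) = I (pderiv (\<pi> n) * \<pi> (n - 1)) + I (pderiv (\<pi> (n - 1)) * \<pi> n)"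
    by (simp add: pderiv_mult I_add[symmetric] algebra_simps)
  also have "I (pderiv (\<pi> (n - 1)) * \<pi> n) = 0"
  proof -
    have "degree (pderiv (\<pi> (n - 1))) < N" using \<pi>N N1 by (simp add: degree_pderiv)
    moreover have "\<pi> n = smult (1 / g N) (p N)" by (simp add: \<pi>_def nN)
    ultimately show ?thesis using orth[of "pderiv (\<pi> (n - 1))" N] by (simp add: I_smult)
  qed
  also have "I (pderiv (\<pi> n) * \<pi> (n - 1)) = of_int n * h"
  proof -
    define q where "q = pderiv (\<pi> n) - smult (of_int n) (\<pi> (n - 1))"
    have "coeff (\<pi> n) N = 1" using \<pi>N by simp
    then have "coeff q (N - 1) = 0" using N1 \<pi>N by (simp add: q_def coeff_pderiv nN)
    moreover have "degree q \<le> N - 1" unfolding q_def by (intro degree_diff_le) (simp_all add: degree_pderiv \<pi>N)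
    \<comment> \<open>For \<open>N = 1\<close> the degree cannot drop below
      \<open>N - 1 = 0\<close>, hence the separate alternative \<open>q = 0\<close>.\<close>
    ultimately have "q = 0 \<or> degree q < N - 1"
      by (metis leading_coeff_0_iff le_neq_implies_less)
    then have "I (q * \<pi> (n - 1)) = 0"
    proof
      assume "degree q < N - 1"
      moreover have "\<pi> (n - 1) = smult (1 / g (N - 1)) (p (N - 1))"
        using N1 by (simp add: \<pi>_def nN nat_diff_distrib)
      ultimately show ?thesis using orth[of q "N - 1"] by (simp add: I_smult)
    qed (simp add: I_def)
    moreover have "pderiv (\<pi> n) * \<pi> (n - 1) = q * \<pi> (n - 1) + smult (of_int n) (\<pi> (n - 1) * \<pi> (n - 1))"
      by (simp add: q_def algebra_simps)
    ultimately show ?thesis by (simp add: I_add I_smult h_def)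
  qed
  finally have lhs: "I (pderiv (\<pi> n * \<pi> (n - 1))) = of_int n * h" by simp
  have eqV: "\<pi> n * \<pi> (n - 1) * V = monom 1 1 * \<pi> n * \<pi> (n - 1)
     + smult (- (4 * real \<nu>1 * \<xi>1)) (monom 1 (2 * \<nu>1 - 1) * \<pi> n * \<pi> (n - 1))
     + smult (- (4 * real \<nu>2 * \<xi>2)) (monom 1 (2 * \<nu>2 - 1) * \<pi> n * \<pi> (n - 1))"
  proof -
    have m: "monom c k = smult c (monom 1 k)" for c :: real and k by (simp add: smult_monom)
    show ?thesis unfolding V_def m[of "4 * real _ * _"] by (simp add: algebra_simps)
  qed
  have "I (\<pi> n * \<pi> (n - 1) * V) = (jpow R 1 n (n - 1) - 4 * real \<nu>1 * \<xi>1 * jpow R (2 * \<nu>1 - 1) n (n - 1)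
     - 4 * real \<nu>2 * \<xi>2 * jpow R (2 * \<nu>2 - 1) n (n - 1)) * h"
  proof -
    have "n \<ge> 0" using n by simp
    show ?thesis
      unfolding eqV I_add I_smult powI[OF \<open>n \<ge> 0\<close>] by (simp only: ring_distribs) (simp add: mult.assoc)
  qed
  with ibp lhs h have "of_int n = jpow R 1 n (n - 1) - 4 * real \<nu>1 * \<xi>1 * jpow R (2 * \<nu>1 - 1) n (n - 1)
     - 4 * real \<nu>2 * \<xi>2 * jpow R (2 * \<nu>2 - 1) n (n - 1)" by simp
  then show ?thesis by (simp add: R_def)
qed

subsection \<open>Monotonicity of the string equation\<close>

text \<open>These functions are convex and, unlike convex functions in general, closed under
  products, which the recursion of \<open>jpow\<close> requires.\<close>

inductive posexp :: "(real \<Rightarrow> real) \<Rightarrow> bool" where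
  base: "c \<ge> 0 \<Longrightarrow> posexp (\<lambda>t. c * exp (l * t))"
| add: "posexp f \<Longrightarrow> posexp g \<Longrightarrow> posexp (\<lambda>t. f t + g t)"

lemma posexp_const: "c \<ge> 0 \<Longrightarrow> posexp (\<lambda>_. c)"
  using posexp.base[of c 0] by simp

lemma posexp_base_mult:
  assumes "c \<ge> 0" and g: "posexp g"
  shows "posexp (\<lambda>t. c * exp (l * t) * g t)"
  using g
proof induction
  case (base c' l')
  then show ?case
    using posexp.base[of "c * c'" "l + l'"] assms(1) by (simp add: exp_add algebra_simps)
next
  case (add f g)
  then show ?case using posexp.add[OF add.IH] by (simp add: algebra_simps)
qed

lemma posexp_mult: "posexp f \<Longrightarrow> posexp g \<Longrightarrow> posexp (\<lambda>t. f t * g t)"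
proof (induction rule: posexp.induct)
  case (add f1 f2)
  then show ?case using posexp.add[of "\<lambda>t. f1 t * g t" "\<lambda>t. f2 t * g t"] by (simp add: algebra_simps)
qed (rule posexp_base_mult)

lemma posexp_sum: "(\<And>i. i \<in> A \<Longrightarrow> posexp (f i)) \<Longrightarrow> posexp (\<lambda>t. \<Sum>i\<in>A. f i t)"
  by (induction A rule: infinite_finite_induct) (auto intro: posexp_const posexp.add)

lemma posexp_deriv_mono:
  "posexp f \<Longrightarrow> \<exists>f'. (\<forall>t. (f has_real_derivative f' t) (at t)) \<and> mono f'"
proof (induction rule: posexp.induct)
  case (base c l)
  have "mono (\<lambda>t. c * l * exp (l * t))"
  proof (rule monoI)
    fix x y :: real assume "x \<le> y"
    have "l * exp (l * x) \<le> l * exp (l * y)"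
    proof (cases "l \<ge> 0")
      case True
      then show ?thesis using \<open>x \<le> y\<close> by (intro mult_left_mono) (auto intro: mult_left_mono)
    next
      case False
      then have "l * y \<le> l * x" using \<open>x \<le> y\<close> by (intro mult_left_mono_neg) auto
      then show ?thesis using False by (intro mult_left_mono_neg) auto
    qed
    then show "c * l * exp (l * x) \<le> c * l * exp (l * y)"
      using base by (simp add: mult.assoc mult_left_mono)
  qed
  moreover have "((\<lambda>t. c * exp (l * t)) has_real_derivative c * l * exp (l * t)) (at t)" for t
    by (auto intro!: derivative_eq_intros)
  ultimately show ?case by (intro exI[of _ "\<lambda>t. c * l * exp (l * t)"]) simp
next
  case (add f g)
  then obtain f' g' where "\<forall>t. (f has_real_derivative f' t) (at t)" "mono f'"
    "\<forall>t. (g has_real_derivative g' t) (at t)" "mono g'" by blast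
  then show ?case
    by (intro exI[of _ "\<lambda>t. f' t + g' t"]) (auto intro!: derivative_eq_intros simp: mono_def add_mono)
qed

lemma posexp_jpow: "(\<And>l. posexp (\<lambda>t. r t l)) \<Longrightarrow> posexp (\<lambda>t. jpow (r t) p n m)"
  by (induction p arbitrary: n) (simp_all add: posexp_const posexp_mult posexp.add)

lemma jpow_has_derivative:
  assumes "\<And>l. ((\<lambda>t. r t l) has_real_derivative \<rho> l) (at t)"
  shows "((\<lambda>t. jpow (r t) p n m) has_real_derivative djpow (r t) \<rho> p n m) (at t)"
proof (induction p arbitrary: n)
  case (Suc p)
  show ?case
    by (auto intro!: derivative_eq_intros Suc assms simp: algebra_simps)
qed simp

text \<open>By cyclicity of the trace each of the \<open>p + 1\<close> places where \<open>L\<close>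
  is varied contributes the trace of \<open>\<delta>L L^p\<close>, and \<open>jpow_down\<close>
  absorbs the factor \<open>r l\<close> of the logarithmic variation \<open>d l * r l\<close>. The
  range of \<open>n\<close> is wide enough for the closed walks that take a down step inside
  \<open>{a..b}\<close>.\<close>

lemma trace_djpow:
  fixes r :: "int \<Rightarrow> real"
  assumes "\<And>l. l \<notin> {a..b} \<Longrightarrow> r l = 0"
  shows "(\<Sum>n\<in>{a - int (Suc p)..b + int (Suc p)}. djpow r (\<lambda>l. d l * r l) (Suc p) n n)
     = real (Suc p) * (\<Sum>l\<in>{a..b}. d l * jpow r p l (l - 1))"
proof -
  let ?J = "{a - int (Suc p)..b + int (Suc p)}"
  have "(\<Sum>n\<in>?J. djpow r (\<lambda>l. d l * r l) (Suc p) n n)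
     = (\<Sum>n\<in>?J. \<Sum>i<Suc p. \<Sum>l\<in>{a..b}. jpow r i n l * (d l * r l) * jpow r (p - i) (l - 1) n)"
    by (subst djpow_expand[of "{a..b}"]) (use assms in auto)
  also have "\<dots> = (\<Sum>i<Suc p. \<Sum>l\<in>{a..b}. d l * r l * (\<Sum>n\<in>?J. jpow r (p - i) (l - 1) n * jpow r i n l))"
    by (subst sum.swap, rule sum.cong[OF refl], subst sum.swap)
       (simp add: sum_distrib_left algebra_simps)
  also have "\<dots> = (\<Sum>i<Suc p. \<Sum>l\<in>{a..b}. d l * jpow r p l (l - 1))"
  proof (intro sum.cong refl)
    fix i l assume "i \<in> {..<Suc p}" "l \<in> {a..b}"
    then have "(\<Sum>n\<in>?J. jpow r (p - i) (l - 1) n * jpow r i n l) = jpow r (p - i + i) (l - 1) l"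
      by (intro jpow_add[symmetric]) auto
    also have "p - i + i = p" using \<open>i \<in> _\<close> by simp
    finally show "d l * r l * (\<Sum>n\<in>?J. jpow r (p - i) (l - 1) n * jpow r i n l) = d l * jpow r p l (l - 1)"
      by (simp add: jpow_down)
  qed
  finally show ?thesis by simp
qed

text \<open>In the variables \<open>ln r\<^sub>l\<close> the trace of \<open>L\<^bsup>p+1\<^esup>\<close> is a sum of exponentials of linear
  forms with nonnegative coefficients, hence convex, and its gradient is \<open>(p+1) (L\<^sup>p)\<^bsub>l,l-1\<^esub>\<close>.\<close>

lemma jpow_monotone:
  fixes r \<rho> :: "int \<Rightarrow> real"
  assumes r: "\<And>l. l \<in> {a..b} \<Longrightarrow> r l > 0" "\<And>l. l \<notin> {a..b} \<Longrightarrow> r l = 0"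
    and \<rho>: "\<And>l. l \<in> {a..b} \<Longrightarrow> \<rho> l > 0" "\<And>l. l \<notin> {a..b} \<Longrightarrow> \<rho> l = 0"
  shows "(\<Sum>l\<in>{a..b}. (ln (r l) - ln (\<rho> l)) * (jpow r p l (l - 1) - jpow \<rho> p l (l - 1))) \<ge> 0"
proof -
  define d where "d l = ln (r l) - ln (\<rho> l)" for l
  \<comment> \<open>The path is straight in the logarithms, from \<open>\<rho>\<close> at 0 to
    \<open>r\<close> at 1; convexity of \<open>G\<close> compares its slopes at the two
    ends.\<close>
  define R where "R t l = (if l \<in> {a..b} then \<rho> l * exp (d l * t) else 0)" for t l
  let ?J = "{a - int (Suc p)..b + int (Suc p)}"
  define G where "G t = (\<Sum>n\<in>?J. jpow (R t) (Suc p) n n)" for t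
  define G' where "G' t = real (Suc p) * (\<Sum>l\<in>{a..b}. d l * jpow (R t) p l (l - 1))" for t
  have "R 0 l = \<rho> l" "R 1 l = r l" for l
    using r[of l] \<rho>[of l] by (cases "l \<in> {a..b}"; simp add: R_def d_def exp_diff)+
  then have R0: "R 0 = \<rho>" and R1: "R 1 = r" by auto
  have "posexp (\<lambda>t. R t l)" for l
    using \<rho>(1)[of l] posexp.base[of "\<rho> l" "d l"] posexp_const[of 0] by (cases "l \<in> {a..b}") (auto simp: R_def)
  then have "posexp G" unfolding G_def[abs_def] by (intro posexp_sum posexp_jpow)
  then obtain f' where f': "\<And>t. (G has_real_derivative f' t) (at t)" "mono f'"
    using posexp_deriv_mono by blast
  have "((\<lambda>t. R t l) has_real_derivative d l * R t l) (at t)" for l t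
    unfolding R_def by (cases "l \<in> {a..b}") (auto intro!: derivative_eq_intros)
  then have "(G has_real_derivative (\<Sum>n\<in>?J. djpow (R t) (\<lambda>l. d l * R t l) (Suc p) n n)) (at t)" for t
    unfolding G_def[abs_def] by (intro DERIV_sum jpow_has_derivative)
  then have "(G has_real_derivative G' t) (at t)" for t
    unfolding G'_def by (subst trace_djpow[where r = "R t", symmetric]) (auto simp: R_def)
  then have "f' = G'" using f'(1) DERIV_unique by blast
  then have "G' 0 \<le> G' 1" using f'(2) by (simp add: monoD)
  then have "(\<Sum>l\<in>{a..b}. d l * jpow \<rho> p l (l - 1)) \<le> (\<Sum>l\<in>{a..b}. d l * jpow r p l (l - 1))"
    by (simp add: G'_def R0 R1 mult_le_cancel_left del: of_nat_Suc)
  then show ?thesis by (simp add: d_def right_diff_distrib sum_subtractf)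
qed

section \<open>Bounds, Lipschitz estimates and the hole filling inequality\<close>

lemma jpow_bound:
  fixes r :: "int \<Rightarrow> real"
  assumes "\<And>l. \<bar>r l\<bar> \<le> M" shows "\<bar>jpow r p n m\<bar> \<le> (1 + M) ^ p"
proof (induction p arbitrary: n)
  case 0
  then show ?case by (simp add: of_bool_def)
next
  case (Suc p)
  have M: "M \<ge> 0" using assms[of 0] by linarith
  have "\<bar>jpow r (Suc p) n m\<bar> \<le> \<bar>jpow r p (n + 1) m\<bar> + \<bar>r n\<bar> * \<bar>jpow r p (n - 1) m\<bar>"
    by (simp add: abs_mult[symmetric])
  also have "\<dots> \<le> (1 + M) ^ p + M * (1 + M) ^ p"
    using M by (intro add_mono mult_mono Suc assms) auto
  finally show ?case by (simp add: algebra_simps)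
qed

lemma jpow_lipschitz:
  fixes M :: real
  assumes M: "M \<ge> 0"
  shows "\<exists>C\<ge>0. \<forall>r \<rho> n m. (\<forall>l. \<bar>r l\<bar> \<le> M) \<longrightarrow> (\<forall>l. \<bar>\<rho> l\<bar> \<le> M) \<longrightarrow>
     \<bar>jpow r p n m - jpow \<rho> p n m\<bar> \<le> C * (\<Sum>l\<in>{n - int p..n + int p}. \<bar>r l - \<rho> l\<bar>)"
proof (induction p)
  case 0
  then show ?case by (intro exI[of _ 0]) simp
next
  case (Suc p)
  then obtain C where C: "C \<ge> 0" and lip: "\<And>r \<rho> n m. (\<forall>l. \<bar>r l\<bar> \<le> M) \<Longrightarrow> (\<forall>l. \<bar>\<rho> l\<bar> \<le> M) \<Longrightarrow>
     \<bar>jpow r p n m - jpow \<rho> p n m\<bar> \<le> C * (\<Sum>l\<in>{n - int p..n + int p}. \<bar>r l - \<rho> l\<bar>)" by blast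
  let ?C = "C + M * C + (1 + M) ^ p"
  have "\<bar>jpow r (Suc p) n m - jpow \<rho> (Suc p) n m\<bar> \<le> ?C * (\<Sum>l\<in>{n - int (Suc p)..n + int (Suc p)}. \<bar>r l - \<rho> l\<bar>)"
    if r: "\<forall>l. \<bar>r l\<bar> \<le> M" and \<rho>: "\<forall>l. \<bar>\<rho> l\<bar> \<le> M" for r \<rho> n m
  proof -
    define s where "s = (\<Sum>l\<in>{n - int (Suc p)..n + int (Suc p)}. \<bar>r l - \<rho> l\<bar>)"
    have s: "(\<Sum>l\<in>A. \<bar>r l - \<rho> l\<bar>) \<le> s" if "A \<subseteq> {n - int (Suc p)..n + int (Suc p)}" for A
      unfolding s_def by (rule sum_mono2) (use that in auto)
    have "\<bar>jpow r p (n + 1) m - jpow \<rho> p (n + 1) m\<bar> \<le> C * (\<Sum>l\<in>{(n + 1) - int p..(n + 1) + int p}. \<bar>r l - \<rho> l\<bar>)"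
      by (rule lip[OF r \<rho>])
    also have "\<dots> \<le> C * s" by (rule mult_left_mono[OF s C]) auto
    finally have 1: "\<bar>jpow r p (n + 1) m - jpow \<rho> p (n + 1) m\<bar> \<le> C * s" .
    have "\<bar>jpow r p (n - 1) m - jpow \<rho> p (n - 1) m\<bar> \<le> C * (\<Sum>l\<in>{(n - 1) - int p..(n - 1) + int p}. \<bar>r l - \<rho> l\<bar>)"
      by (rule lip[OF r \<rho>])
    also have "\<dots> \<le> C * s" by (rule mult_left_mono[OF s C]) auto
    finally have 2: "\<bar>r n\<bar> * \<bar>jpow r p (n - 1) m - jpow \<rho> p (n - 1) m\<bar> \<le> M * (C * s)"
      using r M by (intro mult_mono) auto
    have "\<bar>r n - \<rho> n\<bar> \<le> s" using s[of "{n}"] by simp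
    then have 3: "\<bar>r n - \<rho> n\<bar> * \<bar>jpow \<rho> p (n - 1) m\<bar> \<le> s * (1 + M) ^ p"
      using \<rho> by (intro mult_mono jpow_bound) auto
    have "jpow r (Suc p) n m - jpow \<rho> (Suc p) n m = (jpow r p (n + 1) m - jpow \<rho> p (n + 1) m)
       + r n * (jpow r p (n - 1) m - jpow \<rho> p (n - 1) m) + (r n - \<rho> n) * jpow \<rho> p (n - 1) m"
      by (simp add: algebra_simps)
    also have "\<bar>\<dots>\<bar> \<le> \<bar>jpow r p (n + 1) m - jpow \<rho> p (n + 1) m\<bar>
       + \<bar>r n\<bar> * \<bar>jpow r p (n - 1) m - jpow \<rho> p (n - 1) m\<bar> + \<bar>r n - \<rho> n\<bar> * \<bar>jpow \<rho> p (n - 1) m\<bar>"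
      unfolding abs_mult[symmetric] by (intro order_trans[OF abs_triangle_ineq] add_mono) auto
    also have "\<dots> \<le> ?C * s" using 1 2 3 by (simp add: algebra_simps)
    finally show ?thesis unfolding s_def .
  qed
  then show ?case using C M by (intro exI[of _ ?C]) auto
qed

text \<open>Translates monotonicity, which holds in the logarithms, into square norms of
  \<open>r - \<rho>\<close>.\<close>

lemma ln_diff_bounds:
  fixes x y c M :: real
  assumes "0 < c" "c \<le> x" "x \<le> M" "c \<le> y" "y \<le> M"
  shows "\<bar>ln x - ln y\<bar> \<le> \<bar>x - y\<bar> / c" "(ln x - ln y) * (x - y) \<ge> (x - y)\<^sup>2 / M"
proof -
  have *: "ln x - ln y \<le> (x - y) / c \<and> (x - y) / M \<le> ln x - ln y"
    if "y \<le> x" "0 < c" "c \<le> x" "x \<le> M" "c \<le> y" "y \<le> M" for x y :: real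
  proof -
    have "ln x - ln y \<le> (x - y) / y" using that by (intro ln_diff_le) auto
    also have "\<dots> \<le> (x - y) / c" using that by (intro divide_left_mono) auto
    finally have 1: "ln x - ln y \<le> (x - y) / c" .
    have "ln y - ln x \<le> (y - x) / x" using that by (intro ln_diff_le) auto
    moreover have "(y - x) / x = - ((x - y) / x)"
      by (simp only: minus_divide_left minus_diff_eq)
    moreover have "(x - y) / M \<le> (x - y) / x" using that by (intro divide_left_mono) auto
    ultimately show ?thesis using 1 by linarith
  qed
  have A: "\<bar>ln x - ln y\<bar> \<le> \<bar>x - y\<bar> / c \<and> \<bar>x - y\<bar> / M \<le> \<bar>ln x - ln y\<bar> \<and> (ln x - ln y) * (x - y) = \<bar>ln x - ln y\<bar> * \<bar>x - y\<bar>"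
  proof (cases "y \<le> x")
    case True
    then show ?thesis using *[of y x] assms by (auto simp: abs_of_nonneg)
  next
    case False
    then have "ln x \<le> ln y" using assms by simp
    then show ?thesis using *[of x y] assms False by (auto simp: abs_of_nonpos algebra_simps)
  qed
  then show "\<bar>ln x - ln y\<bar> \<le> \<bar>x - y\<bar> / c" by blast
  have "(x - y)\<^sup>2 / M = \<bar>x - y\<bar> / M * \<bar>x - y\<bar>" by (simp add: power2_eq_square)
  also have "\<dots> \<le> \<bar>ln x - ln y\<bar> * \<bar>x - y\<bar>" using A by (intro mult_right_mono) auto
  finally show "(ln x - ln y) * (x - y) \<ge> (x - y)\<^sup>2 / M" using A by simp
qed

text \<open>With \<open>v i = - 2 \<nu>_i s_i\<close> and \<open>d i = 2 \<nu>_i - 1\<close> this is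
  the left side of the string equation.\<close>

definition string_op :: "'i set \<Rightarrow> ('i \<Rightarrow> 'a::comm_ring_1) \<Rightarrow> ('i \<Rightarrow> nat) \<Rightarrow> (int \<Rightarrow> 'a) \<Rightarrow> int \<Rightarrow> 'a" where
  "string_op I v d r n = r n + (\<Sum>i\<in>I. v i * jpow r (d i) n (n - 1))"

text \<open>Testing the difference of two string equations with \<open>ln r - ln \<rho>\<close> on a window: the
  truncation is exact except for an error supported in a boundary layer.\<close>

lemma string_hole_filling:
  fixes v :: "'i \<Rightarrow> real"
  assumes I: "finite I" and v: "\<And>i. i \<in> I \<Longrightarrow> v i \<ge> 0" and D: "\<And>i. i \<in> I \<Longrightarrow> int (d i) \<le> D" "D \<ge> 0"
    and c: "0 < c" "c \<le> M"
  shows "\<exists>C>0. \<forall>r \<rho> k m \<eta>. m \<ge> 2 * D \<longrightarrow>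
     (\<forall>l\<in>{k - m..k + m}. c \<le> r l \<and> r l \<le> M \<and> c \<le> \<rho> l \<and> \<rho> l \<le> M) \<longrightarrow>
     (\<forall>l\<in>{k - m..k + m}. \<bar>string_op I v d r l - string_op I v d \<rho> l\<bar> \<le> \<eta>) \<longrightarrow>
     (\<Sum>l\<in>{k - (m - 2 * D)..k + (m - 2 * D)}. (r l - \<rho> l)\<^sup>2) * (1 + C)
       \<le> C * (\<Sum>l\<in>{k - m..k + m}. (r l - \<rho> l)\<^sup>2) + C * \<eta>\<^sup>2 * (2 * m + 1)"
proof -
  have "\<forall>i. \<exists>C\<ge>0. \<forall>r \<rho> n m. (\<forall>l. \<bar>r l\<bar> \<le> M) \<longrightarrow> (\<forall>l. \<bar>\<rho> l\<bar> \<le> M) \<longrightarrow>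
     \<bar>jpow r (d i) n m - jpow \<rho> (d i) n m\<bar> \<le> C * (\<Sum>l\<in>{n - int (d i)..n + int (d i)}. \<bar>r l - \<rho> l\<bar>)"
    using c by (intro allI jpow_lipschitz) auto
  then obtain Ci where Ci: "\<And>i. Ci i \<ge> 0" and lip: "\<And>i r \<rho> n m. (\<forall>l. \<bar>r l\<bar> \<le> M) \<Longrightarrow> (\<forall>l. \<bar>\<rho> l\<bar> \<le> M) \<Longrightarrow>
     \<bar>jpow r (d i) n m - jpow \<rho> (d i) n m\<bar> \<le> Ci i * (\<Sum>l\<in>{n - int (d i)..n + int (d i)}. \<bar>r l - \<rho> l\<bar>)"
    by metis
  define C0 where "C0 = (\<Sum>i\<in>I. v i * Ci i)"
  have C0: "C0 \<ge> 0" unfolding C0_def by (intro sum_nonneg mult_nonneg_nonneg v Ci) auto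
  \<comment> \<open>The factor \<open>2 * (2 * D + 1)\<close> counts the shifts \<open>j\<close> in
    \<open>{-D..D}\<close>, each of which yields two sums over the boundary layer.\<close>
  define C1 where "C1 = C0 / c * (2 * (2 * D + 1))"
  \<comment> \<open>What completing the square in \<open>\<bar>\<delta> l\<bar> / c * \<eta>\<close>
    leaves after half of \<open>(\<delta> l)^2 / M\<close> has been spent.\<close>
  define C3 where "C3 = M / (2 * c\<^sup>2)"
  have C1: "C1 \<ge> 0" using C0 c D by (simp add: C1_def)
  have C3: "C3 > 0" using c by (simp add: C3_def)
  have M: "M > 0" using c by simp
  have main: "(\<Sum>l\<in>{k - (m - 2 * D)..k + (m - 2 * D)}. (r l - \<rho> l)\<^sup>2) * (1 / (2 * M) + C1)
       \<le> C1 * (\<Sum>l\<in>{k - m..k + m}. (r l - \<rho> l)\<^sup>2) + C3 * \<eta>\<^sup>2 * (2 * m + 1)"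
    if m: "m \<ge> 2 * D" and bd: "\<forall>l\<in>{k - m..k + m}. c \<le> r l \<and> r l \<le> M \<and> c \<le> \<rho> l \<and> \<rho> l \<le> M"
      and res: "\<forall>l\<in>{k - m..k + m}. \<bar>string_op I v d r l - string_op I v d \<rho> l\<bar> \<le> \<eta>"
    for r \<rho> :: "int \<Rightarrow> real" and k m :: int and \<eta> :: real
  proof -
    define W where "W j = {k - (m - j)..k + (m - j)}" for j
    define \<delta> where "\<delta> l = r l - \<rho> l" for l
    define L where "L l = ln (r l) - ln (\<rho> l)" for l
    have Wm: "W j \<subseteq> W 0" if "j \<ge> 0" for j using that by (auto simp: W_def)
    have [simp]: "finite (W j)" for j by (simp add: W_def)
    have bdW: "c \<le> r l" "r l \<le> M" "c \<le> \<rho> l" "\<rho> l \<le> M" if "l \<in> W 0" for l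
      using bd that by (auto simp: W_def)
    have L: "\<bar>L l\<bar> \<le> \<bar>\<delta> l\<bar> / c" "L l * \<delta> l \<ge> (\<delta> l)\<^sup>2 / M" if "l \<in> W 0" for l
      unfolding L_def \<delta>_def using ln_diff_bounds[of c "r l" M "\<rho> l"] bdW[OF that] c by auto
    have \<eta>: "\<eta> \<ge> 0" using res m D by (intro order_trans[OF abs_ge_zero bspec[OF res, of k]]) auto
    \<comment> \<open>Cutting to the window gives the finite support that
      \<open>jpow_monotone\<close> asks for, at the price of wrong powers near the edge.\<close>
    define r' where "r' l = (if l \<in> W 0 then r l else 0)" for l
    define \<rho>' where "\<rho>' l = (if l \<in> W 0 then \<rho> l else 0)" for l
    define \<Phi> where "\<Phi> r l = (\<Sum>i\<in>I. v i * jpow r (d i) l (l - 1))" for r :: "int \<Rightarrow> real" and l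
    have mono: "0 \<le> (\<Sum>l\<in>W 0. L l * (\<Phi> r' l - \<Phi> \<rho>' l))"
    proof -
      have "0 \<le> (\<Sum>i\<in>I. v i * (\<Sum>l\<in>W 0. L l * (jpow r' (d i) l (l - 1) - jpow \<rho>' (d i) l (l - 1))))"
      proof (rule sum_nonneg, rule mult_nonneg_nonneg)
        fix i assume "i \<in> I"
        then show "0 \<le> v i" by (rule v)
        have "0 \<le> (\<Sum>l\<in>{k - m..k + m}. (ln (r' l) - ln (\<rho>' l)) * (jpow r' (d i) l (l - 1) - jpow \<rho>' (d i) l (l - 1)))"
          by (rule jpow_monotone) (use bdW c in \<open>force simp: r'_def \<rho>'_def W_def\<close>)+
        also have "\<dots> = (\<Sum>l\<in>W 0. L l * (jpow r' (d i) l (l - 1) - jpow \<rho>' (d i) l (l - 1)))"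
          by (intro sum.cong) (auto simp: W_def L_def r'_def \<rho>'_def)
        finally show "0 \<le> (\<Sum>l\<in>W 0. L l * (jpow r' (d i) l (l - 1) - jpow \<rho>' (d i) l (l - 1)))" .
      qed
      also have "\<dots> = (\<Sum>l\<in>W 0. L l * (\<Phi> r' l - \<Phi> \<rho>' l))"
        unfolding \<Phi>_def sum_subtractf[symmetric] sum_distrib_left
        by (subst sum.swap) (intro sum.cong refl, simp add: algebra_simps)
      finally show ?thesis .
    qed
    \<comment> \<open>At distance \<open>D\<close> from the edge walks of length \<open>d i\<close>
      do not notice the cut, so the residual appears, and the linear term of
      \<open>string_op\<close> has the good sign.\<close>
    have inner: "L l * (\<Phi> r' l - \<Phi> \<rho>' l) \<le> - (\<delta> l)\<^sup>2 / (2 * M) + C3 * \<eta>\<^sup>2" if l: "l \<in> W D" for l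
    proof -
      have l0: "l \<in> W 0" using l Wm[OF D(2)] by blast
      have "jpow r' (d i) l (l - 1) = jpow r (d i) l (l - 1)" "jpow \<rho>' (d i) l (l - 1) = jpow \<rho> (d i) l (l - 1)"
        if "i \<in> I" for i
        using D(1)[OF that] l by (intro jpow_cong; auto simp: r'_def \<rho>'_def W_def)+
      then have "\<Phi> r' l - \<Phi> \<rho>' l = (string_op I v d r l - string_op I v d \<rho> l) - \<delta> l"
        by (simp add: \<Phi>_def string_op_def \<delta>_def)
      then have "L l * (\<Phi> r' l - \<Phi> \<rho>' l) = L l * (string_op I v d r l - string_op I v d \<rho> l) - L l * \<delta> l"
        by (simp only: right_diff_distrib)
      also have "L l * (string_op I v d r l - string_op I v d \<rho> l) \<le> \<bar>L l\<bar> * \<bar>string_op I v d r l - string_op I v d \<rho> l\<bar>"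
        by (simp add: abs_mult[symmetric])
      also have "\<dots> \<le> \<bar>\<delta> l\<bar> / c * \<eta>"
        using L(1)[OF l0] res l0 by (intro mult_mono) (auto simp: W_def)
      also have "\<bar>\<delta> l\<bar> / c * \<eta> \<le> (\<delta> l)\<^sup>2 / (2 * M) + C3 * \<eta>\<^sup>2"
      proof -
        have "0 \<le> (\<bar>\<delta> l\<bar> / M - \<eta> / c)\<^sup>2 * M / 2" using M by simp
        also have "\<dots> = (\<delta> l)\<^sup>2 / (2 * M) + C3 * \<eta>\<^sup>2 - \<bar>\<delta> l\<bar> / c * \<eta>"
          using M c by (simp add: C3_def power2_eq_square field_simps)
        finally show ?thesis by simp
      qed
      finally show ?thesis using L(2)[OF l0] by (simp add: field_simps)
    qed
    \<comment> \<open>In the boundary layer only the Lipschitz bound is left; it costs squares of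
      \<open>\<delta>\<close> at sites within distance \<open>D\<close>.\<close>
    have outer: "L l * (\<Phi> r' l - \<Phi> \<rho>' l)
        \<le> C0 / c * (\<Sum>j\<in>{-D..D}. if l + j \<in> W 0 then (\<delta> l)\<^sup>2 + (\<delta> (l + j))\<^sup>2 else 0)" if l: "l \<in> W 0" for l
    proof -
      have b: "\<bar>r' l\<bar> \<le> M" "\<bar>\<rho>' l\<bar> \<le> M" for l using bdW[of l] c by (auto simp: r'_def \<rho>'_def)
      have "\<bar>\<Phi> r' l - \<Phi> \<rho>' l\<bar> \<le> (\<Sum>i\<in>I. v i * \<bar>jpow r' (d i) l (l - 1) - jpow \<rho>' (d i) l (l - 1)\<bar>)"
        unfolding \<Phi>_def sum_subtractf[symmetric] right_diff_distrib[symmetric]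
        by (rule order_trans[OF sum_abs]) (simp add: abs_mult v)
      also have "\<dots> \<le> (\<Sum>i\<in>I. v i * (Ci i * (\<Sum>j\<in>{l - D..l + D}. \<bar>r' j - \<rho>' j\<bar>)))"
      proof (intro sum_mono mult_left_mono v)
        fix i assume i: "i \<in> I"
        have "\<bar>jpow r' (d i) l (l - 1) - jpow \<rho>' (d i) l (l - 1)\<bar>
            \<le> Ci i * (\<Sum>j\<in>{l - int (d i)..l + int (d i)}. \<bar>r' j - \<rho>' j\<bar>)"
          by (rule lip) (use b in auto)
        also have "\<dots> \<le> Ci i * (\<Sum>j\<in>{l - D..l + D}. \<bar>r' j - \<rho>' j\<bar>)"
          by (intro mult_left_mono Ci sum_mono2) (use D(1)[OF i] in auto)
        finally show "\<bar>jpow r' (d i) l (l - 1) - jpow \<rho>' (d i) l (l - 1)\<bar>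
            \<le> Ci i * (\<Sum>j\<in>{l - D..l + D}. \<bar>r' j - \<rho>' j\<bar>)" .
      qed
      also have "\<dots> = C0 * (\<Sum>j\<in>{l - D..l + D}. \<bar>r' j - \<rho>' j\<bar>)"
        by (simp add: C0_def sum_distrib_right mult.assoc)
      also have "(\<Sum>j\<in>{l - D..l + D}. \<bar>r' j - \<rho>' j\<bar>) = (\<Sum>j\<in>{-D..D}. if l + j \<in> W 0 then \<bar>\<delta> (l + j)\<bar> else 0)"
        by (rule sum.reindex_bij_witness[of _ "\<lambda>j. l + j" "\<lambda>j. j - l"]) (auto simp: r'_def \<rho>'_def \<delta>_def)
      finally have "\<bar>L l\<bar> * \<bar>\<Phi> r' l - \<Phi> \<rho>' l\<bar>
         \<le> \<bar>\<delta> l\<bar> / c * (C0 * (\<Sum>j\<in>{-D..D}. if l + j \<in> W 0 then \<bar>\<delta> (l + j)\<bar> else 0))"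
        using L(1)[OF l] c by (intro mult_mono) auto
      also have "\<dots> = C0 / c * (\<Sum>j\<in>{-D..D}. if l + j \<in> W 0 then \<bar>\<delta> l\<bar> * \<bar>\<delta> (l + j)\<bar> else 0)"
        by (simp add: sum_distrib_left if_distrib[of "\<lambda>x. _ * x"] algebra_simps cong: if_cong)
      also have "\<dots> \<le> C0 / c * (\<Sum>j\<in>{-D..D}. if l + j \<in> W 0 then (\<delta> l)\<^sup>2 + (\<delta> (l + j))\<^sup>2 else 0)"
      proof (intro mult_left_mono sum_mono)
        fix j
        have "2 * (\<bar>\<delta> l\<bar> * \<bar>\<delta> (l + j)\<bar>) \<le> (\<delta> l)\<^sup>2 + (\<delta> (l + j))\<^sup>2"
          using sum_squares_bound[of "\<bar>\<delta> l\<bar>" "\<bar>\<delta> (l + j)\<bar>"] by (simp add: mult.assoc)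
        moreover have "0 \<le> \<bar>\<delta> l\<bar> * \<bar>\<delta> (l + j)\<bar>" by simp
        ultimately have "\<bar>\<delta> l\<bar> * \<bar>\<delta> (l + j)\<bar> \<le> (\<delta> l)\<^sup>2 + (\<delta> (l + j))\<^sup>2" by linarith
        then show "(if l + j \<in> W 0 then \<bar>\<delta> l\<bar> * \<bar>\<delta> (l + j)\<bar> else 0)
           \<le> (if l + j \<in> W 0 then (\<delta> l)\<^sup>2 + (\<delta> (l + j))\<^sup>2 else 0)" by simp
      qed (use C0 c in auto)
      finally have "\<bar>L l\<bar> * \<bar>\<Phi> r' l - \<Phi> \<rho>' l\<bar>
          \<le> C0 / c * (\<Sum>j\<in>{-D..D}. if l + j \<in> W 0 then (\<delta> l)\<^sup>2 + (\<delta> (l + j))\<^sup>2 else 0)" .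
      moreover have "L l * (\<Phi> r' l - \<Phi> \<rho>' l) \<le> \<bar>L l\<bar> * \<bar>\<Phi> r' l - \<Phi> \<rho>' l\<bar>"
        by (simp only: abs_mult[symmetric] abs_ge_self)
      ultimately show ?thesis by (rule order_trans[rotated])
    qed
    define Q where "Q j = (\<Sum>l\<in>W j. (\<delta> l)\<^sup>2)" for j
    define B where "B = W 0 - W D"
    have split0: "W 0 = W D \<union> B" "W D \<inter> B = {}" "finite B" using Wm[OF D(2)] by (auto simp: B_def)
    have "(\<Sum>l\<in>W 0. L l * (\<Phi> r' l - \<Phi> \<rho>' l)) \<le> (\<Sum>l\<in>W D. - (\<delta> l)\<^sup>2 / (2 * M) + C3 * \<eta>\<^sup>2)
       + (\<Sum>l\<in>B. C0 / c * (\<Sum>j\<in>{-D..D}. if l + j \<in> W 0 then (\<delta> l)\<^sup>2 + (\<delta> (l + j))\<^sup>2 else 0))"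
      unfolding split0(1) sum.union_disjoint[OF _ split0(3) split0(2), simplified]
      by (intro add_mono sum_mono inner) (use outer split0 in auto)
    also have "(\<Sum>l\<in>W D. - (\<delta> l)\<^sup>2 / (2 * M) + C3 * \<eta>\<^sup>2) = - Q D / (2 * M) + C3 * \<eta>\<^sup>2 * real (card (W D))"
      by (simp add: sum_subtractf Q_def sum_divide_distrib)
    also have "(\<Sum>l\<in>B. C0 / c * (\<Sum>j\<in>{-D..D}. if l + j \<in> W 0 then (\<delta> l)\<^sup>2 + (\<delta> (l + j))\<^sup>2 else 0))
       \<le> C1 * (Q 0 - Q (2 * D))"
    proof -
      \<comment> \<open>A layer of width \<open>D\<close> moved by at most \<open>D\<close> inside
        the window stays in the layer of width \<open>2 D\<close>.\<close>
      define B2 where "B2 = W 0 - W (2 * D)"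
      have QB2: "(\<Sum>l\<in>B2. (\<delta> l)\<^sup>2) = Q 0 - Q (2 * D)"
        unfolding B2_def Q_def by (rule sum_diff) (use Wm[of "2 * D"] D in auto)
      have "(\<Sum>l\<in>B. (\<Sum>j\<in>{-D..D}. if l + j \<in> W 0 then (\<delta> l)\<^sup>2 + (\<delta> (l + j))\<^sup>2 else 0))
         = (\<Sum>j\<in>{-D..D}. \<Sum>l\<in>B. if l + j \<in> W 0 then (\<delta> l)\<^sup>2 + (\<delta> (l + j))\<^sup>2 else 0)"
        by (rule sum.swap)
      also have "\<dots> \<le> (\<Sum>j\<in>{-D..D}. 2 * (Q 0 - Q (2 * D)))"
      proof (rule sum_mono)
        fix j assume j: "j \<in> {-D..D}"
        define B' where "B' = {l \<in> B. l + j \<in> W 0}"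
        have "(\<Sum>l\<in>B. if l + j \<in> W 0 then (\<delta> l)\<^sup>2 + (\<delta> (l + j))\<^sup>2 else 0) = (\<Sum>l\<in>B'. (\<delta> l)\<^sup>2) + (\<Sum>l\<in>B'. (\<delta> (l + j))\<^sup>2)"
          unfolding B'_def sum.distrib[symmetric] using split0(3) by (simp add: sum.inter_filter)
        also have "(\<Sum>l\<in>B'. (\<delta> l)\<^sup>2) \<le> (\<Sum>l\<in>B2. (\<delta> l)\<^sup>2)"
          by (rule sum_mono2) (use D in \<open>auto simp: B'_def B_def B2_def W_def\<close>)
        also have "(\<Sum>l\<in>B'. (\<delta> (l + j))\<^sup>2) = (\<Sum>l\<in>(\<lambda>l. l + j) ` B'. (\<delta> l)\<^sup>2)"
          by (subst sum.reindex) (auto simp: inj_on_def)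
        also have "\<dots> \<le> (\<Sum>l\<in>B2. (\<delta> l)\<^sup>2)"
          by (rule sum_mono2) (use j in \<open>auto simp: B'_def B_def B2_def W_def\<close>)
        finally show "(\<Sum>l\<in>B. if l + j \<in> W 0 then (\<delta> l)\<^sup>2 + (\<delta> (l + j))\<^sup>2 else 0) \<le> 2 * (Q 0 - Q (2 * D))"
          by (simp add: QB2)
      qed
      also have "\<dots> = 2 * (2 * D + 1) * (Q 0 - Q (2 * D))" using D by (simp add: algebra_simps)
      finally have "C0 / c * (\<Sum>l\<in>B. (\<Sum>j\<in>{-D..D}. if l + j \<in> W 0 then (\<delta> l)\<^sup>2 + (\<delta> (l + j))\<^sup>2 else 0))
          \<le> C0 / c * (2 * (2 * D + 1) * (Q 0 - Q (2 * D)))"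
        by (rule mult_left_mono) (use C0 c in simp)
      then show ?thesis by (simp only: C1_def sum_distrib_left[symmetric] mult.assoc)
    qed
    finally have "0 \<le> - Q D / (2 * M) + C3 * \<eta>\<^sup>2 * real (card (W D)) + C1 * (Q 0 - Q (2 * D))"
      using mono by linarith
    moreover have "Q (2 * D) \<le> Q D" unfolding Q_def by (rule sum_mono2) (use D in \<open>auto simp: W_def\<close>)
    then have "Q (2 * D) / (2 * M) \<le> Q D / (2 * M)" using M by (intro divide_right_mono) auto
    moreover have "C3 * \<eta>\<^sup>2 * real (card (W D)) \<le> C3 * \<eta>\<^sup>2 * (2 * m + 1)"
      using C3 D m by (intro mult_left_mono) (auto simp: W_def)
    ultimately have "Q (2 * D) * (1 / (2 * M) + C1) \<le> C1 * Q 0 + C3 * \<eta>\<^sup>2 * (2 * m + 1)"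
      by (simp add: algebra_simps)
    then show ?thesis by (simp add: Q_def W_def \<delta>_def)
  qed
  \<comment> \<open>After multiplication by \<open>2 M\<close>, the summand \<open>2 M C3\<close> is
    added on both sides, to the inner sum and to the larger outer one, so that a single constant
    serves everywhere.\<close>
  define C where "C = 2 * M * (C1 + C3)"
  have C: "C > 0" using M C1 C3 by (simp add: C_def)
  show ?thesis
  proof (intro exI[of _ C] conjI C allI impI)
    fix r \<rho> :: "int \<Rightarrow> real" and k m :: int and \<eta> :: real
    assume a: "m \<ge> 2 * D" "\<forall>l\<in>{k - m..k + m}. c \<le> r l \<and> r l \<le> M \<and> c \<le> \<rho> l \<and> \<rho> l \<le> M"
      "\<forall>l\<in>{k - m..k + m}. \<bar>string_op I v d r l - string_op I v d \<rho> l\<bar> \<le> \<eta>"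
    let ?E2 = "\<Sum>l\<in>{k - (m - 2 * D)..k + (m - 2 * D)}. (r l - \<rho> l)\<^sup>2"
    let ?E0 = "\<Sum>l\<in>{k - m..k + m}. (r l - \<rho> l)\<^sup>2"
    have le: "?E2 \<le> ?E0" by (rule sum_mono2) (use D in auto)
    have "?E2 * (1 + 2 * M * C1) = 2 * M * (?E2 * (1 / (2 * M) + C1))" using M by (simp add: field_simps)
    also have "\<dots> \<le> 2 * M * (C1 * ?E0 + C3 * \<eta>\<^sup>2 * (2 * m + 1))"
      by (rule mult_left_mono[OF main[OF a]]) (use M in simp)
    finally have 1: "?E2 * (1 + 2 * M * C1) \<le> 2 * M * (C1 * ?E0 + C3 * \<eta>\<^sup>2 * (2 * m + 1))" .
    have 2: "?E2 * (2 * M * C3) \<le> ?E0 * (2 * M * C3)" using le M C3 by (intro mult_right_mono) auto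
    have 3: "0 \<le> 2 * M * C1 * (\<eta>\<^sup>2 * (2 * m + 1))" using M C1 a(1) D by (intro mult_nonneg_nonneg) auto
    show "?E2 * (1 + C) \<le> C * ?E0 + C * \<eta>\<^sup>2 * (2 * m + 1)"
      using 1 2 3 unfolding C_def by (simp add: algebra_simps)
  qed
qed

subsection \<open>Stability of the string equation\<close>

text \<open>Each use of the hole filling inequality shrinks the window by \<open>2 D\<close> at both
  ends and gains the factor \<open>\<theta> = C / (1 + C)\<close>. After \<open>J\<close> rounds
  only the site \<open>k\<close> is left; \<open>4 D J + 1\<close> is the size of the largest
  window.\<close>

lemma string_stability:
  fixes v :: "'i \<Rightarrow> real"
  assumes I: "finite I" and v: "\<And>i. i \<in> I \<Longrightarrow> v i \<ge> 0" and D: "\<And>i. i \<in> I \<Longrightarrow> d i \<le> D"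
    and c: "0 < c" "c \<le> M"
  shows "\<exists>C>0. \<exists>\<theta>. 0 < \<theta> \<and> \<theta> < 1 \<and> (\<forall>r \<rho> k J \<eta>.
     (\<forall>l\<in>{k - int (2 * D * J)..k + int (2 * D * J)}. c \<le> r l \<and> r l \<le> M \<and> c \<le> \<rho> l \<and> \<rho> l \<le> M) \<longrightarrow>
     (\<forall>l\<in>{k - int (2 * D * J)..k + int (2 * D * J)}. \<bar>string_op I v d r l - string_op I v d \<rho> l\<bar> \<le> \<eta>) \<longrightarrow>
     (r k - \<rho> k)\<^sup>2 \<le> (4 * D * J + 1) * (\<theta> ^ J * M\<^sup>2 + C * \<eta>\<^sup>2))"
proof -
  obtain C where C: "C > 0" and hole: "\<And>r \<rho> k m \<eta>. m \<ge> 2 * int D \<Longrightarrow>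
     (\<forall>l\<in>{k - m..k + m}. c \<le> r l \<and> r l \<le> M \<and> c \<le> \<rho> l \<and> \<rho> l \<le> M) \<Longrightarrow>
     (\<forall>l\<in>{k - m..k + m}. \<bar>string_op I v d r l - string_op I v d \<rho> l\<bar> \<le> \<eta>) \<Longrightarrow>
     (\<Sum>l\<in>{k - (m - 2 * int D)..k + (m - 2 * int D)}. (r l - \<rho> l)\<^sup>2) * (1 + C)
       \<le> C * (\<Sum>l\<in>{k - m..k + m}. (r l - \<rho> l)\<^sup>2) + C * \<eta>\<^sup>2 * (2 * m + 1)"
    using string_hole_filling[of I v d "int D" c M] I v D c by auto
  define \<theta> where "\<theta> = C / (1 + C)"
  have \<theta>: "0 < \<theta>" "\<theta> < 1" using C by (auto simp: \<theta>_def)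
  have "(r k - \<rho> k)\<^sup>2 \<le> (4 * D * J + 1) * (\<theta> ^ J * M\<^sup>2 + (1 + C) * \<eta>\<^sup>2)"
    if bd: "\<forall>l\<in>{k - int (2 * D * J)..k + int (2 * D * J)}. c \<le> r l \<and> r l \<le> M \<and> c \<le> \<rho> l \<and> \<rho> l \<le> M"
      and res: "\<forall>l\<in>{k - int (2 * D * J)..k + int (2 * D * J)}. \<bar>string_op I v d r l - string_op I v d \<rho> l\<bar> \<le> \<eta>"
    for r \<rho> :: "int \<Rightarrow> real" and k J \<eta>
  proof -
    define a where "a j = (\<Sum>l\<in>{k - int (2 * D * j)..k + int (2 * D * j)}. (r l - \<rho> l)\<^sup>2)" for j
    define K where "K = \<eta>\<^sup>2 * (4 * D * J + 1)"
    have K: "K \<ge> 0" by (simp add: K_def)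
    have step: "a j \<le> \<theta> * a (Suc j) + K" if "j < J" for j
    proof -
      define m where "m = int (2 * D * Suc j)"
      have mJ: "2 * D * Suc j \<le> 2 * D * J" using that by (intro mult_le_mono) auto
      have sub: "{k - m..k + m} \<subseteq> {k - int (2 * D * J)..k + int (2 * D * J)}"
      proof -
        have "m \<le> int (2 * D * J)" unfolding m_def using mJ by (simp only: of_nat_le_iff)
        then show ?thesis by auto
      qed
      have mD: "m - 2 * int D = int (2 * D * j)" "m \<ge> 2 * int D" by (simp_all add: m_def algebra_simps)
      have "a j * (1 + C) \<le> C * a (Suc j) + C * \<eta>\<^sup>2 * (2 * m + 1)"
      proof -
        have "\<forall>l\<in>{k - m..k + m}. c \<le> r l \<and> r l \<le> M \<and> c \<le> \<rho> l \<and> \<rho> l \<le> M"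
          using bd sub by blast
        moreover have "\<forall>l\<in>{k - m..k + m}. \<bar>string_op I v d r l - string_op I v d \<rho> l\<bar> \<le> \<eta>"
          using res sub by blast
        ultimately show ?thesis
          using hole[of m k r \<rho> \<eta>, OF mD(2)] by (simp only: mD(1) a_def m_def[symmetric])
      qed
      also have "C * \<eta>\<^sup>2 * (2 * m + 1) \<le> C * K"
      proof -
        have "real_of_int (2 * m + 1) \<le> real (4 * D * J + 1)"
        proof -
          have "2 * m + 1 \<le> int (4 * D * J + 1)" using mJ unfolding m_def by linarith
          then show ?thesis by linarith
        qed
        then show ?thesis using C unfolding K_def by (simp only: mult.assoc) (intro mult_left_mono; simp)
      qed
      finally have "a j \<le> (C * a (Suc j) + C * K) / (1 + C)" using C by (simp add: field_simps)
      also have "\<dots> = \<theta> * a (Suc j) + \<theta> * K" by (simp add: \<theta>_def add_divide_distrib)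
      also have "\<dots> \<le> \<theta> * a (Suc j) + K" using \<theta> K by (simp add: mult_left_le_one_le)
      finally show ?thesis .
    qed
    have "a 0 \<le> \<theta> ^ i * a i + K * (\<Sum>j<i. \<theta> ^ j)" if "i \<le> J" for i
      using that
    proof (induction i)
      case (Suc i)
      have "a 0 \<le> \<theta> ^ i * a i + K * (\<Sum>j<i. \<theta> ^ j)" using Suc by simp
      also have "\<theta> ^ i * a i \<le> \<theta> ^ i * (\<theta> * a (Suc i) + K)"
        using step[of i] Suc.prems \<theta> by (intro mult_left_mono) auto
      finally show ?case by (simp add: algebra_simps)
    qed simp
    then have a0: "a 0 \<le> \<theta> ^ J * a J + K * (\<Sum>j<J. \<theta> ^ j)" by simp
    have "(\<Sum>j<J. \<theta> ^ j) \<le> 1 + C"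
    proof -
      have "(\<Sum>j<J. \<theta> ^ j) = (1 - \<theta> ^ J) / (1 - \<theta>)" using \<theta> by (simp add: sum_gp_strict)
      also have "\<dots> \<le> 1 / (1 - \<theta>)" using \<theta> by (intro divide_right_mono) auto
      also have "\<dots> = 1 + C" using C by (simp add: \<theta>_def field_simps)
      finally show ?thesis .
    qed
    then have 1: "K * (\<Sum>j<J. \<theta> ^ j) \<le> K * (1 + C)" by (rule mult_left_mono[OF _ K])
    have "a J \<le> (4 * D * J + 1) * M\<^sup>2"
    proof -
      have "a J \<le> (\<Sum>l\<in>{k - int (2 * D * J)..k + int (2 * D * J)}. M\<^sup>2)"
        unfolding a_def
      proof (rule sum_mono)
        fix l assume "l \<in> {k - int (2 * D * J)..k + int (2 * D * J)}"
        then have "\<bar>r l - \<rho> l\<bar> \<le> \<bar>M\<bar>" using bd c by fastforce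
        then show "(r l - \<rho> l)\<^sup>2 \<le> M\<^sup>2" by (simp only: abs_le_square_iff)
      qed
      also have "\<dots> = (4 * D * J + 1) * M\<^sup>2" by simp
      finally show ?thesis .
    qed
    then have 2: "\<theta> ^ J * a J \<le> \<theta> ^ J * ((4 * D * J + 1) * M\<^sup>2)" using \<theta> by (intro mult_left_mono) auto
    have "(r k - \<rho> k)\<^sup>2 = a 0" by (simp add: a_def)
    also have "\<dots> \<le> \<theta> ^ J * ((4 * D * J + 1) * M\<^sup>2) + K * (1 + C)" using a0 1 2 by linarith
    also have "\<dots> = (4 * D * J + 1) * (\<theta> ^ J * M\<^sup>2 + (1 + C) * \<eta>\<^sup>2)"
      by (simp add: K_def algebra_simps)
    finally show ?thesis .
  qed
  then show ?thesis using C \<theta> by (intro exI[of _ "1 + C"] conjI exI[of _ \<theta>]) auto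
qed

lemma power_le_fact_exp: "0 \<le> x \<Longrightarrow> x ^ n \<le> fact n * exp (x::real)"
proof -
  assume x: "0 \<le> x"
  have "(\<lambda>n. x ^ n /\<^sub>R fact n) sums exp x" by (rule exp_converges)
  then have "(\<Sum>i\<in>{n}. x ^ i /\<^sub>R fact i) \<le> exp x"
    using x by (metis (no_types, lifting) sum_le_suminf sums_unique sums_summable finite.emptyI finite.insertI
      scaleR_nonneg_nonneg zero_le_power inverse_nonnegative_iff_nonnegative fact_ge_zero)
  then show ?thesis by (simp add: field_simps)
qed

text \<open>With \<open>j = k div N\<close> and \<open>a = - ln \<theta>\<close>, the inequality
  \<open>x^Q \<le> Q! exp x\<close> at \<open>x = a (j + 1)\<close> bounds the power of
  \<open>k \<le> N (j + 1)\<close> by a multiple of \<open>\<theta>^-(j+1)\<close>; one factor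
  \<open>1 / \<theta>\<close> is left over.\<close>

lemma geometric_div_power_bounded:
  fixes \<theta> :: real
  assumes \<theta>: "0 < \<theta>" "\<theta> < 1" and N: "N \<ge> 1"
  shows "\<exists>B>0. \<forall>k. \<theta> ^ (k div N) * real k ^ Q \<le> B"
proof -
  define a where "a = - ln \<theta>"
  have a: "a > 0" using \<theta> by (simp add: a_def)
  define B where "B = real N ^ Q * fact Q / a ^ Q / \<theta>"
  have "\<theta> ^ (k div N) * real k ^ Q \<le> B" for k
  proof -
    define j where "j = k div N"
    have "k \<le> N * (j + 1)"
      unfolding j_def using N by (metis add.commute dividend_less_times_div le_simps(1) less_le_trans zero_less_one plus_1_eq_Suc mult_Suc_right)
    then have "real k \<le> real N * real (j + 1)" by (metis of_nat_le_iff of_nat_mult)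
    then have "real k ^ Q \<le> (real N * real (j + 1)) ^ Q" by (intro power_mono) auto
    also have "\<dots> = real N ^ Q / a ^ Q * (a * real (j + 1)) ^ Q" using a by (simp add: power_mult_distrib)
    also have "\<dots> \<le> real N ^ Q / a ^ Q * (fact Q * exp (a * real (j + 1)))"
      using a by (intro mult_left_mono power_le_fact_exp) auto
    finally have "\<theta> ^ j * real k ^ Q \<le> \<theta> ^ j * (real N ^ Q / a ^ Q * (fact Q * exp (a * real (j + 1))))"
      using \<theta> by (intro mult_left_mono) auto
    also have "exp (a * real (j + 1)) = inverse (\<theta> ^ (j + 1))"
    proof -
      have "exp (a * real (j + 1)) = exp a ^ (j + 1)" by (metis exp_of_nat_mult mult.commute)
      also have "exp a = inverse \<theta>" using \<theta> by (simp add: a_def exp_minus)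
      finally show ?thesis by (simp only: power_inverse)
    qed
    finally show ?thesis using \<theta> by (simp add: B_def j_def field_simps)
  qed
  moreover have "B > 0" using a \<theta> N by (simp add: B_def)
  ultimately show ?thesis by blast
qed

text \<open>All terms of the string equation are nonnegative, which bounds \<open>R k l\<close>
  above by \<open>l / k\<close>; factoring \<open>R k l\<close> out of it bounds it below. So both
  sequences lie in a compact set of positive numbers on the window, and stability applies with
  radius about \<open>k / 2\<close>. The lost factor \<open>k\<close> is recovered later by
  truncating at a higher order.\<close>

lemma string_asymptotics:
  fixes v :: "'i \<Rightarrow> real" and R \<rho> :: "nat \<Rightarrow> int \<Rightarrow> real"
  assumes I: "finite I" and v: "\<And>i. i \<in> I \<Longrightarrow> v i \<ge> 0"
    and R: "\<And>k l. k \<ge> 1 \<Longrightarrow> R k l \<ge> 0" "\<And>k l. k \<ge> 1 \<Longrightarrow> l \<le> 0 \<Longrightarrow> R k l = 0"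
    and string: "\<And>k l. k \<ge> 1 \<Longrightarrow> l \<ge> 1 \<Longrightarrow> string_op I v d (R k) l = of_int l / real k"
    and c: "0 < c" "c \<le> M"
    and \<rho>: "\<And>k l. k \<ge> k0 \<Longrightarrow> int k \<le> 2 * l \<Longrightarrow> 2 * l \<le> 3 * int k \<Longrightarrow> c \<le> \<rho> k l \<and> \<rho> k l \<le> M"
    and approx: "\<And>k l. k \<ge> k0 \<Longrightarrow> int k \<le> 2 * l \<Longrightarrow> 2 * l \<le> 3 * int k \<Longrightarrow>
       \<bar>string_op I v d (\<rho> k) l - of_int l / real k\<bar> \<le> A / real k ^ P"
  shows "\<exists>B k1. \<forall>k\<ge>k1. (R k (int k) - \<rho> k (int k))\<^sup>2 \<le> B * real k / real k ^ (2 * P)"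
proof -
  define D where "D = (\<Sum>i\<in>I. d i) + 1"
  have D: "d i \<le> D" if "i \<in> I" for i
    using member_le_sum[of i I d] I that by (simp add: D_def)
  have D1: "D \<ge> 1" by (simp add: D_def)
  \<comment> \<open>The base 3 is \<open>1 + 2\<close>: \<open>jpow_bound\<close> is used with the
    bound 2, valid for \<open>R k\<close> at sites up to \<open>2 k\<close>.\<close>
  define s where "s = 1 + (\<Sum>i\<in>I. v i * 3 ^ d i)"
  have s: "s \<ge> 1" unfolding s_def using v by (simp add: sum_nonneg)
  define c' where "c' = min c (1 / (2 * s))"
  define M' where "M' = max M 2"
  have c': "0 < c'" "c' \<le> M'" using c s by (auto simp: c'_def M'_def)
  have upper: "R k l \<le> of_int l / real k" if "k \<ge> 1" "l \<ge> 1" for k l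
  proof -
    have "0 \<le> (\<Sum>i\<in>I. v i * jpow (R k) (d i) l (l - 1))"
      by (intro sum_nonneg mult_nonneg_nonneg v jpow_nonneg R(1)[OF that(1)])
    then show ?thesis using string[OF that] by (simp add: string_op_def)
  qed
  have lower: "1 / (2 * s) \<le> R k l" if k: "k \<ge> 2 * D" "int k \<le> 2 * l" "2 * l \<le> 3 * int k" for k l
  proof -
    have k1: "k \<ge> 1" using k D1 by linarith
    have l1: "l \<ge> 1" using k k1 by linarith
    \<comment> \<open>\<open>jpow_bound\<close> asks for a global bound, so the sequence is cut
      beyond \<open>2 k\<close>, out of reach of the walks that start in the window.\<close>
    define R' where "R' j = (if j \<le> 2 * int k then R k j else 0)" for j
    have R': "\<bar>R' j\<bar> \<le> 2" for j
    proof (cases "1 \<le> j \<and> j \<le> 2 * int k")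
      case True
      then have "R k j \<le> of_int j / real k" by (intro upper[OF k1]) auto
      also have "\<dots> \<le> of_int (2 * int k) / real k" using True by (intro divide_right_mono) linarith+
      also have "\<dots> = 2" using k1 by simp
      finally show ?thesis using R(1)[OF k1, of j] by (simp add: R'_def)
    qed (use R(2)[OF k1, of j] in \<open>auto simp: R'_def\<close>)
    have "jpow (R k) (d i) (l - 1) l \<le> 3 ^ d i" if "i \<in> I" for i
    proof -
      have "jpow (R k) (d i) (l - 1) l = jpow R' (d i) (l - 1) l"
        by (rule jpow_cong) (use D[OF that] k in \<open>auto simp: R'_def\<close>)
      also have "\<dots> \<le> (1 + 2) ^ d i" using jpow_bound[of R' 2 "d i" "l - 1" l, OF R'] by linarith
      finally show ?thesis by simp
    qed
    then have "1 + (\<Sum>i\<in>I. v i * jpow (R k) (d i) (l - 1) l) \<le> s"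
      unfolding s_def by (intro add_mono sum_mono mult_left_mono v) auto
    then have "R k l * (1 + (\<Sum>i\<in>I. v i * jpow (R k) (d i) (l - 1) l)) \<le> R k l * s"
      by (rule mult_left_mono[OF _ R(1)[OF k1]])
    also have "R k l * (1 + (\<Sum>i\<in>I. v i * jpow (R k) (d i) (l - 1) l)) = string_op I v d (R k) l"
      by (simp add: string_op_def jpow_down[of _ _ l] sum_distrib_left algebra_simps)
    also have "\<dots> = of_int l / real k" by (rule string[OF k1 l1])
    finally have "of_int l / real k \<le> R k l * s" .
    moreover have "1 / 2 \<le> of_int l / real k" using k k1 by (simp add: field_simps)
    ultimately have "1 / 2 \<le> R k l * s" by (rule order_trans[rotated])
    then show ?thesis using s by (simp add: field_simps)
  qed
  obtain C \<theta> where C: "C > 0" and \<theta>: "0 < \<theta>" "\<theta> < 1" and stab: "\<And>r \<rho> k J \<eta>.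
     (\<forall>l\<in>{k - int (2 * D * J)..k + int (2 * D * J)}. c' \<le> r l \<and> r l \<le> M' \<and> c' \<le> \<rho> l \<and> \<rho> l \<le> M') \<Longrightarrow>
     (\<forall>l\<in>{k - int (2 * D * J)..k + int (2 * D * J)}. \<bar>string_op I v d r l - string_op I v d \<rho> l\<bar> \<le> \<eta>) \<Longrightarrow>
     (r k - \<rho> k)\<^sup>2 \<le> (4 * D * J + 1) * (\<theta> ^ J * M'\<^sup>2 + C * \<eta>\<^sup>2)"
    using string_stability[of I v d D c' M', OF I v D c'] by blast
  obtain B where B: "B > 0" "\<And>k. \<theta> ^ (k div (4 * D)) * real k ^ (2 * P) \<le> B"
    using geometric_div_power_bounded[OF \<theta>, of "4 * D" "2 * P"] D1 by auto
  show ?thesis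
  proof (intro exI allI impI)
    fix k assume "k \<ge> max (max k0 (2 * D)) 1"
    then have k: "k \<ge> k0" "k \<ge> 2 * D" "k \<ge> 1" by auto
    \<comment> \<open>Then \<open>2 D J \<le> k / 2\<close> keeps the window between
      \<open>k / 2\<close> and \<open>3 k / 2\<close>, while \<open>J\<close> still grows linearly
      in \<open>k\<close>.\<close>
    define J where "J = k div (4 * D)"
    have "4 * D * J \<le> k" by (simp add: J_def)
    then have DJ: "2 * int (2 * D * J) \<le> int k" by linarith
    have win: "int k \<le> 2 * l" "2 * l \<le> 3 * int k" if "l \<in> {int k - int (2 * D * J)..int k + int (2 * D * J)}" for l
      using that DJ by (auto simp del: of_nat_mult)
    have "(R k (int k) - \<rho> k (int k))\<^sup>2 \<le> (4 * D * J + 1) * (\<theta> ^ J * M'\<^sup>2 + C * (A / real k ^ P)\<^sup>2)"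
    proof (rule stab; intro ballI)
      fix l assume l: "l \<in> {int k - int (2 * D * J)..int k + int (2 * D * J)}"
      have l1: "l \<ge> 1" using win(1)[OF l] k by linarith
      have "R k l \<le> of_int l / real k" by (rule upper[OF k(3) l1])
      also have "\<dots> \<le> 2" using win(2)[OF l] k by (simp add: field_simps)
      finally have "R k l \<le> 2" .
      then show "c' \<le> R k l \<and> R k l \<le> M' \<and> c' \<le> \<rho> k l \<and> \<rho> k l \<le> M'"
        using lower[OF k(2) win[OF l]] \<rho>[OF k(1) win[OF l]] by (auto simp: c'_def M'_def)
      show "\<bar>string_op I v d (R k) l - string_op I v d (\<rho> k) l\<bar> \<le> A / real k ^ P"
        using approx[OF k(1) win[OF l]] string[OF k(3) l1] by (simp add: abs_minus_commute)
    qed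
    also have "\<dots> \<le> (2 * real k) * ((B * M'\<^sup>2 + C * A\<^sup>2) / real k ^ (2 * P))"
    proof (intro mult_mono)
      have "4 * D * J + 1 \<le> 2 * k" using \<open>4 * D * J \<le> k\<close> k by linarith
      then show "real (4 * D * J + 1) \<le> 2 * real k" by linarith
      have "\<theta> ^ J \<le> B / real k ^ (2 * P)" using B(2)[of k] k by (simp add: J_def field_simps)
      then have "\<theta> ^ J * M'\<^sup>2 \<le> B / real k ^ (2 * P) * M'\<^sup>2" by (intro mult_right_mono) auto
      then show "\<theta> ^ J * M'\<^sup>2 + C * (A / real k ^ P)\<^sup>2 \<le> (B * M'\<^sup>2 + C * A\<^sup>2) / real k ^ (2 * P)"
        by (simp add: power_divide power_mult[symmetric] add_divide_distrib mult.commute)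
    qed (use \<theta> C in auto)
    finally show "(R k (int k) - \<rho> k (int k))\<^sup>2 \<le> (2 * (B * M'\<^sup>2 + C * A\<^sup>2)) * real k / real k ^ (2 * P)"
      by (simp add: algebra_simps)
  qed
qed

subsection \<open>Smooth functions of the space variable and the times\<close>

definition toda_dom :: "(real \<times> real \<times> real) set" where "toda_dom = {0<..} \<times> {..0} \<times> {..0}"

definition eW :: "real \<times> real \<times> real" where "eW = (1, 0, 0)"
text \<open>Throughout, \<open>True\<close> stands for the first time and \<open>False\<close> for
  the second.\<close>

definition eS :: "bool \<Rightarrow> real \<times> real \<times> real" where "eS i = (if i then (0, 1, 0) else (0, 0, 1))"
definition Dirs :: "(real \<times> real \<times> real) set" where "Dirs = {eW, eS True, eS False}"

lemma Dirs_cases: "e \<in> Dirs \<Longrightarrow> (e = (1, 0, 0) \<Longrightarrow> P) \<Longrightarrow> (e = (0, 1, 0) \<Longrightarrow> P) \<Longrightarrow> (e = (0, 0, 1) \<Longrightarrow> P) \<Longrightarrow> P"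
  by (auto simp: Dirs_def eW_def eS_def)

lemma eW_Dirs[simp]: "eW \<in> Dirs" and eS_Dirs[simp]: "eS i \<in> Dirs"
  by (cases i; simp add: Dirs_def)+

text \<open>Each coordinate direction can be followed backwards from every point, including those
  where a time is 0, so derivatives can be probed by backward increments up to the boundary.\<close>

lemma toda_dom_left:
  assumes "x \<in> toda_dom" obtains \<tau> where "\<tau> > 0"
    "\<And>s t e e'. e \<in> Dirs \<Longrightarrow> e' \<in> Dirs \<Longrightarrow> 0 \<le> s \<Longrightarrow> s \<le> \<tau> \<Longrightarrow> 0 \<le> t \<Longrightarrow> t \<le> \<tau> \<Longrightarrow> x - s *\<^sub>R e - t *\<^sub>R e' \<in> toda_dom"
proof
  show "fst x / 3 > 0" using assms by (auto simp: toda_dom_def)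
  fix s t :: real and e e' :: "real \<times> real \<times> real"
  assume *: "e \<in> Dirs" "e' \<in> Dirs" "0 \<le> s" "s \<le> fst x / 3" "0 \<le> t" "t \<le> fst x / 3"
  have "fst x > 0" using assms by (auto simp: toda_dom_def)
  show "x - s *\<^sub>R e - t *\<^sub>R e' \<in> toda_dom"
    using *(1) by (rule Dirs_cases; use *(2) in \<open>rule Dirs_cases\<close>)
      (use *(3-) assms \<open>fst x > 0\<close> in \<open>cases x; auto simp: toda_dom_def\<close>)+
qed

text \<open>The filter admits only increments that stay in the domain; where a time is 0 this is the
  one-sided derivative of \<open>smooth_on_quadrant\<close>.\<close>

definition has_partial :: "real \<times> real \<times> real \<Rightarrow> (real \<times> real \<times> real \<Rightarrow> real) \<Rightarrow> (real \<times> real \<times> real \<Rightarrow> real) \<Rightarrow> bool" where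
  "has_partial e u u' \<longleftrightarrow> (\<forall>x\<in>toda_dom. ((\<lambda>t. u (x + t *\<^sub>R e)) has_real_derivative u' x) (at 0 within {t. x + t *\<^sub>R e \<in> toda_dom}))"

lemma has_partial_cong:
  assumes "\<And>x. x \<in> toda_dom \<Longrightarrow> u x = v x" "\<And>x. x \<in> toda_dom \<Longrightarrow> u' x = v' x" and "has_partial e u u'"
  shows "has_partial e v v'"
  unfolding has_partial_def
proof
  fix x assume x: "x \<in> toda_dom"
  have "((\<lambda>t. u (x + t *\<^sub>R e)) has_real_derivative v' x) (at 0 within {t. x + t *\<^sub>R e \<in> toda_dom})"
    using assms x by (simp add: has_partial_def)
  then show "((\<lambda>t. v (x + t *\<^sub>R e)) has_real_derivative v' x) (at 0 within {t. x + t *\<^sub>R e \<in> toda_dom})"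
    by (rule has_field_derivative_transform_within[where d = 1]) (use x assms in auto)
qed

lemma at_within_Dom_nontrivial:
  assumes "x \<in> toda_dom" "e \<in> Dirs" shows "at (0::real) within {t. x + t *\<^sub>R e \<in> toda_dom} \<noteq> bot"
proof -
  obtain \<tau> where \<tau>: "\<tau> > 0" "\<And>s t e e'. e \<in> Dirs \<Longrightarrow> e' \<in> Dirs \<Longrightarrow> 0 \<le> s \<Longrightarrow> s \<le> \<tau> \<Longrightarrow> 0 \<le> t \<Longrightarrow> t \<le> \<tau> \<Longrightarrow> x - s *\<^sub>R e - t *\<^sub>R e' \<in> toda_dom"
    using toda_dom_left[OF assms(1)] by blast
  have "{-\<tau><..<0} \<subseteq> {t. x + t *\<^sub>R e \<in> toda_dom}"
  proof
    fix t assume "t \<in> {-\<tau><..<0}"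
    then show "t \<in> {t. x + t *\<^sub>R e \<in> toda_dom}" using \<tau>(2)[of e e "-t" 0] \<tau>(1) assms(2) by auto
  qed
  then have "0 islimpt {t. x + t *\<^sub>R e \<in> toda_dom}"
    by (rule islimpt_subset[rotated]) (use \<tau>(1) in \<open>simp add: islimpt_greaterThanLessThan2\<close>)
  then show ?thesis by (simp add: trivial_limit_within)
qed

lemma has_partial_unique:
  assumes "has_partial e u v" "has_partial e u v'" "e \<in> Dirs" "x \<in> toda_dom" shows "v x = v' x"
proof (rule tendsto_unique[OF at_within_Dom_nontrivial[OF assms(4,3)]])
  show "((\<lambda>t. (u (x + t *\<^sub>R e) - u (x + 0 *\<^sub>R e)) / (t - 0)) \<longlongrightarrow> v x) (at 0 within {t. x + t *\<^sub>R e \<in> toda_dom})"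
    using assms(1,4) unfolding has_partial_def has_field_derivative_iff by blast
  show "((\<lambda>t. (u (x + t *\<^sub>R e) - u (x + 0 *\<^sub>R e)) / (t - 0)) \<longlongrightarrow> v' x) (at 0 within {t. x + t *\<^sub>R e \<in> toda_dom})"
    using assms(2,4) unfolding has_partial_def has_field_derivative_iff by blast
qed

lemma has_partial_const: "has_partial e (\<lambda>_. c) (\<lambda>_. 0)"
  and has_partial_add: "has_partial e u u' \<Longrightarrow> has_partial e v v' \<Longrightarrow> has_partial e (\<lambda>x. u x + v x) (\<lambda>x. u' x + v' x)"
  and has_partial_mult: "has_partial e u u' \<Longrightarrow> has_partial e v v' \<Longrightarrow> has_partial e (\<lambda>x. u x * v x) (\<lambda>x. u' x * v x + u x * v' x)"
  unfolding has_partial_def by (auto intro!: derivative_eq_intros)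

text \<open>A witnessing family replaces derivatives chosen order by order; rings generated by a few
  functions serve as such families.\<close>

definition smooth :: "(real \<times> real \<times> real \<Rightarrow> real) \<Rightarrow> bool" where
  "smooth u \<longleftrightarrow> (\<exists>F. u \<in> F \<and> (\<forall>v\<in>F. continuous_on toda_dom v \<and> (\<forall>e\<in>Dirs. \<exists>v'\<in>F. has_partial e v v')))"

lemma smooth_continuous: "smooth u \<Longrightarrow> continuous_on toda_dom u"
  by (auto simp: smooth_def)

lemma smooth_pd: "smooth u \<Longrightarrow> e \<in> Dirs \<Longrightarrow> \<exists>u'. has_partial e u u' \<and> smooth u'"
  unfolding smooth_def by metis

inductive_set ringgen :: "(real \<times> real \<times> real \<Rightarrow> real) set \<Rightarrow> (real \<times> real \<times> real \<Rightarrow> real) set" for G where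
  gen: "g \<in> G \<Longrightarrow> g \<in> ringgen G"
| const: "(\<lambda>_. c) \<in> ringgen G"
| add: "u \<in> ringgen G \<Longrightarrow> v \<in> ringgen G \<Longrightarrow> (\<lambda>x. u x + v x) \<in> ringgen G"
| mult: "u \<in> ringgen G \<Longrightarrow> v \<in> ringgen G \<Longrightarrow> (\<lambda>x. u x * v x) \<in> ringgen G"

text \<open>By the sum and product rules the ring is closed under partial derivatives as soon as it
  contains those of its generators.\<close>

lemma ringgen_smooth:
  assumes G: "\<And>g. g \<in> G \<Longrightarrow> continuous_on toda_dom g" "\<And>g e. g \<in> G \<Longrightarrow> e \<in> Dirs \<Longrightarrow> \<exists>g'\<in>ringgen G. has_partial e g g'"
    and u: "u \<in> ringgen G"
  shows "smooth u"
proof -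
  have "continuous_on toda_dom v \<and> (\<forall>e\<in>Dirs. \<exists>v'\<in>ringgen G. has_partial e v v')" if "v \<in> ringgen G" for v
    using that
  proof induction
    case (gen g)
    then show ?case using G by blast
  next
    case (const c)
    then show ?case using has_partial_const ringgen.const by fastforce
  next
    case (add u v)
    have "\<exists>v'\<in>ringgen G. has_partial e (\<lambda>x. u x + v x) v'" if e: "e \<in> Dirs" for e
    proof -
      obtain u' v' where "u' \<in> ringgen G" "has_partial e u u'" "v' \<in> ringgen G" "has_partial e v v'" using add e by blast
      then show ?thesis by (intro bexI[of _ "\<lambda>x. u' x + v' x"] has_partial_add ringgen.add)
    qed
    then show ?case using add by (auto intro!: continuous_intros)
  next
    case (mult u v)
    have "\<exists>v'\<in>ringgen G. has_partial e (\<lambda>x. u x * v x) v'" if e: "e \<in> Dirs" for e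
    proof -
      obtain u' v' where "u' \<in> ringgen G" "has_partial e u u'" "v' \<in> ringgen G" "has_partial e v v'" using mult e by blast
      then show ?thesis using mult.hyps
        by (intro bexI[of _ "\<lambda>x. u' x * v x + u x * v' x"] has_partial_mult ringgen.add ringgen.mult)
    qed
    then show ?case using mult by (auto intro!: continuous_intros)
  qed
  then show ?thesis using u unfolding smooth_def by blast
qed

lemma smooth_ringgen:
  assumes "\<And>g. g \<in> G \<Longrightarrow> smooth g" "u \<in> ringgen G" shows "smooth u"
proof (rule ringgen_smooth[of "{u. smooth u}"])
  show "\<exists>g'\<in>ringgen {u. smooth u}. has_partial e g g'" if "g \<in> {u. smooth u}" "e \<in> Dirs" for g e
    using smooth_pd[of g e] that by (blast intro: ringgen.gen)
  show "u \<in> ringgen {u. smooth u}"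
    using assms(2) by induction (auto intro: ringgen.intros assms(1))
qed (auto intro: smooth_continuous)

lemma smooth_const: "smooth (\<lambda>_. c)"
  and smooth_add: "smooth u \<Longrightarrow> smooth v \<Longrightarrow> smooth (\<lambda>x. u x + v x)"
  and smooth_mult: "smooth u \<Longrightarrow> smooth v \<Longrightarrow> smooth (\<lambda>x. u x * v x)"
  by (rule smooth_ringgen[of "{u. smooth u}"]; blast intro: ringgen.intros)+

lemma smooth_cong:
  assumes "\<And>x. x \<in> toda_dom \<Longrightarrow> u x = v x" "smooth u" shows "smooth v"
proof -
  obtain F where F: "u \<in> F" "\<And>v. v \<in> F \<Longrightarrow> continuous_on toda_dom v" "\<And>v e. v \<in> F \<Longrightarrow> e \<in> Dirs \<Longrightarrow> \<exists>v'\<in>F. has_partial e v v'"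
    using assms(2) unfolding smooth_def by metis
  define F' where "F' = {v. \<exists>u\<in>F. \<forall>x\<in>toda_dom. u x = v x}"
  have "continuous_on toda_dom v \<and> (\<forall>e\<in>Dirs. \<exists>v'\<in>F'. has_partial e v v')" if v: "v \<in> F'" for v
  proof -
    obtain u where u: "u \<in> F" "\<forall>x\<in>toda_dom. u x = v x" using v by (auto simp: F'_def)
    have "continuous_on toda_dom v" using F(2)[OF u(1)] u(2) by (simp cong: continuous_on_cong)
    moreover have "\<exists>v'\<in>F'. has_partial e v v'" if e: "e \<in> Dirs" for e
    proof -
      obtain u' where u': "u' \<in> F" "has_partial e u u'" using F(3)[OF u(1) e] by blast
      then have "has_partial e v u'" using u(2) by (intro has_partial_cong[of u v u' u']) auto
      then show ?thesis using u'(1) by (auto simp: F'_def)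
    qed
    ultimately show ?thesis by blast
  qed
  moreover have "v \<in> F'" using F(1) assms(1) unfolding F'_def by blast
  ultimately show ?thesis unfolding smooth_def by blast
qed

lemma has_partial_interior:
  assumes u: "has_partial e u u'" and e: "e \<in> Dirs" and t: "a < t" "t < b" and seg: "\<And>t. a \<le> t \<Longrightarrow> t \<le> b \<Longrightarrow> y + t *\<^sub>R e \<in> toda_dom"
  shows "((\<lambda>t. u (y + t *\<^sub>R e)) has_real_derivative u' (y + t *\<^sub>R e)) (at t)"
proof -
  let ?S = "{\<tau>. (y + t *\<^sub>R e) + \<tau> *\<^sub>R e \<in> toda_dom}"
  have "y + t *\<^sub>R e \<in> toda_dom" using seg t by simp
  then have 1: "((\<lambda>\<tau>. u ((y + t *\<^sub>R e) + \<tau> *\<^sub>R e)) has_real_derivative u' (y + t *\<^sub>R e)) (at 0 within ?S)"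
    using u by (simp add: has_partial_def)
  have "{a - t<..<b - t} \<subseteq> ?S"
  proof
    fix \<tau> assume "\<tau> \<in> {a - t<..<b - t}"
    then have "y + (t + \<tau>) *\<^sub>R e \<in> toda_dom" by (intro seg) auto
    then show "\<tau> \<in> ?S" by (simp add: scaleR_add_left add.assoc)
  qed
  then have "((\<lambda>\<tau>. u ((y + t *\<^sub>R e) + \<tau> *\<^sub>R e)) has_real_derivative u' (y + t *\<^sub>R e)) (at 0 within {a - t<..<b - t})"
    by (rule has_field_derivative_subset[OF 1])
  then have "((\<lambda>\<tau>. u ((y + t *\<^sub>R e) + \<tau> *\<^sub>R e)) has_real_derivative u' (y + t *\<^sub>R e)) (at 0)"
    using t by (subst (asm) at_within_open) auto
  then have "((\<lambda>\<tau>. u (y + (\<tau> + t) *\<^sub>R e)) has_real_derivative u' (y + t *\<^sub>R e)) (at 0)"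
    by (simp add: scaleR_add_left add.assoc add.left_commute add.commute)
  then show ?thesis using DERIV_shift[of "\<lambda>t. u (y + t *\<^sub>R e)" "u' (y + t *\<^sub>R e)" 0 t] by simp
qed

lemma has_partial_mvt:
  assumes u: "has_partial e u u'" "continuous_on toda_dom u" and e: "e \<in> Dirs" and h: "h > 0"
    and seg: "\<And>t. 0 \<le> t \<Longrightarrow> t \<le> h \<Longrightarrow> y - t *\<^sub>R e \<in> toda_dom"
  obtains \<xi> where "0 < \<xi>" "\<xi> < h" "u y - u (y - h *\<^sub>R e) = h * u' (y - \<xi> *\<^sub>R e)"
proof -
  have seg': "y + t *\<^sub>R e \<in> toda_dom" if "-h \<le> t" "t \<le> 0" for t using seg[of "-t"] that by simp
  define \<phi> where "\<phi> t = u (y + t *\<^sub>R e)" for t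
  have "continuous_on {-h..0} \<phi>"
    unfolding \<phi>_def by (rule continuous_on_compose2[OF u(2)]) (auto intro!: continuous_intros seg')
  moreover have d: "(\<phi> has_real_derivative u' (y + t *\<^sub>R e)) (at t)" if "-h < t" "t < 0" for t
    unfolding \<phi>_def by (rule has_partial_interior[OF u(1) e that seg'])
  ultimately obtain \<xi> l where \<xi>: "-h < \<xi>" "\<xi> < 0" "(\<phi> has_real_derivative l) (at \<xi>)" "\<phi> 0 - \<phi> (-h) = (0 - (-h)) * l"
    using MVT[of "-h" 0 \<phi>] h real_differentiable_def by (metis neg_less_0_iff_less)
  have "l = u' (y + \<xi> *\<^sub>R e)" using DERIV_unique[OF \<xi>(3) d[OF \<xi>(1,2)]] .
  then show ?thesis using that[of "-\<xi>"] \<xi> by (simp add: \<phi>_def)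
qed

lemma has_partial_commute_aux:
  assumes u: "has_partial e u ue" "has_partial e' ue uee'" "continuous_on toda_dom u" "continuous_on toda_dom ue"
    and e: "e \<in> Dirs" "e' \<in> Dirs" and h: "h > 0"
    and seg: "\<And>s t. 0 \<le> s \<Longrightarrow> s \<le> h \<Longrightarrow> 0 \<le> t \<Longrightarrow> t \<le> h \<Longrightarrow> x - s *\<^sub>R e - t *\<^sub>R e' \<in> toda_dom"
  obtains s t where "0 < s" "s < h" "0 < t" "t < h"
    "u x - u (x - h *\<^sub>R e) - u (x - h *\<^sub>R e') + u (x - h *\<^sub>R e - h *\<^sub>R e') = h * h * uee' (x - s *\<^sub>R e - t *\<^sub>R e')"
proof -
  define \<phi> where "\<phi> t = u (x + t *\<^sub>R e) - u ((x - h *\<^sub>R e') + t *\<^sub>R e)" for t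
  define \<phi>' where "\<phi>' t = ue (x + t *\<^sub>R e) - ue ((x - h *\<^sub>R e') + t *\<^sub>R e)" for t
  have D0: "x + t *\<^sub>R e \<in> toda_dom" and D1: "(x - h *\<^sub>R e') + t *\<^sub>R e \<in> toda_dom" if "-h \<le> t" "t \<le> 0" for t
    using seg[of "-t" 0] seg[of "-t" h] that h by (auto simp: algebra_simps)
  have "continuous_on {-h..0} \<phi>"
    unfolding \<phi>_def
    by (intro continuous_intros continuous_on_compose2[OF u(3)]) (auto intro!: continuous_intros D0 D1)
  moreover have d: "(\<phi> has_real_derivative \<phi>' t) (at t)" if "-h < t" "t < 0" for t
    unfolding \<phi>_def \<phi>'_def
    by (intro derivative_intros has_partial_interior[OF u(1) e(1) that]) (auto intro: D0 D1)
  ultimately obtain \<xi> l where \<xi>': "-h < \<xi>" "\<xi> < 0" "(\<phi> has_real_derivative l) (at \<xi>)" "\<phi> 0 - \<phi> (-h) = (0 - (-h)) * l"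
    using MVT[of "-h" 0 \<phi>] h real_differentiable_def by (metis neg_less_0_iff_less)
  have \<xi>: "-h < \<xi>" "\<xi> < 0" "\<phi> 0 - \<phi> (-h) = (0 - (-h)) * \<phi>' \<xi>"
    using \<xi>' DERIV_unique[OF \<xi>'(3) d[OF \<xi>'(1,2)]] by auto
  obtain t where t: "0 < t" "t < h" "ue (x + \<xi> *\<^sub>R e) - ue ((x + \<xi> *\<^sub>R e) - h *\<^sub>R e') = h * uee' ((x + \<xi> *\<^sub>R e) - t *\<^sub>R e')"
    using has_partial_mvt[OF u(2,4) e(2) h, of "x + \<xi> *\<^sub>R e"] seg[of "-\<xi>"] \<xi> by auto
  show ?thesis
  proof (rule that[of "-\<xi>" t])
    have "u x - u (x - h *\<^sub>R e) - u (x - h *\<^sub>R e') + u (x - h *\<^sub>R e - h *\<^sub>R e') = \<phi> 0 - \<phi> (-h)"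
      by (simp add: \<phi>_def algebra_simps)
    also have "\<dots> = h * (h * uee' ((x + \<xi> *\<^sub>R e) - t *\<^sub>R e'))"
      using \<xi>(3) t(3) by (simp add: \<phi>'_def algebra_simps)
    finally show "u x - u (x - h *\<^sub>R e) - u (x - h *\<^sub>R e') + u (x - h *\<^sub>R e - h *\<^sub>R e') = h * h * uee' (x - (- \<xi>) *\<^sub>R e - t *\<^sub>R e')"
      by simp
  qed (use \<xi> t in auto)
qed

text \<open>The mixed second difference over a backward square of side \<open>h\<close> equals, by
  two mean value theorems, \<open>h^2\<close> times either mixed derivative at some point of the
  square; let \<open>h\<close> tend to 0. Backward squares make this work on the boundary
  too.\<close>

lemma has_partial_commute:
  assumes u: "has_partial e u ue" "has_partial e' ue uee'" "has_partial e' u ue'" "has_partial e ue' ue'e"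
    and c: "continuous_on toda_dom u" "continuous_on toda_dom ue" "continuous_on toda_dom ue'" "continuous_on toda_dom uee'" "continuous_on toda_dom ue'e"
    and e: "e \<in> Dirs" "e' \<in> Dirs" and x: "x \<in> toda_dom"
  shows "uee' x = ue'e x"
proof -
  obtain \<tau> where \<tau>: "\<tau> > 0" "\<And>s t e e'. e \<in> Dirs \<Longrightarrow> e' \<in> Dirs \<Longrightarrow> 0 \<le> s \<Longrightarrow> s \<le> \<tau> \<Longrightarrow> 0 \<le> t \<Longrightarrow> t \<le> \<tau> \<Longrightarrow> x - s *\<^sub>R e - t *\<^sub>R e' \<in> toda_dom"
    using toda_dom_left[OF x] by blast
  have ne: "norm f = 1" if "f \<in> Dirs" for f
    using that by (rule Dirs_cases) (auto simp: norm_prod_def)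
  have "\<bar>uee' x - ue'e x\<bar> \<le> \<epsilon>" if \<epsilon>: "\<epsilon> > 0" for \<epsilon>
  proof -
    obtain \<delta>1 where \<delta>1: "\<delta>1 > 0" "\<And>y. y \<in> toda_dom \<Longrightarrow> dist y x < \<delta>1 \<Longrightarrow> dist (uee' y) (uee' x) < \<epsilon> / 2"
      using c(4) x \<epsilon> unfolding continuous_on_iff by (metis half_gt_zero)
    obtain \<delta>2 where \<delta>2: "\<delta>2 > 0" "\<And>y. y \<in> toda_dom \<Longrightarrow> dist y x < \<delta>2 \<Longrightarrow> dist (ue'e y) (ue'e x) < \<epsilon> / 2"
      using c(5) x \<epsilon> unfolding continuous_on_iff by (metis half_gt_zero)
    define h where "h = min \<tau> (min \<delta>1 \<delta>2 / 2)"
    have h: "h > 0" "h \<le> \<tau>" "2 * h \<le> \<delta>1" "2 * h \<le> \<delta>2" using \<tau> \<delta>1 \<delta>2 by (auto simp: h_def)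
    have near: "dist (x - s *\<^sub>R f - t *\<^sub>R f') x < 2 * h" if "0 < s" "s < h" "0 < t" "t < h" "f \<in> Dirs" "f' \<in> Dirs" for s t f f'
    proof -
      have "dist (x - s *\<^sub>R f - t *\<^sub>R f') x = norm (s *\<^sub>R f + t *\<^sub>R f')"
      proof -
        have "(x - s *\<^sub>R f - t *\<^sub>R f') - x = - (s *\<^sub>R f + t *\<^sub>R f')" by simp
        then show ?thesis unfolding dist_norm by (metis norm_minus_cancel)
      qed
      also have "\<dots> \<le> norm (s *\<^sub>R f) + norm (t *\<^sub>R f')" by (rule norm_triangle_ineq)
      also have "\<dots> < 2 * h" using that ne by simp
      finally show ?thesis .
    qed
    have seg1: "x - s *\<^sub>R e - t *\<^sub>R e' \<in> toda_dom" if "0 \<le> s" "s \<le> h" "0 \<le> t" "t \<le> h" for s t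
      by (rule \<tau>(2)[OF e]) (use that h in linarith)+
    have seg2: "x - s *\<^sub>R e' - t *\<^sub>R e \<in> toda_dom" if "0 \<le> s" "s \<le> h" "0 \<le> t" "t \<le> h" for s t
      by (rule \<tau>(2)[OF e(2,1)]) (use that h in linarith)+
    obtain s t where st: "0 < s" "s < h" "0 < t" "t < h"
      "u x - u (x - h *\<^sub>R e) - u (x - h *\<^sub>R e') + u (x - h *\<^sub>R e - h *\<^sub>R e') = h * h * uee' (x - s *\<^sub>R e - t *\<^sub>R e')"
      using has_partial_commute_aux[OF u(1,2) c(1,2) e h(1) seg1] by blast
    obtain s' t' where st': "0 < s'" "s' < h" "0 < t'" "t' < h"
      "u x - u (x - h *\<^sub>R e') - u (x - h *\<^sub>R e) + u (x - h *\<^sub>R e' - h *\<^sub>R e) = h * h * ue'e (x - s' *\<^sub>R e' - t' *\<^sub>R e)"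
      using has_partial_commute_aux[OF u(3,4) c(1,3) e(2,1) h(1) seg2] by blast
    have "h * h * uee' (x - s *\<^sub>R e - t *\<^sub>R e') = h * h * ue'e (x - s' *\<^sub>R e' - t' *\<^sub>R e)"
      unfolding st(5)[symmetric] st'(5)[symmetric] by (simp add: algebra_simps)
    then have eq: "uee' (x - s *\<^sub>R e - t *\<^sub>R e') = ue'e (x - s' *\<^sub>R e' - t' *\<^sub>R e)" using h by simp
    have "dist (uee' (x - s *\<^sub>R e - t *\<^sub>R e')) (uee' x) < \<epsilon> / 2"
      by (rule \<delta>1(2)[OF seg1]) (use near[OF st(1-4) e] h st in linarith)+
    moreover have "dist (ue'e (x - s' *\<^sub>R e' - t' *\<^sub>R e)) (ue'e x) < \<epsilon> / 2"
      by (rule \<delta>2(2)[OF seg2]) (use near[OF st'(1-4) e(2,1)] h st' in linarith)+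
    ultimately show ?thesis unfolding eq dist_real_def by linarith
  qed
  then have "\<bar>uee' x - ue'e x\<bar> \<le> 0" by (rule field_le_epsilon) simp
  then show ?thesis by simp
qed

section \<open>The ring of smooth functions with its commuting derivations\<close>

typedef sfun = "{u. smooth u \<and> (\<forall>x. x \<notin> toda_dom \<longrightarrow> u x = 0)}"
  morphisms ev Abs_sfun
  by (rule exI[of _ "\<lambda>_. 0"]) (auto intro: smooth_const)

setup_lifting type_definition_sfun

text \<open>The unit and the other constants are indicator multiples of the domain, so that equality of
  elements is equality on the domain.\<close>

lift_definition cst :: "real \<Rightarrow> sfun" is "\<lambda>c x. if x \<in> toda_dom then c else 0"
  by (auto intro: smooth_cong[OF _ smooth_const])

instantiation sfun :: comm_ring_1
begin
lift_definition zero_sfun :: sfun is "\<lambda>_. 0" by (auto intro: smooth_const)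
definition one_sfun :: sfun where "one_sfun = cst 1"
lift_definition plus_sfun :: "sfun \<Rightarrow> sfun \<Rightarrow> sfun" is "\<lambda>u v x. u x + v x" by (auto intro: smooth_add)
lift_definition times_sfun :: "sfun \<Rightarrow> sfun \<Rightarrow> sfun" is "\<lambda>u v x. u x * v x" by (auto intro: smooth_mult)
lift_definition uminus_sfun :: "sfun \<Rightarrow> sfun" is "\<lambda>u x. - u x"
  using smooth_mult[OF smooth_const[of "-1"]] by auto
definition minus_sfun :: "sfun \<Rightarrow> sfun \<Rightarrow> sfun" where "minus_sfun u v = u + - v"
instance
proof
  fix a b c :: sfun
  show "(0::sfun) \<noteq> 1"
  proof
    assume "(0::sfun) = 1"
    then have "ev 0 (1, 0, 0) = ev (cst 1) (1, 0, 0)" by (simp add: one_sfun_def)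
    then show False by (simp add: zero_sfun.rep_eq cst.rep_eq toda_dom_def)
  qed
  show "1 * a = a" unfolding one_sfun_def by transfer (auto simp: fun_eq_iff)
  show "a - b = a + - b" by (rule minus_sfun_def)
qed (transfer, simp add: fun_eq_iff algebra_simps)+
end

lemma ev_0[simp]: "ev 0 x = 0" and ev_add[simp]: "ev (u + v) x = ev u x + ev v x"
  and ev_mult[simp]: "ev (u * v) x = ev u x * ev v x" and ev_minus[simp]: "ev (- u) x = - ev u x"
  by (simp_all add: zero_sfun.rep_eq plus_sfun.rep_eq times_sfun.rep_eq uminus_sfun.rep_eq)

lemma ev_diff[simp]: "ev (u - v) x = ev u x - ev v x"
  by (simp only: minus_sfun_def ev_add ev_minus)

lemma ev_cst[simp]: "x \<in> toda_dom \<Longrightarrow> ev (cst c) x = c" by (simp add: cst.rep_eq)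
lemma ev_1[simp]: "x \<in> toda_dom \<Longrightarrow> ev 1 x = 1" by (simp add: one_sfun_def)

lemma ev_out: "x \<notin> toda_dom \<Longrightarrow> ev u x = 0" using ev[of u] by blast
lemma ev_smooth: "smooth (ev u)" using ev[of u] by auto

lemma sfun_eqI: "(\<And>x. x \<in> toda_dom \<Longrightarrow> ev u x = ev v x) \<Longrightarrow> u = v"
proof -
  assume eq: "\<And>x. x \<in> toda_dom \<Longrightarrow> ev u x = ev v x"
  have "ev u x = ev v x" for x using eq[of x] ev_out[of x u] ev_out[of x v] by (cases "x \<in> toda_dom") simp_all
  then have "ev u = ev v" by (rule ext)
  then show "u = v" by (simp only: ev_inject)
qed

lemma ev_power[simp]: "x \<in> toda_dom \<Longrightarrow> ev (u ^ n) x = ev u x ^ n"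
  by (induction n) auto

lemma ev_sum: "ev (\<Sum>i\<in>A. f i) x = (\<Sum>i\<in>A. ev (f i) x)"
  by (induction A rule: infinite_finite_induct) auto

lemma ev_of_nat[simp]: "x \<in> toda_dom \<Longrightarrow> ev (of_nat n) x = of_nat n"
  by (induction n) auto

lemma cst_0: "cst 0 = 0" and cst_1: "cst 1 = 1" and cst_add: "cst (a + b) = cst a + cst b"
  and cst_mult: "cst (a * b) = cst a * cst b" and cst_of_nat: "cst (of_nat n) = of_nat n"
  by (rule sfun_eqI; simp)+

lemma cst_power: "cst (a ^ n) = cst a ^ n" by (rule sfun_eqI) simp

definition mk_sfun :: "(real \<times> real \<times> real \<Rightarrow> real) \<Rightarrow> sfun" where
  "mk_sfun u = Abs_sfun (\<lambda>x. if x \<in> toda_dom then u x else 0)"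

lemma ev_mk_sfun: assumes "smooth u" "x \<in> toda_dom" shows "ev (mk_sfun u) x = u x"
proof -
  have "smooth (\<lambda>x. if x \<in> toda_dom then u x else 0)" by (rule smooth_cong[OF _ assms(1)]) simp
  then show ?thesis using assms(2) by (simp add: mk_sfun_def Abs_sfun_inverse)
qed

text \<open>The choice is harmless, since values on the domain are unique by
  \<open>has_partial_unique\<close>.\<close>

definition partial :: "real \<times> real \<times> real \<Rightarrow> sfun \<Rightarrow> sfun" where
  "partial e u = mk_sfun (SOME u'. has_partial e (ev u) u' \<and> smooth u')"

lemma has_partial_partial: assumes "e \<in> Dirs" shows "has_partial e (ev u) (ev (partial e u))"
proof -
  define u' where "u' = (SOME u'. has_partial e (ev u) u' \<and> smooth u')"
  have u': "has_partial e (ev u) u'" "smooth u'"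
    unfolding u'_def using someI_ex[OF smooth_pd[OF ev_smooth assms]] by blast+
  show ?thesis
    by (rule has_partial_cong[OF _ _ u'(1)]) (simp_all add: partial_def u'_def[symmetric] ev_mk_sfun[OF u'(2)])
qed

lemma partial_eqI: assumes "e \<in> Dirs" "has_partial e (ev u) (ev v)" shows "partial e u = v"
  by (rule sfun_eqI, rule has_partial_unique[OF has_partial_partial[OF assms(1)] assms(2,1)])

lemma partial_add: assumes "e \<in> Dirs" shows "partial e (u + v) = partial e u + partial e v"
  using has_partial_add[OF has_partial_partial has_partial_partial, OF assms assms, of u v] by (intro partial_eqI assms) (simp flip: ev_add)

lemma partial_mult: assumes "e \<in> Dirs" shows "partial e (u * v) = partial e u * v + u * partial e v"
  using has_partial_mult[OF has_partial_partial has_partial_partial, OF assms assms, of u v] by (intro partial_eqI assms) (simp flip: ev_add ev_mult)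

lemma partial_cst[simp]: assumes "e \<in> Dirs" shows "partial e (cst c) = 0"
  by (rule partial_eqI[OF assms], rule has_partial_cong[OF _ _ has_partial_const[of e c]]) simp_all

lemma partial_0[simp]: "e \<in> Dirs \<Longrightarrow> partial e 0 = 0" and partial_1[simp]: "e \<in> Dirs \<Longrightarrow> partial e 1 = 0"
  using partial_cst[of e 0] partial_cst[of e 1] by (simp_all add: cst_0 cst_1)

lemma partial_uminus: "e \<in> Dirs \<Longrightarrow> partial e (- u) = - partial e u"
  using partial_add[of e u "- u"] by (simp add: eq_neg_iff_add_eq_0 add.commute)

lemma partial_cst_mult: "e \<in> Dirs \<Longrightarrow> partial e (cst c * u) = cst c * partial e u"
  by (simp add: partial_mult)

lemma partial_sum: "e \<in> Dirs \<Longrightarrow> partial e (\<Sum>i\<in>A. f i) = (\<Sum>i\<in>A. partial e (f i))"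
  by (induction A rule: infinite_finite_induct) (auto simp: partial_add)

lemma partial_commute: assumes "e \<in> Dirs" "e' \<in> Dirs" shows "partial e' (partial e u) = partial e (partial e' u)"
  by (rule sfun_eqI, rule has_partial_commute[where e = e and e' = e' and u = "ev u"])
     (use assms in \<open>auto intro: has_partial_partial smooth_continuous ev_smooth\<close>)

lemma has_derivative_ev_W:
  assumes "w > 0" "s \<le> 0" "t \<le> 0"
  shows "((\<lambda>w. ev u (w, s, t)) has_real_derivative ev (partial eW u) (w, s, t)) (at w)"
proof -
  have "((\<lambda>a. ev u ((0, s, t) + a *\<^sub>R eW)) has_real_derivative ev (partial eW u) ((0, s, t) + w *\<^sub>R eW)) (at w)"
    by (rule has_partial_interior[OF has_partial_partial, of eW "w / 2" w "w + 1"]) (use assms in \<open>simp_all, simp_all add: toda_dom_def eW_def\<close>)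
  then show ?thesis by (simp add: eW_def)
qed

lemma has_derivative_ev_S:
  assumes "w > 0" "s \<le> 0" "t \<le> 0"
  shows "((\<lambda>s. ev u (w, s, t)) has_real_derivative ev (partial (eS True) u) (w, s, t)) (at s within {..0})"
    "((\<lambda>t. ev u (w, s, t)) has_real_derivative ev (partial (eS False) u) (w, s, t)) (at t within {..0})"
proof -
  have im: "(+) a ` {..- a} = {..0}" for a :: real
    using image_add_atMost[of a "- a"] by simp
  have x: "(w, s, t) \<in> toda_dom" using assms by (simp add: toda_dom_def)
  have "((\<lambda>a. ev u ((w, s, t) + a *\<^sub>R eS True)) has_real_derivative ev (partial (eS True) u) (w, s, t)) (at 0 within {..- s})"
  proof -
    have "{a. (w, s, t) + a *\<^sub>R eS True \<in> toda_dom} = {..- s}"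
      using assms by (auto simp: toda_dom_def eS_def)
    then show ?thesis using has_partial_partial[OF eS_Dirs, of True u] x unfolding has_partial_def by metis
  qed
  then have "((\<lambda>a. ev u (w, s + a, t)) has_real_derivative ev (partial (eS True) u) (w, s, t)) (at 0 within {..- s})"
    by (simp add: eS_def)
  then show "((\<lambda>s. ev u (w, s, t)) has_real_derivative ev (partial (eS True) u) (w, s, t)) (at s within {..0})"
    using DERIV_at_within_shift[of "\<lambda>s. ev u (w, s, t)" _ s 0 "{..- s}"] by (simp only: im add_0_right)
  have "((\<lambda>a. ev u ((w, s, t) + a *\<^sub>R eS False)) has_real_derivative ev (partial (eS False) u) (w, s, t)) (at 0 within {..- t})"
  proof -
    have "{a. (w, s, t) + a *\<^sub>R eS False \<in> toda_dom} = {..- t}"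
      using assms by (auto simp: toda_dom_def eS_def)
    then show ?thesis using has_partial_partial[OF eS_Dirs, of False u] x unfolding has_partial_def by metis
  qed
  then have "((\<lambda>a. ev u (w, s, t + a)) has_real_derivative ev (partial (eS False) u) (w, s, t)) (at 0 within {..- t})"
    by (simp add: eS_def)
  then show "((\<lambda>t. ev u (w, s, t)) has_real_derivative ev (partial (eS False) u) (w, s, t)) (at t within {..0})"
    using DERIV_at_within_shift[of "\<lambda>t. ev u (w, s, t)" _ t 0 "{..- t}"] by (simp only: im add_0_right)
qed

lemma continuous_on_ev: "continuous_on toda_dom (ev u)"
  by (rule smooth_continuous[OF ev_smooth])

subsection \<open>Formal Taylor shifts\<close>

unbundle no vec_syntax
unbundle fps_syntax

lemma fps_decomp:
  fixes F :: "'a::comm_ring_1 fps"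
  shows "F = fps_const (F $ 0) + fps_X * fps_shift 1 F"
proof (rule fps_ext)
  fix n show "F $ n = (fps_const (F $ 0) + fps_X * fps_shift 1 F) $ n" by (cases n) simp_all
qed

text \<open>Splitting off constant terms, \<open>F = a + X F'\<close>, reduces coefficient
  \<open>n\<close> of the claim to coefficient \<open>n - 1\<close> for other series. Used for the
  Taylor shifts and for the substitution \<open>h = \<epsilon>^2\<close>.\<close>

lemma fps_multiplicative:
  fixes \<Theta> :: "'a::comm_ring_1 fps \<Rightarrow> 'b::comm_ring_1 fps"
  assumes add: "\<And>F G. \<Theta> (F + G) = \<Theta> F + \<Theta> G" and X: "\<And>F. \<Theta> (fps_X * F) = fps_X * \<Theta> F"
    and const: "\<And>a b. \<Theta> (fps_const (a * b)) = \<Theta> (fps_const a) * \<Theta> (fps_const b)"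
  shows "\<Theta> (F * G) = \<Theta> F * \<Theta> G"
proof (rule fps_ext)
  fix n
  show "\<Theta> (F * G) $ n = (\<Theta> F * \<Theta> G) $ n"
  proof (induction n arbitrary: F G rule: less_induct)
    case (less n)
    define F' where "F' = fps_shift 1 F"
    define G' where "G' = fps_shift 1 G"
    let ?a = "F $ 0" and ?b = "G $ 0"
    have F: "F = fps_const ?a + fps_X * F'" and G: "G = fps_const ?b + fps_X * G'"
      unfolding F'_def G'_def by (rule fps_decomp)+
    have TF: "\<Theta> F = \<Theta> (fps_const ?a) + fps_X * \<Theta> F'" and TG: "\<Theta> G = \<Theta> (fps_const ?b) + fps_X * \<Theta> G'"
      by (subst F, simp only: add X) (subst G, simp only: add X)
    have "F * G = (fps_const ?a + fps_X * F') * G" by (subst (1) F) (rule refl)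
    also have "\<dots> = fps_const ?a * G + fps_X * (F' * G)" by (simp only: ring_distribs mult.assoc)
    also have "fps_const ?a * G = fps_const ?a * (fps_const ?b + fps_X * G')" by (subst (1) G) (rule refl)
    also have "\<dots> = fps_const (?a * ?b) + fps_X * (fps_const ?a * G')"
      by (simp only: ring_distribs fps_const_mult mult.left_commute)
    finally have L: "\<Theta> (F * G) = \<Theta> (fps_const (?a * ?b)) + fps_X * \<Theta> (fps_const ?a * G') + fps_X * \<Theta> (F' * G)"
      by (simp only: add X)
    have R: "\<Theta> F * \<Theta> G = \<Theta> (fps_const (?a * ?b)) + fps_X * (\<Theta> (fps_const ?a) * \<Theta> G') + fps_X * (\<Theta> F' * \<Theta> G)"
    proof -
      have "\<Theta> F * \<Theta> G = \<Theta> (fps_const ?a) * \<Theta> G + fps_X * (\<Theta> F' * \<Theta> G)"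
        by (subst TF) (simp only: ring_distribs mult.assoc)
      also have "\<Theta> (fps_const ?a) * \<Theta> G = \<Theta> (fps_const (?a * ?b)) + fps_X * (\<Theta> (fps_const ?a) * \<Theta> G')"
        by (subst TG) (simp only: ring_distribs const mult.left_commute)
      finally show ?thesis .
    qed
    show ?case
    proof (cases n)
      case (Suc m)
      then have "(fps_X * \<Theta> (H * H')) $ n = (fps_X * (\<Theta> H * \<Theta> H')) $ n" for H H'
        using less.IH[of m H H'] by simp
      then show ?thesis unfolding L R by (simp only: fps_add_nth)
    next
      case 0
      then show ?thesis unfolding L R by simp
    qed
  qed
qed

abbreviation dW :: "sfun \<Rightarrow> sfun" where "dW \<equiv> partial eW"
abbreviation dS :: "bool \<Rightarrow> sfun \<Rightarrow> sfun" where "dS i \<equiv> partial (eS i)"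

lemma dW_pow_add: "(dW ^^ j) (u + v) = (dW ^^ j) u + (dW ^^ j) v"
  by (induction j) (simp_all add: partial_add)
lemma dW_pow_0[simp]: "(dW ^^ j) 0 = 0"
  by (induction j) simp_all
lemma dW_pow_cst_mult: "(dW ^^ j) (cst c * u) = cst c * (dW ^^ j) u"
  by (induction j) (simp_all add: partial_cst_mult)
text \<open>The expansion of \<open>u (w + c \<epsilon>)\<close>, the series variable being
  \<epsilon>.\<close>

definition taylor :: "int \<Rightarrow> sfun \<Rightarrow> sfun fps" where
  "taylor c u = Abs_fps (\<lambda>j. cst (of_int c ^ j / fact j) * (dW ^^ j) u)"

text \<open>Extends \<open>taylor\<close> to coefficients that already form a series:
  \<open>F(w, \<epsilon>)\<close> becomes \<open>F(w + c \<epsilon>, \<epsilon>)\<close>, expanded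
  again in \<epsilon>.\<close>

definition tshift :: "int \<Rightarrow> sfun fps \<Rightarrow> sfun fps" where
  "tshift c F = Abs_fps (\<lambda>m. \<Sum>j\<le>m. cst (of_int c ^ j / fact j) * (dW ^^ j) (F $ (m - j)))"

lemma cst_sum: "cst (\<Sum>i\<in>A. f i) = (\<Sum>i\<in>A. cst (f i))"
  by (induction A rule: infinite_finite_induct) (simp_all add: cst_0 cst_add)

lemma Suc_mult_divide_fact: "real (Suc n) * (x ^ Suc n / fact (Suc n)) = x * (x ^ n / fact n)"
  unfolding fact_Suc by (simp del: of_nat_Suc)

text \<open>Differentiation in \<epsilon> gives \<open>c\<close> times the expansion of
  \<open>dW u\<close>, so both sides satisfy the same recursion; the factor \<open>n + 1\<close> can
  be divided out because the ring contains the real constants.\<close>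

lemma taylor_mult: "taylor c (u * v) = taylor c u * taylor c v"
proof (rule fps_ext)
  fix n
  show "taylor c (u * v) $ n = (taylor c u * taylor c v) $ n"
  proof (induction n arbitrary: u v)
    case (Suc n)
    have X: "of_nat (Suc n) * (taylor c u * taylor c v) $ Suc n = fps_deriv (taylor c u * taylor c v) $ n"
      by (simp only: fps_deriv_nth Suc_eq_plus1)
    have Y: "fps_deriv (taylor c u) = fps_const (cst (of_int c)) * taylor c (dW u)" for u
    proof (rule fps_ext)
      fix k
      have "of_nat (Suc k) * taylor c u $ Suc k = cst (real (Suc k) * (of_int c ^ Suc k / fact (Suc k))) * (dW ^^ Suc k) u"
        unfolding cst_of_nat[symmetric] taylor_def fps_nth_Abs_fps by (simp only: cst_mult mult.assoc)
      also have "real (Suc k) * (of_int c ^ Suc k / fact (Suc k)) = of_int c * (of_int c ^ k / fact k)"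
        by (rule Suc_mult_divide_fact)
      also have "(dW ^^ Suc k) u = (dW ^^ k) (dW u)" by (simp only: funpow_Suc_right o_apply)
      finally show "fps_deriv (taylor c u) $ k = (fps_const (cst (of_int c)) * taylor c (dW u)) $ k"
        unfolding fps_deriv_nth fps_mult_left_const_nth by (simp only: taylor_def fps_nth_Abs_fps cst_mult mult.assoc Suc_eq_plus1)
    qed
    have S: "of_nat (Suc n) * taylor c u $ Suc n = cst (of_int c) * taylor c (dW u) $ n" for u
      using arg_cong[OF Y[of u], of "\<lambda>F. F $ n"] unfolding fps_deriv_nth fps_mult_left_const_nth by simp
    have "of_nat (Suc n) * taylor c (u * v) $ Suc n = cst (of_int c) * (taylor c (dW u * v) $ n + taylor c (u * dW v) $ n)"
      unfolding S partial_mult[OF eW_Dirs] by (simp add: taylor_def dW_pow_add algebra_simps)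
    also have "\<dots> = of_nat (Suc n) * (taylor c u * taylor c v) $ Suc n"
    proof -
      have "fps_deriv (taylor c u * taylor c v) = fps_const (cst (of_int c)) * (taylor c (dW u) * taylor c v + taylor c u * taylor c (dW v))"
        unfolding fps_deriv_mult Y by (simp only: ring_distribs mult.assoc mult.left_commute) (simp only: add.commute)
      then show ?thesis unfolding X Suc.IH by (simp only: fps_mult_left_const_nth fps_add_nth)
    qed
    finally have "cst (1 / real (Suc n)) * (of_nat (Suc n) * taylor c (u * v) $ Suc n)
        = cst (1 / real (Suc n)) * (of_nat (Suc n) * (taylor c u * taylor c v) $ Suc n)" by (rule arg_cong)
    moreover have "cst (1 / real (Suc n)) * of_nat (Suc n) = 1"
      by (simp only: cst_of_nat[symmetric] cst_mult[symmetric]) (simp add: cst_1)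
    ultimately show ?case by (simp only: mult.assoc[symmetric] mult_1_left)
  qed (simp add: taylor_def cst_1)
qed

lemma tshift_add: "tshift c (F + G) = tshift c F + tshift c G"
  by (rule fps_ext) (simp add: tshift_def dW_pow_add sum.distrib algebra_simps)

lemma tshift_const: "tshift c (fps_const u) = taylor c u"
proof (rule fps_ext)
  fix n
  have "tshift c (fps_const u) $ n = (\<Sum>j\<le>n. if j = n then cst (of_int c ^ n / fact n) * (dW ^^ n) u else 0)"
    unfolding tshift_def fps_nth_Abs_fps by (intro sum.cong) auto
  then show "tshift c (fps_const u) $ n = taylor c u $ n" by (simp add: taylor_def)
qed

lemma tshift_X_mult: "tshift c (fps_X * F) = fps_X * tshift c F"
proof (rule fps_ext)
  fix n
  show "tshift c (fps_X * F) $ n = (fps_X * tshift c F) $ n"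
  proof (cases n)
    case (Suc m)
    have "tshift c (fps_X * F) $ n = (\<Sum>j\<le>m. cst (of_int c ^ j / fact j) * (dW ^^ j) (F $ (m - j)))"
      unfolding tshift_def fps_nth_Abs_fps Suc
      by (simp add: Suc_diff_le)
    then show ?thesis using Suc by (simp add: tshift_def)
  qed (simp add: tshift_def)
qed

lemma tshift_X_pow_mult: "tshift c (fps_X ^ k * F) = fps_X ^ k * tshift c F"
  by (induction k) (simp_all add: tshift_X_mult mult.assoc)

lemma tshift_decomp: "tshift c F = taylor c (F $ 0) + fps_X * tshift c (fps_shift 1 F)"
  by (subst fps_decomp[of F]) (simp only: tshift_add tshift_const tshift_X_mult)

lemma tshift_mult: "tshift c (F * G) = tshift c F * tshift c G"
  by (rule fps_multiplicative[OF tshift_add tshift_X_mult]) (simp only: tshift_const taylor_mult)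

lemma tshift_taylor: "tshift a (taylor b u) = taylor (a + b) u"
proof (rule fps_ext)
  fix n
  have "tshift a (taylor b u) $ n = (\<Sum>j\<le>n. cst (of_int a ^ j / fact j * (of_int b ^ (n - j) / fact (n - j)))) * (dW ^^ n) u"
    unfolding tshift_def taylor_def fps_nth_Abs_fps sum_distrib_right
  proof (intro sum.cong refl)
    fix j assume "j \<in> {..n}"
    then have "(dW ^^ j) ((dW ^^ (n - j)) u) = (dW ^^ n) u"
      using funpow_add[of j "n - j" dW] by simp
    then show "cst (of_int a ^ j / fact j) * (dW ^^ j) (cst (of_int b ^ (n - j) / fact (n - j)) * (dW ^^ (n - j)) u)
        = cst (of_int a ^ j / fact j * (of_int b ^ (n - j) / fact (n - j))) * (dW ^^ n) u"
      by (simp only: dW_pow_cst_mult cst_mult mult.assoc)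
  qed
  also have "(\<Sum>j\<le>n. cst (of_int a ^ j / fact j * (of_int b ^ (n - j) / fact (n - j))))
      = cst (\<Sum>j\<le>n. of_int a ^ j / fact j * (of_int b ^ (n - j) / fact (n - j)))"
    by (simp only: cst_sum)
  also have "(\<Sum>j\<le>n. of_int a ^ j / fact j * (of_int b ^ (n - j) / fact (n - j)) :: real) = of_int (a + b) ^ n / fact n"
  proof -
    have "of_int (a + b) ^ n / fact n = (\<Sum>j\<le>n. of_nat (n choose j) * of_int a ^ j * of_int b ^ (n - j) / fact n :: real)"
      by (simp only: of_int_add binomial_ring sum_divide_distrib)
    also have "\<dots> = (\<Sum>j\<le>n. of_int a ^ j / fact j * (of_int b ^ (n - j) / fact (n - j)))"
      by (intro sum.cong refl) (simp add: binomial_fact)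
    finally show ?thesis by (rule sym)
  qed
  finally show "tshift a (taylor b u) $ n = taylor (a + b) u $ n" by (simp add: taylor_def)
qed

lemma tshift_tshift: "tshift a (tshift b F) = tshift (a + b) F"
proof (rule fps_ext)
  fix n
  show "tshift a (tshift b F) $ n = tshift (a + b) F $ n"
  proof (induction n arbitrary: F)
    case 0
    show ?case by (simp add: tshift_def cst_1)
  next
    case (Suc n)
    show ?case
      by (subst tshift_decomp[of b], subst tshift_decomp[of "a + b"])
         (simp add: tshift_add tshift_taylor tshift_X_mult Suc)
  qed
qed

lemma tshift_0: "tshift 0 F = F"
proof (rule fps_ext)
  fix n
  have "tshift 0 F $ n = (\<Sum>j\<le>n. if j = 0 then F $ n else 0)"
    unfolding tshift_def fps_nth_Abs_fps by (intro sum.cong) (auto simp: cst_1 cst_0 power_0_left)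
  then show "tshift 0 F $ n = F $ n" by simp
qed

lemma tshift_nth_0[simp]: "tshift c F $ 0 = F $ 0"
  by (simp add: tshift_def cst_1)

lemma tshift_1: "tshift c 1 = 1" and tshift_zero: "tshift c 0 = 0"
proof -
  have "taylor c (cst 1) = 1"
  proof (rule fps_ext)
    fix n
    have "(dW ^^ n) (cst 1) = (if n = 0 then cst 1 else 0)" for n
      by (cases n) (simp_all only: funpow_Suc_right o_apply partial_cst[OF eW_Dirs] dW_pow_0, simp_all)
    then show "taylor c (cst 1) $ n = 1 $ n" by (simp add: taylor_def cst_1)
  qed
  then show "tshift c 1 = 1" by (simp add: tshift_const[symmetric] cst_1)
  show "tshift c 0 = 0" by (rule fps_ext) (simp add: tshift_def)
qed

text \<open>The shift is a ring endomorphism taking the weight of site \<open>n\<close> to that of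
  site \<open>n + c\<close>, so entries at different sites are shifts of each other.\<close>

lemma tshift_jpow: "tshift c (jpow (\<lambda>n. tshift n F) p n m) = jpow (\<lambda>n. tshift n F) p (n + c) (m + c)"
proof -
  have "tshift c (jpow (\<lambda>n. tshift n F) p n m) = jpow (\<lambda>n. tshift c (tshift n F)) p n m"
    by (rule jpow_hom) (simp_all add: tshift_1 tshift_zero tshift_add tshift_mult)
  also have "\<dots> = jpow (\<lambda>n. tshift (n + c) F) p n m" by (simp add: tshift_tshift add.commute)
  finally show ?thesis by (simp only: jpow_shift[of "\<lambda>n. tshift n F"])
qed

subsection \<open>The formal solution of the string equation\<close>

lemma dW_cst_taylor: "dW a = 0 \<Longrightarrow> taylor c a = fps_const a"
proof (rule fps_ext)
  fix n assume "dW a = 0"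
  then show "taylor c a $ n = fps_const a $ n"
    by (cases n) (simp_all add: taylor_def cst_1 funpow_Suc_right del: funpow.simps(2))
qed

text \<open>Here \<open>S\<close> are the times, \<open>W\<close> is the space variable,
  \<open>y\<close> a root of the leading equation and \<open>dl\<close> an inverse of the derivative
  of that equation at \<open>y\<close>. Every order of the recursion divides by this
  derivative.\<close>

locale toda_formal =
  fixes \<nu> :: "bool \<Rightarrow> nat" and S :: "bool \<Rightarrow> sfun" and W y dl :: sfun
  assumes \<nu>: "\<And>i. \<nu> i \<ge> 1"
    and dW_S: "\<And>i. dW (S i) = 0" and dW_W: "dW W = 1"
    and dS_W: "\<And>i. dS i W = 0" and dS_S: "\<And>i j. dS i (S j) = of_bool (i = j)"
    and y: "y - (\<Sum>i\<in>UNIV. cst (toda_const (\<nu> i)) * S i * y ^ \<nu> i) = W"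
    and dl: "dl * (1 - (\<Sum>i\<in>UNIV. cst (toda_const (\<nu> i) * real (\<nu> i)) * S i * y ^ (\<nu> i - 1))) = 1"
begin

definition den where "den = 1 - (\<Sum>i\<in>UNIV. cst (toda_const (\<nu> i) * real (\<nu> i)) * S i * y ^ (\<nu> i - 1))"
text \<open>The coefficient \<open>- 4 \<nu>_i \<xi>_i\<close> of the string equation becomes
  \<open>- 2 \<nu>_i s_i\<close> after rescaling by \<open>k\<close>.\<close>

definition vv :: "bool \<Rightarrow> sfun" where "vv i = cst (- 2 * real (\<nu> i)) * S i"
abbreviation deg :: "bool \<Rightarrow> nat" where "deg i \<equiv> 2 * \<nu> i - 1"
abbreviation str :: "(int \<Rightarrow> sfun fps) \<Rightarrow> int \<Rightarrow> sfun fps" where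
  "str \<equiv> string_op UNIV (\<lambda>i. fps_const (vv i)) deg"
text \<open>The equation at site 0 is enough, since the equations at the other sites are its Taylor
  shifts.\<close>

definition St :: "sfun fps \<Rightarrow> sfun fps" where "St F = str (\<lambda>n. tshift n F) 0"
definition dstr :: "(int \<Rightarrow> sfun fps) \<Rightarrow> (int \<Rightarrow> sfun fps) \<Rightarrow> sfun fps" where
  "dstr r \<rho> = \<rho> 0 + (\<Sum>i\<in>UNIV. fps_const (vv i) * djpow r \<rho> (deg i) 0 (- 1))"

lemma toda_const_choose: "toda_const (\<nu> i) = 2 * real (\<nu> i) * real (deg i choose \<nu> i)"
  using binomial_symmetric[of "\<nu> i" "deg i"] \<nu>[of i] by (simp add: toda_const_def)

lemma dl_den: "dl * den = 1" using dl by (simp add: den_def)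

lemma den_cancel: "den * a = 0 \<Longrightarrow> a = 0"
proof -
  assume "den * a = 0"
  then have "(dl * den) * a = 0" by (simp only: mult.assoc mult_zero_right)
  then show "a = 0" by (simp only: dl_den mult_1_left)
qed

lemma nth0_jpow: "jpow r p n m $ 0 = jpow (\<lambda>n. r n $ 0) p n m" for r :: "int \<Rightarrow> sfun fps"
  by (rule jpow_hom) simp_all

lemma nth0_djpow: "djpow r \<rho> p n m $ 0 = djpow (\<lambda>n. r n $ 0) (\<lambda>n. \<rho> n $ 0) p n m" for r \<rho> :: "int \<Rightarrow> sfun fps"
  by (rule djpow_hom) simp_all

text \<open>At order 0 all shifts coincide, so powers reduce to binomial coefficients, and
  \<open>2 \<nu>\<close> times that of \<open>2 \<nu> - 1\<close> over \<open>\<nu>\<close> is the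
  constant of the scheme.\<close>

lemma St_nth0: "St F $ 0 = F $ 0 - (\<Sum>i\<in>UNIV. cst (toda_const (\<nu> i)) * S i * (F $ 0) ^ \<nu> i)"
proof -
  have "jpow (\<lambda>n. F $ 0) (deg i) 0 (- 1) = of_nat (deg i choose \<nu> i) * (F $ 0) ^ \<nu> i" for i
    by (rule jpow_const) (use \<nu>[of i] in simp)
  then have "vv i * jpow (\<lambda>n. F $ 0) (deg i) 0 (- 1) = - (cst (toda_const (\<nu> i)) * S i * (F $ 0) ^ \<nu> i)" for i
    unfolding toda_const_choose vv_def by (intro sfun_eqI) simp
  then show ?thesis by (simp add: St_def string_op_def nth0_jpow fps_sum_nth sum_negf)
qed

lemma dstr_nth0:
  assumes "\<And>n. r n $ 0 = y" "\<And>n. \<rho> n $ 0 = a"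
  shows "dstr r \<rho> $ 0 = den * a"
proof -
  have "djpow (\<lambda>n. y) (\<lambda>n. a) (deg i) 0 (- 1) = of_nat (\<nu> i * (deg i choose \<nu> i)) * y ^ (\<nu> i - 1) * a" for i
    by (rule djpow_const) (use \<nu>[of i] in simp)
  then have "vv i * djpow (\<lambda>n. y) (\<lambda>n. a) (deg i) 0 (- 1)
      = - (cst (toda_const (\<nu> i) * real (\<nu> i)) * S i * y ^ (\<nu> i - 1) * a)" for i
    unfolding toda_const_choose vv_def by (intro sfun_eqI) simp
  then show ?thesis
    by (simp add: dstr_def nth0_djpow fps_sum_nth assms den_def sum_negf sum_distrib_right left_diff_distrib)
qed

lemma dstr_mult: "dstr r (\<lambda>n. c * \<rho> n) = c * dstr r \<rho>"
  by (simp add: dstr_def djpow_mult sum_distrib_left algebra_simps)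

text \<open>The lowest nonzero coefficient of \<open>G\<close> would be annihilated by
  \<open>den\<close>, which has the inverse \<open>dl\<close>.\<close>

lemma dstr_eq_0:
  assumes F: "F $ 0 = y" and G: "dstr (\<lambda>n. tshift n F) (\<lambda>n. tshift n G) = 0"
  shows "G = 0"
proof (rule ccontr)
  assume "G \<noteq> 0"
  define m where "m = subdegree G"
  define G' where "G' = fps_shift m G"
  have "G = G' * fps_X ^ m" unfolding G'_def m_def by (rule subdegree_decompose)
  then have GG: "G = fps_X ^ m * G'" by (subst mult.commute)
  have "G' $ 0 \<noteq> 0" using \<open>G \<noteq> 0\<close> by (simp add: G'_def m_def)
  have "fps_X ^ m * dstr (\<lambda>n. tshift n F) (\<lambda>n. tshift n G') = 0"
    using G unfolding GG tshift_X_pow_mult dstr_mult .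
  then have "(fps_X ^ m * dstr (\<lambda>n. tshift n F) (\<lambda>n. tshift n G')) $ m = 0" by simp
  then have "den * G' $ 0 = 0" by (simp add: fps_X_power_mult_nth dstr_nth0[of _ _ "G' $ 0"] F)
  then show False using den_cancel \<open>G' $ 0 \<noteq> 0\<close> by blast
qed

text \<open>At order \<open>m\<close> only the leading coefficient of the perturbation enters,
  through the linearization at the constant sequence \<open>y\<close>; quadratic terms start at
  order \<open>2 m > m\<close>.\<close>

lemma St_perturb:
  assumes F: "F $ 0 = y" and m: "m \<ge> 1"
  shows "k < m \<Longrightarrow> St (F + fps_X ^ m * G) $ k = St F $ k"
    and "St (F + fps_X ^ m * G) $ m = St F $ m + den * G $ 0"
proof -
  have "\<forall>i. \<exists>c. jpow (\<lambda>n. tshift n F + fps_X ^ m * tshift n G) (deg i) 0 (- 1)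
     = jpow (\<lambda>n. tshift n F) (deg i) 0 (- 1) + fps_X ^ m * djpow (\<lambda>n. tshift n F) (\<lambda>n. tshift n G) (deg i) 0 (- 1) + (fps_X ^ m)\<^sup>2 * c"
    by (intro allI jpow_perturb)
  from choice[OF this] obtain c where c: "\<And>i. jpow (\<lambda>n. tshift n F + fps_X ^ m * tshift n G) (deg i) 0 (- 1)
     = jpow (\<lambda>n. tshift n F) (deg i) 0 (- 1) + fps_X ^ m * djpow (\<lambda>n. tshift n F) (\<lambda>n. tshift n G) (deg i) 0 (- 1) + (fps_X ^ m)\<^sup>2 * c i"
    by (elim exE) (rule that, erule spec)
  define P where "P i = jpow (\<lambda>n. tshift n F) (deg i) 0 (- 1)" for i
  define Q where "Q i = djpow (\<lambda>n. tshift n F) (\<lambda>n. tshift n G) (deg i) 0 (- 1)" for i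
  have c': "fps_const (vv i) * jpow (\<lambda>n. tshift n F + fps_X ^ m * tshift n G) (deg i) 0 (- 1)
     = fps_const (vv i) * P i + fps_X ^ m * (fps_const (vv i) * Q i) + fps_X ^ m * (fps_X ^ m * (fps_const (vv i) * c i))" for i
    unfolding c P_def[symmetric] Q_def[symmetric] power2_eq_square
    by (simp only: distrib_left mult.assoc mult.left_commute)
  have "St (F + fps_X ^ m * G) = tshift 0 F + fps_X ^ m * tshift 0 G
     + (\<Sum>i\<in>UNIV. fps_const (vv i) * jpow (\<lambda>n. tshift n F + fps_X ^ m * tshift n G) (deg i) 0 (- 1))"
    unfolding St_def string_op_def tshift_add tshift_X_pow_mult by (simp only: diff_0)
  also have "\<dots> = (tshift 0 F + (\<Sum>i\<in>UNIV. fps_const (vv i) * P i)) + fps_X ^ m * (tshift 0 G + (\<Sum>i\<in>UNIV. fps_const (vv i) * Q i))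
     + fps_X ^ m * (fps_X ^ m * (\<Sum>i\<in>UNIV. fps_const (vv i) * c i))"
    unfolding c' sum.distrib sum_distrib_left[symmetric] distrib_left by (simp only: ac_simps)
  finally have E: "St (F + fps_X ^ m * G) = St F + fps_X ^ m * dstr (\<lambda>n. tshift n F) (\<lambda>n. tshift n G)
     + fps_X ^ m * (fps_X ^ m * (\<Sum>i\<in>UNIV. fps_const (vv i) * c i))"
    by (simp only: St_def string_op_def dstr_def P_def Q_def diff_0)
  have D0: "dstr (\<lambda>n. tshift n F) (\<lambda>n. tshift n G) $ 0 = den * G $ 0"
    by (rule dstr_nth0) (simp_all only: tshift_nth_0 F)
  show "k < m \<Longrightarrow> St (F + fps_X ^ m * G) $ k = St F $ k"
    unfolding E fps_add_nth fps_X_power_mult_nth by simp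
  show "St (F + fps_X ^ m * G) $ m = St F $ m + den * G $ 0"
    unfolding E fps_add_nth fps_X_power_mult_nth using m by (simp add: D0)
qed

lemma St_unique:
  assumes "F $ 0 = y" "F' $ 0 = y" "St F = St F'" shows "F = F'"
proof (rule ccontr)
  assume ne: "F \<noteq> F'"
  define H where "H = F' - F"
  have H: "H \<noteq> 0" "H $ 0 = 0" using ne assms by (simp_all add: H_def)
  define m where "m = subdegree H"
  have "H $ m \<noteq> 0" unfolding m_def using H(1) by (rule nth_subdegree_nonzero)
  then have m: "m \<ge> 1" using H(2) by (cases m) auto
  define G where "G = fps_shift m H"
  have "H = G * fps_X ^ m" unfolding G_def m_def by (rule subdegree_decompose)
  then have "F' - F = fps_X ^ m * G" by (simp only: H_def mult.commute)
  then have "F' = F + fps_X ^ m * G" by (simp only: diff_eq_eq add.commute)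
  then have "den * G $ 0 = 0" using St_perturb(2)[OF assms(1) m, of G] assms(3) by simp
  then have "G $ 0 = 0" by (rule den_cancel)
  then show False using H by (simp add: G_def m_def)
qed

text \<open>Since \<open>dl\<close> inverts \<open>den\<close>, the new coefficient cancels the
  residual at order \<open>Suc m\<close> and leaves the lower orders untouched.\<close>

primrec approx :: "nat \<Rightarrow> sfun fps" where
  "approx 0 = fps_const y"
| "approx (Suc m) = approx m + fps_X ^ Suc m * fps_const (- (dl * St (approx m) $ Suc m))"

definition F :: "sfun fps" where "F = Abs_fps (\<lambda>m. approx m $ m)"

lemma approx_nth0: "approx m $ 0 = y"
  by (induction m) simp_all

lemma approx_solves: "k \<le> m \<Longrightarrow> St (approx m) $ k = fps_const W $ k"
proof (induction m)
  case 0
  then show ?case by (simp add: St_nth0 y)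
next
  case (Suc m)
  note p = St_perturb[OF approx_nth0, of "Suc m"]
  show ?case
  proof (cases "k = Suc m")
    case True
    have "St (approx (Suc m)) $ Suc m = St (approx m) $ Suc m - (dl * den) * St (approx m) $ Suc m"
      unfolding approx.simps by (subst p(2)) (simp_all add: algebra_simps)
    then show ?thesis using True by (simp add: dl_den)
  next
    case False
    then have "k < Suc m" "k \<le> m" using Suc.prems by auto
    then show ?thesis using p(1)[of k m] Suc.IH by simp
  qed
qed

lemma approx_stable: "k \<le> m \<Longrightarrow> m \<le> n \<Longrightarrow> approx n $ k = approx m $ k"
proof (induction n)
  case (Suc n)
  show ?case
  proof (cases "m = Suc n")
    case False
    then have "approx (Suc n) $ k = approx n $ k"
      using Suc.prems by (simp add: fps_X_power_mult_nth del: power_Suc)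
    then show ?thesis using Suc False by simp
  qed simp
qed simp

lemma F_nth0: "F $ 0 = y" by (simp add: F_def)

lemma St_F: "St F = fps_const W"
proof (rule fps_ext)
  fix k
  define G where "G = fps_shift (Suc k) (F - approx k)"
  have "F = approx k + fps_X ^ Suc k * G"
  proof (rule fps_ext)
    fix n
    show "F $ n = (approx k + fps_X ^ Suc k * G) $ n"
    proof (cases "n \<le> k")
      case True
      then show ?thesis using approx_stable[of n n k] by (simp add: F_def fps_X_power_mult_nth del: power_Suc)
    next
      case False
      then show ?thesis by (simp add: G_def fps_X_power_mult_nth del: power_Suc)
    qed
  qed
  then have "St F $ k = St (approx k) $ k"
    using St_perturb(1)[OF approx_nth0, of "Suc k" k k G] by simp
  then show "St F $ k = fps_const W $ k" by (simp add: approx_solves)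
qed

section \<open>The reflection of \<epsilon> and the vanishing of the odd orders\<close>

definition N :: "sfun fps \<Rightarrow> sfun fps" where "N A = Abs_fps (\<lambda>m. cst ((- 1) ^ m) * A $ m)"

lemma N_add: "N (A + B) = N A + N B"
  by (rule fps_ext) (simp add: N_def algebra_simps)

lemma N_mult: "N (A * B) = N A * N B"
proof (rule fps_ext)
  fix n
  have "cst ((- 1) ^ i) * A $ i * (cst ((- 1) ^ (n - i)) * B $ (n - i)) = cst ((- 1) ^ n) * (A $ i * B $ (n - i))"
    if "i \<le> n" for i
  proof -
    have *: "cst ((- 1) ^ i) * cst ((- 1) ^ (n - i)) = cst ((- 1) ^ n)"
      using that by (simp only: cst_mult[symmetric] power_add[symmetric]) simp
    have "cst ((- 1) ^ i) * A $ i * (cst ((- 1) ^ (n - i)) * B $ (n - i))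
        = (cst ((- 1) ^ i) * cst ((- 1) ^ (n - i))) * (A $ i * B $ (n - i))"
      by (simp only: mult.assoc mult.left_commute)
    then show ?thesis by (simp only: *)
  qed
  then show "N (A * B) $ n = (N A * N B) $ n"
    by (simp add: N_def fps_mult_nth sum_distrib_left)
qed

lemma N_const: "N (fps_const a) = fps_const a"
  by (rule fps_ext) (simp add: N_def cst_1)

lemma N_tshift: "N (tshift c A) = tshift (- c) (N A)"
proof (rule fps_ext)
  fix n
  have "cst ((- 1) ^ n) * (cst (of_int c ^ j / fact j) * (dW ^^ j) (A $ (n - j)))
      = cst (of_int (- c) ^ j / fact j) * (dW ^^ j) (cst ((- 1) ^ (n - j)) * A $ (n - j))" if "j \<le> n" for j
  proof -
    have "(- 1) ^ n * (of_int c ^ j / fact j) = of_int (- c) ^ j / fact j * (- 1 :: real) ^ (n - j)"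
    proof -
      have "(- 1 :: real) ^ n = (- 1) ^ j * (- 1) ^ (n - j)" using that by (simp add: power_add[symmetric])
      moreover have "of_int (- c) ^ j = (- 1 :: real) ^ j * of_int c ^ j" by (simp add: power_mult_distrib[symmetric])
      ultimately show ?thesis by simp
    qed
    then show ?thesis by (simp only: dW_pow_cst_mult mult.assoc[symmetric] cst_mult[symmetric])
  qed
  then show "N (tshift c A) $ n = tshift (- c) (N A) $ n"
    by (simp add: N_def tshift_def sum_distrib_left)
qed

text \<open>Changing the sign of \<epsilon> turns the shift by \<open>n\<close> into the shift by
  \<open>- n\<close>. Translation by one site followed by \<open>jpow_reflect\<close> undoes this
  and returns the entry \<open>(0, -1)\<close> to itself.\<close>

lemma St_N: "St (N A) = N (St A)"
proof -
  have "jpow (\<lambda>n. tshift n (N A)) p 0 (- 1) = N (jpow (\<lambda>n. tshift n A) p 0 (- 1))" for p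
  proof -
    have "N (jpow (\<lambda>n. tshift n A) p 0 (- 1)) = jpow (\<lambda>n. N (tshift n A)) p 0 (- 1)"
      by (rule jpow_hom) (simp_all add: N_add N_mult N_const[of 1, simplified] N_const[of 0, simplified])
    also have "\<dots> = jpow (\<lambda>n. tshift (- n) (N A)) p 0 (- 1)" by (simp only: N_tshift)
    also have "\<dots> = jpow (\<lambda>l. tshift (- (l - 1)) (N A)) p 1 0"
      using jpow_shift[of "\<lambda>l. tshift (- l) (N A)" "- 1" p 1 0] by simp
    also have "(\<lambda>l. tshift (- (l - 1)) (N A)) = (\<lambda>l. tshift (1 - l) (N A))" by simp
    also have "jpow (\<lambda>l. tshift (1 - l) (N A)) p 1 0 = jpow (\<lambda>l. tshift l (N A)) p 0 (- 1)"
      using jpow_reflect[of "\<lambda>l. tshift l (N A)" p "- 1" 0] by simp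
    finally show ?thesis by simp
  qed
  then show ?thesis
    by (simp add: St_def string_op_def N_add N_mult N_const N_tshift UNIV_bool)
qed

lemma F_odd: "odd m \<Longrightarrow> F $ m = 0"
proof -
  assume m: "odd m"
  have "N F = F"
    by (rule St_unique) (simp_all add: St_N St_F N_const F_nth0, simp add: N_def F_nth0 cst_1)
  then have "N F $ m = F $ m" by simp
  then have "cst (- 1) * F $ m = F $ m" using m by (simp add: N_def)
  then have e: "ev (cst (- 1) * F $ m) x = ev (F $ m) x" for x by (simp only:)
  have "- ev (F $ m) x = ev (F $ m) x" if "x \<in> toda_dom" for x
    using e[of x] that by simp
  then show ?thesis by (intro sfun_eqI) fastforce
qed

abbreviation r :: "int \<Rightarrow> sfun fps" where "r n \<equiv> tshift n F"

lemma tshift_W: "tshift n (fps_const W) = fps_const W + fps_const (cst (of_int n)) * fps_X"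
proof (rule fps_ext)
  fix k
  have *: "(dW ^^ k) W = (if k = 0 then W else if k = 1 then 1 else 0)"
  proof (cases k)
    case (Suc j)
    then show ?thesis by (cases j) (simp_all add: funpow_Suc_right dW_W del: funpow.simps(2))
  qed simp
  consider "k = 0" | "k = 1" | "k \<ge> 2" by linarith
  then show "tshift n (fps_const W) $ k = (fps_const W + fps_const (cst (of_int n)) * fps_X) $ k"
    by cases (simp_all add: tshift_const taylor_def * dW_W cst_1 fps_X_def)
qed

end

section \<open>The Toda flow and the homogeneity of the formal solution\<close>

context toda_formal
begin

lemma str_r: "str r n = fps_const W + fps_const (cst (of_int n)) * fps_X"
proof -
  have vv: "tshift n (fps_const (vv i)) = fps_const (vv i)" for i
    unfolding tshift_const by (rule dW_cst_taylor) (simp add: vv_def partial_cst_mult dW_S)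
  have "tshift n (\<Sum>i\<in>UNIV. fps_const (vv i) * jpow r (deg i) 0 (- 1)) = (\<Sum>i\<in>UNIV. fps_const (vv i) * jpow r (deg i) n (n - 1))"
    using tshift_jpow[of n F _ 0 "- 1"] by (simp add: UNIV_bool tshift_add tshift_mult vv)
  then have "tshift n (St F) = str r n"
    by (simp add: St_def string_op_def tshift_add tshift_tshift)
  then show ?thesis by (simp add: St_F tshift_W)
qed

text \<open>The entry \<open>(n, n-1)\<close> of the vector field
  \<open>[L, (L^(2\<nu>_i))_-]\<close>.\<close>

definition q :: "bool \<Rightarrow> int \<Rightarrow> sfun fps" where
  "q i n = jpow r (2 * \<nu> i) (n + 1) (n - 1) - jpow r (2 * \<nu> i) n (n - 2)"

lemma tshift_q: "tshift c (q i 0) = q i c"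
proof -
  have "tshift c (- A) = - tshift c A" for A
    using tshift_add[of c A "- A"] by (simp add: tshift_zero eq_neg_iff_add_eq_0 add.commute)
  then have "tshift c (A - B) = tshift c A - tshift c B" for A B
    using tshift_add[of c A "- B"] by simp
  then show ?thesis
    using tshift_jpow[of c F "2 * \<nu> i" 1 "- 1"] tshift_jpow[of c F "2 * \<nu> i" 0 "- 2"]
    by (simp add: q_def add.commute)
qed

text \<open>This is \<open>toda_flow_string\<close> with \<open>e = \<epsilon>\<close>, because the
  right side of the string equation grows by \<epsilon> from one site to the next.\<close>

lemma dstr_q: "dstr r (q i) = of_nat (2 * \<nu> i) * fps_X * jpow r (deg i) 0 (- 1)"
proof -
  \<comment> \<open>The index \<open>None\<close> carries the linear term, \<open>r n\<close> being
    the entry \<open>(n, n-1)\<close> of the first power.\<close>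
  let ?v = "\<lambda>j :: bool option. case j of None \<Rightarrow> 1 | Some j \<Rightarrow> fps_const (vv j)"
  let ?d = "\<lambda>j :: bool option. case j of None \<Rightarrow> 1 | Some j \<Rightarrow> deg j"
  have opt: "(\<Sum>j\<in>UNIV. f j) = f None + (\<Sum>j\<in>UNIV. f (Some j))" for f :: "bool option \<Rightarrow> sfun fps"
    by (simp add: UNIV_option_conv sum.reindex)
  have str: "(\<Sum>j\<in>UNIV. ?v j * jpow r (?d j) n (n - 1)) = fps_const W + fps_const (cst (of_int n)) * fps_X" for n
    unfolding str_r[symmetric] opt by (simp add: string_op_def)
  have "(\<Sum>j\<in>UNIV. ?v j * djpow r (\<lambda>n. jpow r (2 * \<nu> i) (n + 1) (n - 1) - jpow r (2 * \<nu> i) n (n - 2)) (?d j) 0 (0 - 1))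
     = of_nat (2 * \<nu> i) * fps_X * jpow r (2 * \<nu> i - 1) 0 (0 - 1)"
  proof (rule toda_flow_string)
    show "odd (?d j)" for j
    proof (cases j)
      case (Some i)
      then show ?thesis using \<nu>[of i] by simp
    qed simp
    show "(\<Sum>j\<in>UNIV. ?v j * jpow r (?d j) (n + 1) n) = (\<Sum>j\<in>UNIV. ?v j * jpow r (?d j) n (n - 1)) + fps_X" for n
      using str[of "n + 1"] str[of n]
      by (simp add: cst_add cst_1 fps_const_add[symmetric] ring_distribs del: fps_const_add)
  qed auto
  then show ?thesis unfolding opt by (simp add: dstr_def q_def[abs_def])
qed

definition \<Delta> :: "bool \<Rightarrow> sfun fps \<Rightarrow> sfun fps" where "\<Delta> i A = Abs_fps (\<lambda>m. dS i (A $ m))"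

lemma \<Delta>_add: "\<Delta> i (A + B) = \<Delta> i A + \<Delta> i B"
  by (rule fps_ext) (simp add: \<Delta>_def partial_add)

lemma \<Delta>_mult: "\<Delta> i (A * B) = \<Delta> i A * B + A * \<Delta> i B"
  by (rule fps_ext) (simp add: \<Delta>_def fps_mult_nth partial_sum partial_mult sum.distrib)

lemma \<Delta>_const: "\<Delta> i (fps_const a) = fps_const (dS i a)"
  by (rule fps_ext) (simp add: \<Delta>_def)

lemma \<Delta>_tshift: "\<Delta> i (tshift c A) = tshift c (\<Delta> i A)"
proof (rule fps_ext)
  fix m
  have "dS i ((dW ^^ j) u) = (dW ^^ j) (dS i u)" for j u
    by (induction j arbitrary: u) (simp_all add: partial_commute[of eW "eS i"])
  then show "\<Delta> i (tshift c A) $ m = tshift c (\<Delta> i A) $ m"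
    by (simp add: \<Delta>_def tshift_def partial_sum partial_cst_mult)
qed

text \<open>Differentiate the string equation in time \<open>i\<close>: its right side
  \<open>W\<close> is independent of the time, and the explicit factor in \<open>vv i\<close>
  produces the inhomogeneity.\<close>

lemma dstr_\<Delta>: "dstr r (\<lambda>n. tshift n (\<Delta> i F)) = of_nat (2 * \<nu> i) * jpow r (deg i) 0 (- 1)"
proof -
  have jpow: "\<Delta> i (jpow r p n m) = djpow r (\<lambda>n. tshift n (\<Delta> i F)) p n m" for p n m
    unfolding \<Delta>_tshift[symmetric]
    by (rule jpow_derivation) (simp_all add: \<Delta>_add \<Delta>_mult \<Delta>_const[of i 0, simplified] \<Delta>_const[of i 1, simplified])
  have vv: "\<Delta> i (fps_const (vv j)) = (if j = i then - of_nat (2 * \<nu> i) else 0)" for j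
  proof -
    have "dS i (vv j) = (if j = i then - of_nat (2 * \<nu> i) else 0)"
    proof (rule sfun_eqI)
      fix x assume x: "x \<in> toda_dom"
      have "ev (of_nat (2 * \<nu> i)) x = real (2 * \<nu> i)" using x by (rule ev_of_nat)
      then show "ev (dS i (vv j)) x = ev (if j = i then - of_nat (2 * \<nu> i) else 0) x"
        using x unfolding vv_def by (simp add: partial_cst_mult dS_S del: of_nat_mult)
    qed
    moreover have "fps_const (- of_nat (2 * \<nu> i) :: sfun) = - of_nat (2 * \<nu> i)"
      by (simp only: fps_const_neg[symmetric] fps_of_nat)
    ultimately show ?thesis unfolding \<Delta>_const by simp
  qed
  have "0 = \<Delta> i (St F)" by (simp add: St_F \<Delta>_const dS_W)
  also have "\<dots> = \<Delta> i F + (\<Sum>j\<in>UNIV. \<Delta> i (fps_const (vv j)) * jpow r (deg j) 0 (- 1)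
      + fps_const (vv j) * djpow r (\<lambda>n. tshift n (\<Delta> i F)) (deg j) 0 (- 1))"
    unfolding St_def string_op_def UNIV_bool by (simp add: \<Delta>_add \<Delta>_mult jpow tshift_0)
  also have "\<dots> = dstr r (\<lambda>n. tshift n (\<Delta> i F)) - of_nat (2 * \<nu> i) * jpow r (deg i) 0 (- 1)"
    unfolding vv dstr_def sum.distrib tshift_0 by (cases i) (simp_all add: UNIV_bool)
  finally show ?thesis by simp
qed

text \<open>The factor \<open>fps_X\<close> supplies the \<epsilon> that \<open>dstr_q\<close> has
  and \<open>dstr_\<Delta>\<close> lacks; then both satisfy one linear equation, and
  \<open>dstr_eq_0\<close> applies to their difference.\<close>

theorem toda: "fps_X * \<Delta> i F = jpow r (2 * \<nu> i) 1 (- 1) - jpow r (2 * \<nu> i) 0 (- 2)"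
proof -
  define G where "G = fps_X * \<Delta> i F + fps_const (- 1) * q i 0"
  have TG: "tshift n G = fps_X * tshift n (\<Delta> i F) - q i n" for n
  proof -
    have "dW (- 1) = 0" by (simp add: partial_uminus)
    then have "tshift n (fps_const (- 1)) = fps_const (- 1)" unfolding tshift_const by (rule dW_cst_taylor)
    then have "tshift n G = fps_X * tshift n (\<Delta> i F) + fps_const (- 1) * q i n"
      unfolding G_def tshift_add tshift_mult tshift_q by (simp only: tshift_X_mult[of n 1, simplified tshift_1 mult_1_right])
    then show ?thesis by (simp add: fps_const_neg[symmetric] del: fps_const_neg)
  qed
  have "dstr r (\<lambda>n. tshift n G) = dstr r (\<lambda>n. fps_X * tshift n (\<Delta> i F)) - dstr r (q i)"
    unfolding TG by (simp add: dstr_def djpow_diff sum_subtractf algebra_simps)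
  also have "\<dots> = 0" unfolding dstr_mult dstr_\<Delta> dstr_q by (simp add: algebra_simps)
  finally have "G = 0" by (rule dstr_eq_0[OF F_nth0])
  then have "fps_X * \<Delta> i F = q i 0"
    by (simp add: G_def fps_const_neg[symmetric] del: fps_const_neg)
  then show ?thesis by (simp add: q_def)
qed

text \<open>Substituting \<open>L w\<close> for \<open>w\<close>, \<open>L^(1-\<nu>_i) s_i\<close>
  for \<open>s_i\<close> and \<open>L \<epsilon>\<close> for \<epsilon> scales the string equation
  by \<open>L\<close>, so the rescaled series \<open>G\<close> solves the original equation and
  equals \<open>F\<close>. The map \<open>h\<close> abstracts the substitution in \<open>w\<close>
  and the times.\<close>

lemma homogeneous:
  fixes h :: "sfun \<Rightarrow> sfun" and L :: real
  assumes L: "L \<noteq> 0" and h: "h 0 = 0" "h 1 = 1" "\<And>u v. h (u + v) = h u + h v" "\<And>u v. h (u * v) = h u * h v"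
    "\<And>c. h (cst c) = cst c"
    and hW: "\<And>u. dW (h u) = cst L * h (dW u)" and "h W = cst L * W" "h y = cst L * y"
    and hS: "\<And>i. h (S i) = cst (L / L ^ \<nu> i) * S i"
  shows "cst L * F $ m = cst (L ^ m) * h (F $ m)"
proof -
  define H where "H A = Abs_fps (\<lambda>m. cst (L ^ m) * h (A $ m))" for A
  have hsum: "h (\<Sum>i\<in>I. f i) = (\<Sum>i\<in>I. h (f i))" for f :: "nat \<Rightarrow> sfun" and I
    by (induction I rule: infinite_finite_induct) (simp_all add: h)
  have H_add: "H (A + B) = H A + H B" for A B
    by (rule fps_ext) (simp add: H_def h algebra_simps)
  have H_mult: "H (A * B) = H A * H B" for A B
  proof (rule fps_ext)
    fix n
    have "cst (L ^ n) * (h (A $ i) * h (B $ (n - i))) = cst (L ^ i) * h (A $ i) * (cst (L ^ (n - i)) * h (B $ (n - i)))"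
      if "i \<le> n" for i
    proof -
      have "cst (L ^ n) = cst (L ^ i) * cst (L ^ (n - i))"
        using that by (simp only: cst_mult[symmetric] power_add[symmetric]) simp
      then show ?thesis by (simp only: mult.assoc mult.left_commute)
    qed
    then show "H (A * B) $ n = (H A * H B) $ n"
      by (simp add: H_def fps_mult_nth hsum h sum_distrib_left)
  qed
  have H_const: "H (fps_const a) = fps_const (h a)" for a
    by (rule fps_ext) (simp add: H_def cst_1 h)
  have hWj: "(dW ^^ j) (h u) = cst (L ^ j) * h ((dW ^^ j) u)" for j u
  proof (induction j)
    case (Suc j)
    have "(dW ^^ Suc j) (h u) = cst (L ^ j) * (cst L * h ((dW ^^ Suc j) u))"
      by (simp add: Suc partial_cst_mult hW)
    then show ?case by (simp only: power_Suc cst_mult mult.assoc mult.left_commute)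
  qed (simp add: cst_1)
  have H_tshift: "H (tshift c A) = tshift c (H A)" for c A
  proof (rule fps_ext)
    fix n
    have "cst (L ^ n) * (cst (of_int c ^ j / fact j) * h ((dW ^^ j) (A $ (n - j))))
       = cst (of_int c ^ j / fact j) * (dW ^^ j) (cst (L ^ (n - j)) * h (A $ (n - j)))" if "j \<le> n" for j
    proof -
      have "cst (L ^ n) = cst (L ^ (n - j)) * cst (L ^ j)"
        using that by (simp only: cst_mult[symmetric] power_add[symmetric]) simp
      then show ?thesis by (simp only: dW_pow_cst_mult hWj mult.assoc mult.left_commute)
    qed
    then show "H (tshift c A) $ n = tshift c (H A) $ n"
      by (simp add: H_def tshift_def hsum h sum_distrib_left)
  qed
  define G where "G = fps_const (cst (1 / L)) * H F"
  have TG: "tshift n G = fps_const (cst (1 / L)) * tshift n (H F)" for n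
    unfolding G_def tshift_mult tshift_const by (subst dW_cst_taylor) simp_all
  have pwG: "jpow (\<lambda>n. tshift n G) (deg i) 0 (- 1) = fps_const (cst (1 / L ^ \<nu> i)) * H (jpow r (deg i) 0 (- 1))" for i
  proof -
    have "jpow (\<lambda>n. tshift n G) (deg i) 0 (- 1) = fps_const (cst (1 / L)) ^ \<nu> i * jpow (\<lambda>n. tshift n (H F)) (deg i) 0 (- 1)"
      unfolding TG by (rule jpow_scale) (use \<nu>[of i] in simp)
    also have "fps_const (cst (1 / L)) ^ \<nu> i = fps_const (cst (1 / L ^ \<nu> i))"
      by (simp only: fps_const_power cst_power[symmetric] power_one_over)
    also have "jpow (\<lambda>n. tshift n (H F)) (deg i) 0 (- 1) = H (jpow r (deg i) 0 (- 1))"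
      unfolding H_tshift[symmetric]
      by (rule jpow_hom[symmetric]) (simp_all add: H_add H_mult H_const[of 0, simplified h, simplified] H_const[of 1, simplified h, simplified])
    finally show ?thesis .
  qed
  have cc: "fps_const (cst (1 / L)) * fps_const (h (vv i)) = fps_const (vv i) * fps_const (cst (1 / L ^ \<nu> i))" for i
    unfolding fps_const_mult
  proof (rule arg_cong[of _ _ fps_const], rule sfun_eqI)
    fix x assume "x \<in> toda_dom"
    then show "ev (cst (1 / L) * h (vv i)) x = ev (vv i * cst (1 / L ^ \<nu> i)) x"
      using L by (simp add: vv_def h hS)
  qed
  have "St G = G + (\<Sum>i\<in>UNIV. fps_const (vv i) * (fps_const (cst (1 / L ^ \<nu> i)) * H (jpow r (deg i) 0 (- 1))))"
    unfolding St_def string_op_def diff_0 pwG tshift_0 ..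
  also have "\<dots> = fps_const (cst (1 / L)) * H (St F)"
  proof -
    have s2: "(\<Sum>i\<in>UNIV. f i) = f False + f True" for f :: "bool \<Rightarrow> sfun fps" by (simp add: UNIV_bool)
    show ?thesis
      unfolding St_def string_op_def s2
      by (simp only: tshift_0 H_add H_mult H_const G_def distrib_left mult.assoc[symmetric] cc diff_0)
  qed
  also have "\<dots> = fps_const (cst (1 / L) * (cst L * W))" by (simp only: St_F H_const fps_const_mult \<open>h W = cst L * W\<close>)
  also have "cst (1 / L) * (cst L * W) = W" by (rule sfun_eqI) (simp add: L)
  finally have "St G = St F" by (simp add: St_F)
  moreover have "G $ 0 = y"
  proof -
    have "cst (1 / L) * (cst L * y) = y" by (rule sfun_eqI) (simp add: L)
    then show ?thesis by (simp add: G_def H_def F_nth0 \<open>h y = cst L * y\<close> cst_1)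
  qed
  ultimately have GF: "G = F" using St_unique[of G F] F_nth0 by blast
  have "cst L * F $ m = cst L * G $ m" by (simp only: GF)
  also have "G $ m = cst (1 / L) * (cst (L ^ m) * h (F $ m))"
    by (simp add: G_def H_def)
  also have "cst L * (cst (1 / L) * (cst (L ^ m) * h (F $ m))) = cst (L ^ m) * h (F $ m)"
    by (rule sfun_eqI) (simp add: L)
  finally show ?thesis .
qed

end

subsection \<open>The leading term\<close>

definition sc :: "bool \<Rightarrow> real \<times> real \<times> real \<Rightarrow> real" where
  "sc i x = (if i then fst (snd x) else snd (snd x))"

lemma has_partial_sc: "has_partial e (sc i) (\<lambda>_. sc i e)" and has_partial_fst: "has_partial e fst (\<lambda>_. fst e)"
  unfolding has_partial_def sc_def by (cases i; auto intro!: derivative_eq_intros)+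

lemma continuous_sc: "continuous_on A (sc i)"
  unfolding sc_def by (cases i; auto intro!: continuous_intros)

lemma smooth_sc: "smooth (sc i)" and smooth_fst: "smooth fst"
proof -
  have *: "smooth u" if "continuous_on toda_dom u" "\<And>e. has_partial e u (\<lambda>_. c e)" for u c
  proof (rule ringgen_smooth[of "{u}"])
    show "\<exists>g'\<in>ringgen {u}. has_partial e g g'" if "g \<in> {u}" for g e
      by (rule bexI[of _ "\<lambda>_. c e"]) (use that \<open>\<And>e. has_partial e u (\<lambda>_. c e)\<close> in \<open>auto intro: ringgen.const\<close>)
  qed (use that in \<open>auto intro: ringgen.gen\<close>)
  show "smooth (sc i)" by (rule *[OF continuous_sc has_partial_sc])
  show "smooth fst" by (rule *[OF _ has_partial_fst]) (intro continuous_intros)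
qed

lemma sc_toda_dom: "x \<in> toda_dom \<Longrightarrow> sc i x \<le> 0" and fst_toda_dom: "x \<in> toda_dom \<Longrightarrow> fst x > 0"
  by (auto simp: toda_dom_def sc_def)

lemma sc_affine: "sc i (x + t *\<^sub>R e) = sc i x + t * sc i e"
  by (simp add: sc_def)

lemma ringgen_power: "u \<in> ringgen G \<Longrightarrow> (\<lambda>x. u x ^ n) \<in> ringgen G"
  by (induction n) (auto intro: ringgen.intros ringgen.const[of 1, simplified])

lemma ringgen_mono: "u \<in> ringgen G \<Longrightarrow> G \<subseteq> G' \<Longrightarrow> u \<in> ringgen G'"
  by (induction rule: ringgen.induct) (auto intro: ringgen.intros)

locale root =
  fixes \<nu> :: "bool \<Rightarrow> nat"
  assumes \<nu>: "\<And>i. \<nu> i \<ge> 1"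
begin

definition cc :: "bool \<Rightarrow> real" where "cc i = toda_const (\<nu> i)"

lemma cc_nonneg: "cc i \<ge> 0" by (simp add: cc_def toda_const_def)

definition P :: "real \<times> real \<times> real \<Rightarrow> real \<Rightarrow> real" where
  "P x a = a - (\<Sum>i\<in>UNIV. cc i * sc i x * a ^ \<nu> i)"

text \<open>The divided difference of \<open>P x\<close>. For nonnegative arguments it is at least
  1, as the times are nonpositive; this gives uniqueness, continuity and differentiability of the
  root up to the boundary.\<close>

definition Q :: "real \<times> real \<times> real \<Rightarrow> real \<Rightarrow> real \<Rightarrow> real" where
  "Q x a b = 1 - (\<Sum>i\<in>UNIV. cc i * sc i x * (\<Sum>j<\<nu> i. b ^ (\<nu> i - Suc j) * a ^ j))"

lemma P_diff: "P x a - P x b = (a - b) * Q x a b"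
proof -
  have "cc i * sc i x * a ^ \<nu> i - cc i * sc i x * b ^ \<nu> i
     = (a - b) * (cc i * sc i x * (\<Sum>j<\<nu> i. b ^ (\<nu> i - Suc j) * a ^ j))" for i
    unfolding right_diff_distrib[symmetric] power_diff_sumr2 by (simp add: mult.left_commute)
  from this[of True] this[of False] show ?thesis by (simp add: P_def Q_def UNIV_bool algebra_simps)
qed

lemma Q_ge_1:
  assumes "x \<in> toda_dom" "a \<ge> 0" "b \<ge> 0" shows "Q x a b \<ge> 1"
proof -
  have "cc i * sc i x * (\<Sum>j<\<nu> i. b ^ (\<nu> i - Suc j) * a ^ j) \<le> 0" for i
    using assms sc_toda_dom[OF assms(1), of i] cc_nonneg[of i]
    by (intro mult_nonpos_nonneg mult_nonneg_nonpos sum_nonneg) auto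
  then show ?thesis by (simp add: Q_def sum_nonpos)
qed

lemma P_unique:
  assumes "x \<in> toda_dom" "a \<ge> 0" "b \<ge> 0" "P x a = P x b" shows "a = b"
  using P_diff[of x a b] Q_ge_1[OF assms(1-3)] assms(4) by auto

lemma P_exists:
  assumes x: "x \<in> toda_dom" shows "\<exists>a. 0 < a \<and> a \<le> fst x \<and> P x a = fst x"
proof -
  have z: "(0 :: real) ^ \<nu> i = 0" for i using \<nu>[of i] by (simp add: power_0_left)
  have "P x 0 = 0" unfolding P_def z by simp
  moreover have "P x (fst x) \<ge> fst x"
  proof -
    have "cc i * sc i x * fst x ^ \<nu> i \<le> 0" for i
      using sc_toda_dom[OF x, of i] cc_nonneg[of i] fst_toda_dom[OF x]
      by (intro mult_nonpos_nonneg mult_nonneg_nonpos) auto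
    then show ?thesis by (simp add: P_def sum_nonpos)
  qed
  moreover have "continuous_on {0..fst x} (P x)" unfolding P_def[abs_def] by (intro continuous_intros)
  ultimately obtain a where a: "0 \<le> a" "a \<le> fst x" "P x a = fst x"
    using IVT'[of "P x" 0 "fst x" "fst x"] fst_toda_dom[OF x] by auto
  then have "a \<noteq> 0" using \<open>P x 0 = 0\<close> fst_toda_dom[OF x] by auto
  then show ?thesis using a by (intro exI[of _ a]) auto
qed

definition yr :: "real \<times> real \<times> real \<Rightarrow> real" where
  "yr x = (SOME a. 0 < a \<and> a \<le> fst x \<and> P x a = fst x)"

lemma yr: assumes "x \<in> toda_dom" shows "0 < yr x" "yr x \<le> fst x" "P x (yr x) = fst x"
  using someI_ex[OF P_exists[OF assms]] unfolding yr_def by blast+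

text \<open>The change of \<open>fst x - P x b\<close> when \<open>x\<close> moves by
  \<open>e\<close>; it is linear in \<open>e\<close>, which makes difference quotients of the root
  explicit.\<close>

definition num where "num e b = fst e + (\<Sum>i\<in>UNIV. cc i * sc i e * b ^ \<nu> i)" for e :: "real \<times> real \<times> real"

lemma yr_diff:
  assumes "x \<in> toda_dom" "x' \<in> toda_dom"
  shows "(yr x' - yr x) * Q x' (yr x') (yr x) = num (x' - x) (yr x)"
proof -
  have "(yr x' - yr x) * Q x' (yr x') (yr x) = P x' (yr x') - P x' (yr x)" by (simp add: P_diff)
  also have "\<dots> = fst x' - fst x + (P x (yr x) - P x' (yr x))" using yr[OF assms(1)] yr[OF assms(2)] by simp
  also have "\<dots> = num (x' - x) (yr x)"
    by (simp add: P_def num_def UNIV_bool sc_def algebra_simps)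
  finally show ?thesis .
qed

lemma yr_tendsto: assumes x: "x \<in> toda_dom" shows "(yr \<longlongrightarrow> yr x) (at x within toda_dom)"
proof -
  have lim0: "((\<lambda>x'. num (x' - x) (yr x)) \<longlongrightarrow> num (x - x) (yr x)) (at x within toda_dom)"
    unfolding num_def sc_def UNIV_bool by (auto intro!: tendsto_eq_intros)
  have 0: "((\<lambda>x'. num (x' - x) (yr x)) \<longlongrightarrow> 0) (at x within toda_dom)"
  proof -
    have "num (x - x) (yr x) = 0" by (simp add: num_def sc_def fst_zero snd_zero cong: if_cong)
    then show "?thesis" using lim0 by (simp only:)
  qed
  have "\<forall>\<^sub>F x' in at x within toda_dom. norm (yr x' - yr x) \<le> norm (num (x' - x) (yr x))"
    unfolding eventually_at_filter
  proof (intro always_eventually allI impI)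
    fix x' assume x': "x' \<in> toda_dom"
    have "Q x' (yr x') (yr x) \<ge> 1" by (rule Q_ge_1[OF x']) (use yr[OF x] yr[OF x'] in auto)
    then have "\<bar>yr x' - yr x\<bar> * 1 \<le> \<bar>yr x' - yr x\<bar> * \<bar>Q x' (yr x') (yr x)\<bar>"
      by (intro mult_left_mono) auto
    then show "norm (yr x' - yr x) \<le> norm (num (x' - x) (yr x))"
      unfolding yr_diff[OF x x', symmetric] by (simp add: abs_mult)
  qed
  from Lim_null_comparison[OF this tendsto_norm_zero[OF 0]] show ?thesis by (simp add: LIM_zero_iff)
qed

lemma continuous_yr: "continuous_on toda_dom yr"
  unfolding continuous_on_def using yr_tendsto by blast

definition denr where "denr x = 1 - (\<Sum>i\<in>UNIV. cc i * real (\<nu> i) * sc i x * yr x ^ (\<nu> i - 1))"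
definition dlr where "dlr x = inverse (denr x)"

lemma Q_diag: "Q x (yr x) (yr x) = denr x"
proof -
  have "(\<Sum>j<n. b ^ (n - Suc j) * b ^ j) = real n * b ^ (n - 1)" for n and b :: real
  proof -
    have "(\<Sum>j<n. b ^ (n - Suc j) * b ^ j) = (\<Sum>j<n. b ^ (n - 1))"
      by (intro sum.cong) (auto simp: power_add[symmetric])
    then show ?thesis by simp
  qed
  then show ?thesis by (simp add: Q_def denr_def mult.assoc mult.left_commute)
qed

lemma denr: "x \<in> toda_dom \<Longrightarrow> denr x \<ge> 1"
  using Q_ge_1[of x "yr x" "yr x"] yr[of x] by (simp add: Q_diag)

lemma has_partial_yr: "has_partial e yr (\<lambda>x. num e (yr x) * dlr x)"
  unfolding has_partial_def
proof
  fix x assume x: "x \<in> toda_dom"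
  let ?S = "{t. x + t *\<^sub>R e \<in> toda_dom}"
  have lim: "((\<lambda>t. x + t *\<^sub>R e) \<longlongrightarrow> x) (at 0 within ?S)" by (auto intro!: tendsto_eq_intros)
  have lim': "((\<lambda>t. yr (x + t *\<^sub>R e)) \<longlongrightarrow> yr x) (at 0 within ?S)"
    by (rule continuous_on_tendsto_compose[OF continuous_yr lim x]) (simp add: eventually_at_filter)
  have "((\<lambda>t. Q (x + t *\<^sub>R e) (yr (x + t *\<^sub>R e)) (yr x)) \<longlongrightarrow> Q x (yr x) (yr x)) (at 0 within ?S)"
    unfolding Q_def sc_affine by (auto intro!: tendsto_eq_intros lim')
  then have "((\<lambda>t. num e (yr x) / Q (x + t *\<^sub>R e) (yr (x + t *\<^sub>R e)) (yr x)) \<longlongrightarrow> num e (yr x) / denr x) (at 0 within ?S)"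
    unfolding Q_diag using denr[OF x] by (intro tendsto_intros) auto
  then have "((\<lambda>t. (yr (x + t *\<^sub>R e) - yr (x + 0 *\<^sub>R e)) / (t - 0)) \<longlongrightarrow> num e (yr x) / denr x) (at 0 within ?S)"
  proof (rule Lim_transform_eventually)
    show "\<forall>\<^sub>F t in at 0 within ?S. num e (yr x) / Q (x + t *\<^sub>R e) (yr (x + t *\<^sub>R e)) (yr x)
        = (yr (x + t *\<^sub>R e) - yr (x + 0 *\<^sub>R e)) / (t - 0)"
      unfolding eventually_at_filter
    proof (intro always_eventually allI impI)
      fix t assume t: "t \<noteq> 0" "t \<in> ?S"
      then have x': "x + t *\<^sub>R e \<in> toda_dom" by simp
      have q: "Q (x + t *\<^sub>R e) (yr (x + t *\<^sub>R e)) (yr x) \<ge> 1"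
        by (rule Q_ge_1[OF x']) (use yr[OF x] yr[OF x'] in auto)
      have "num (t *\<^sub>R e) (yr x) = t * num e (yr x)"
        by (simp add: num_def sc_def UNIV_bool algebra_simps)
      then have "(yr (x + t *\<^sub>R e) - yr x) * Q (x + t *\<^sub>R e) (yr (x + t *\<^sub>R e)) (yr x) = t * num e (yr x)"
        using yr_diff[OF x x'] by simp
      then show "num e (yr x) / Q (x + t *\<^sub>R e) (yr (x + t *\<^sub>R e)) (yr x) = (yr (x + t *\<^sub>R e) - yr (x + 0 *\<^sub>R e)) / (t - 0)"
        using q t by (simp add: field_simps)
    qed
  qed
  then show "((\<lambda>t. yr (x + t *\<^sub>R e)) has_real_derivative num e (yr x) * dlr x) (at 0 within ?S)"
    by (simp add: has_field_derivative_iff dlr_def divide_inverse)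
qed

text \<open>The ring generated by these is closed under derivatives: the root has derivative
  \<open>num e (yr x) * dlr x\<close>, and \<open>dlr\<close> has \<open>- d * dlr^2\<close> with
  \<open>d\<close> the derivative of \<open>denr\<close>.\<close>

definition gens where "gens = {sc True, sc False, yr, dlr}"

lemma num_ringgen: "(\<lambda>x. num e (yr x)) \<in> ringgen gens"
  unfolding num_def UNIV_bool
  by (simp, intro ringgen.add ringgen.const ringgen.mult ringgen_power ringgen.gen) (simp_all add: gens_def)

lemma denr_ringgen: "denr \<in> ringgen {sc True, sc False, yr}"
proof -
  have "denr = (\<lambda>x. 1 + ((- (cc True * real (\<nu> True))) * sc True x * yr x ^ (\<nu> True - 1)
      + (- (cc False * real (\<nu> False))) * sc False x * yr x ^ (\<nu> False - 1)))"
    by (rule ext) (simp add: denr_def UNIV_bool algebra_simps)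
  moreover have "\<dots> \<in> ringgen {sc True, sc False, yr}"
    by (intro ringgen.add ringgen.const ringgen.mult ringgen_power ringgen.gen) simp_all
  ultimately show ?thesis by simp
qed

lemma has_partial_gens0: "u \<in> ringgen {sc True, sc False, yr} \<Longrightarrow> \<exists>u'\<in>ringgen gens. has_partial e u u'"
proof (induction rule: ringgen.induct)
  case (gen g)
  have "has_partial e (sc i) (\<lambda>_. sc i e)" "(\<lambda>_. sc i e) \<in> ringgen gens" for i
    by (rule has_partial_sc, rule ringgen.const)
  moreover have "(\<lambda>x. num e (yr x) * dlr x) \<in> ringgen gens"
    by (intro ringgen.mult num_ringgen ringgen.gen) (simp add: gens_def)
  ultimately show ?case using gen has_partial_yr[of e] by blast
next
  case (const c)
  show ?case by (rule bexI[of _ "\<lambda>_. 0"]) (rule has_partial_const, rule ringgen.const)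
next
  case (add u v)
  then obtain u' v' where "u' \<in> ringgen gens" "has_partial e u u'" "v' \<in> ringgen gens" "has_partial e v v'" by blast
  then show ?case by (intro bexI[of _ "\<lambda>x. u' x + v' x"] has_partial_add ringgen.add)
next
  case (mult u v)
  then obtain u' v' where uv: "u' \<in> ringgen gens" "has_partial e u u'" "v' \<in> ringgen gens" "has_partial e v v'" by blast
  have "u \<in> ringgen gens" "v \<in> ringgen gens" using mult.hyps ringgen_mono by (auto simp: gens_def)
  then show ?case using uv by (intro bexI[of _ "\<lambda>x. u' x * v x + u x * v' x"] has_partial_mult ringgen.add ringgen.mult)
qed

lemma smooth_gens: assumes "u \<in> ringgen gens" shows "smooth u"
proof (rule ringgen_smooth[OF _ _ assms])
  have dc: "continuous_on toda_dom denr"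
    unfolding denr_def[abs_def] by (intro continuous_intros continuous_sc continuous_yr)
  fix g assume g: "g \<in> gens"
  show "continuous_on toda_dom g"
  proof (cases "g = dlr")
    case True
    have "continuous_on toda_dom dlr" unfolding dlr_def[abs_def]
      by (intro continuous_on_inverse dc) (use denr in fastforce)
    then show ?thesis using True by simp
  qed (use g continuous_sc continuous_yr in \<open>auto simp: gens_def\<close>)
  fix e :: "real \<times> real \<times> real"
  show "\<exists>g'\<in>ringgen gens. has_partial e g g'"
  proof (cases "g = dlr")
    case True
    obtain d where d: "d \<in> ringgen gens" "has_partial e denr d" using has_partial_gens0[OF denr_ringgen] by blast
    have "has_partial e dlr (\<lambda>x. (- 1) * (d x * (dlr x * dlr x)))"
      unfolding has_partial_def
    proof
      fix x assume x: "x \<in> toda_dom"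
      have "((\<lambda>t. denr (x + t *\<^sub>R e)) has_real_derivative d x) (at 0 within {t. x + t *\<^sub>R e \<in> toda_dom})"
        using d(2) x by (simp add: has_partial_def)
      from DERIV_inverse_fun[OF this] denr[OF x]
      show "((\<lambda>t. dlr (x + t *\<^sub>R e)) has_real_derivative (- 1) * (d x * (dlr x * dlr x))) (at 0 within {t. x + t *\<^sub>R e \<in> toda_dom})"
        by (simp add: dlr_def divide_inverse power2_eq_square numeral_2_eq_2 mult.assoc)
    qed
    moreover have "(\<lambda>x. (- 1) * (d x * (dlr x * dlr x))) \<in> ringgen gens"
      by (intro ringgen.mult ringgen.const d ringgen.gen) (simp_all add: gens_def)
    ultimately show ?thesis using True by blast
  next
    case False
    then have "g \<in> ringgen {sc True, sc False, yr}" using g by (auto simp: gens_def intro: ringgen.gen)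
    then show ?thesis by (rule has_partial_gens0)
  qed
qed

lemma smooth_yr: "smooth yr" and smooth_dlr: "smooth dlr"
  by (rule smooth_gens, rule ringgen.gen, simp add: gens_def)+

lemma mk_sfun_deriv: "smooth u \<Longrightarrow> smooth u' \<Longrightarrow> e \<in> Dirs \<Longrightarrow> has_partial e u u' \<Longrightarrow> partial e (mk_sfun u) = mk_sfun u'"
  by (rule partial_eqI) (auto intro: has_partial_cong[of u _ u' _ e] simp: ev_mk_sfun)

lemma mk_sfun_const: "mk_sfun (\<lambda>_. c) = cst c"
  by (rule sfun_eqI) (simp add: ev_mk_sfun smooth_const)

sublocale toda_formal \<nu> "\<lambda>i. mk_sfun (sc i)" "mk_sfun fst" "mk_sfun yr" "mk_sfun dlr"
proof
  have eWS: "sc i eW = 0" "sc i (eS j) = of_bool (i = j)" "fst eW = 1" "fst (eS j) = 0" for i j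
    by (auto simp: sc_def eW_def eS_def)
  show "dW (mk_sfun (sc i)) = 0" "dS j (mk_sfun (sc i)) = of_bool (j = i)" for i j
    using mk_sfun_deriv[OF smooth_sc smooth_const eW_Dirs has_partial_sc] mk_sfun_deriv[OF smooth_sc smooth_const eS_Dirs has_partial_sc]
    by (auto simp: eWS mk_sfun_const cst_0 cst_1)
  show "dW (mk_sfun fst) = 1" "dS i (mk_sfun fst) = 0" for i
    using mk_sfun_deriv[OF smooth_fst smooth_const eW_Dirs has_partial_fst] mk_sfun_deriv[OF smooth_fst smooth_const eS_Dirs has_partial_fst]
    by (auto simp: eWS mk_sfun_const cst_0 cst_1)
  show "mk_sfun yr - (\<Sum>i\<in>UNIV. cst (toda_const (\<nu> i)) * mk_sfun (sc i) * mk_sfun yr ^ \<nu> i) = mk_sfun fst"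
  proof (rule sfun_eqI)
    fix x assume x: "x \<in> toda_dom"
    show "ev (mk_sfun yr - (\<Sum>i\<in>UNIV. cst (toda_const (\<nu> i)) * mk_sfun (sc i) * mk_sfun yr ^ \<nu> i)) x = ev (mk_sfun fst) x"
      using yr(3)[OF x] x by (simp add: ev_sum ev_mk_sfun smooth_yr smooth_sc smooth_fst P_def cc_def)
  qed
  show "mk_sfun dlr * (1 - (\<Sum>i\<in>UNIV. cst (toda_const (\<nu> i) * real (\<nu> i)) * mk_sfun (sc i) * mk_sfun yr ^ (\<nu> i - 1))) = 1"
  proof (rule sfun_eqI)
    fix x assume x: "x \<in> toda_dom"
    have "dlr x * denr x = 1" using denr[OF x] by (simp add: dlr_def)
    then show "ev (mk_sfun dlr * (1 - (\<Sum>i\<in>UNIV. cst (toda_const (\<nu> i) * real (\<nu> i)) * mk_sfun (sc i) * mk_sfun yr ^ (\<nu> i - 1)))) x = ev 1 x"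
      using x by (simp add: ev_sum ev_mk_sfun smooth_yr smooth_sc smooth_dlr denr_def cc_def)
  qed
qed (rule \<nu>)

section \<open>Scaling of the space variable and the times\<close>

definition \<sigma> :: "real \<Rightarrow> real \<times> real \<times> real \<Rightarrow> real \<times> real \<times> real" where
  "\<sigma> L x = (L * fst x, L / L ^ \<nu> True * sc True x, L / L ^ \<nu> False * sc False x)"

lemma \<sigma>_toda_dom: "L > 0 \<Longrightarrow> x \<in> toda_dom \<Longrightarrow> \<sigma> L x \<in> toda_dom"
proof -
  assume L: "L > 0" and x: "x \<in> toda_dom"
  have "L / L ^ n * s \<le> 0" if "s \<le> 0" for n s using L that by (intro mult_nonneg_nonpos) auto
  then show "\<sigma> L x \<in> toda_dom" using L sc_toda_dom[OF x] fst_toda_dom[OF x] unfolding \<sigma>_def toda_dom_def by simp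
qed

lemma has_partial_\<sigma>:
  assumes L: "L > 0" and e: "e \<in> Dirs" and k: "\<And>x t. \<sigma> L (x + t *\<^sub>R e) = \<sigma> L x + (k * t) *\<^sub>R e"
  shows "has_partial e (\<lambda>x. ev u (\<sigma> L x)) (\<lambda>x. k * ev (partial e u) (\<sigma> L x))"
  unfolding has_partial_def
proof
  fix x assume x: "x \<in> toda_dom"
  let ?S = "{t. x + t *\<^sub>R e \<in> toda_dom}"
  have "((\<lambda>t. ev u (\<sigma> L x + t *\<^sub>R e)) has_real_derivative ev (partial e u) (\<sigma> L x)) (at 0 within {t. \<sigma> L x + t *\<^sub>R e \<in> toda_dom})"
    using has_partial_partial[OF e, of u] \<sigma>_toda_dom[OF L x] by (simp add: has_partial_def)
  then have "((\<lambda>t. ev u (\<sigma> L x + t *\<^sub>R e)) has_real_derivative ev (partial e u) (\<sigma> L x)) (at (k * 0) within (\<lambda>t. k * t) ` ?S)"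
  proof (subst mult_zero_right, rule has_field_derivative_subset)
    show "(\<lambda>t. k * t) ` ?S \<subseteq> {t. \<sigma> L x + t *\<^sub>R e \<in> toda_dom}"
    proof (rule image_subsetI)
      fix t assume "t \<in> ?S"
      then have "\<sigma> L (x + t *\<^sub>R e) \<in> toda_dom" by (intro \<sigma>_toda_dom L) simp
      then show "k * t \<in> {t. \<sigma> L x + t *\<^sub>R e \<in> toda_dom}" by (simp only: k mem_Collect_eq)
    qed
  qed
  moreover have "((\<lambda>t. k * t) has_real_derivative k) (at 0 within ?S)" by (auto intro!: derivative_eq_intros)
  ultimately have "((\<lambda>t. ev u (\<sigma> L x + t *\<^sub>R e)) \<circ> (\<lambda>t. k * t) has_real_derivative ev (partial e u) (\<sigma> L x) * k) (at 0 within ?S)"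
    by (rule DERIV_image_chain)
  then show "((\<lambda>t. ev u (\<sigma> L (x + t *\<^sub>R e))) has_real_derivative k * ev (partial e u) (\<sigma> L x)) (at 0 within ?S)"
    by (simp add: k o_def mult.commute)
qed

lemma \<sigma>_shift: "e \<in> Dirs \<Longrightarrow> \<exists>k. \<forall>x t. \<sigma> L (x + t *\<^sub>R e) = \<sigma> L x + (k * t) *\<^sub>R e"
proof (erule Dirs_cases)
  show "e = (1, 0, 0) \<Longrightarrow> ?thesis" by (intro exI[of _ L]) (simp add: \<sigma>_def sc_def algebra_simps)
  show "e = (0, 1, 0) \<Longrightarrow> ?thesis" by (intro exI[of _ "L / L ^ \<nu> True"]) (simp add: \<sigma>_def sc_def algebra_simps add_divide_distrib)
  show "e = (0, 0, 1) \<Longrightarrow> ?thesis" by (intro exI[of _ "L / L ^ \<nu> False"]) (simp add: \<sigma>_def sc_def algebra_simps add_divide_distrib)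
qed

lemma smooth_\<sigma>: assumes L: "L > 0" shows "smooth (\<lambda>x. ev u (\<sigma> L x))"
proof -
  define G where "G = {\<lambda>x. ev u (\<sigma> L x) | u. True}"
  have "smooth g" if "g \<in> ringgen G" for g
  proof (rule ringgen_smooth[OF _ _ that])
    fix g assume "g \<in> G"
    then obtain u where g: "g = (\<lambda>x. ev u (\<sigma> L x))" by (auto simp: G_def)
    show "continuous_on toda_dom g" unfolding g
    proof (rule continuous_on_compose2[OF continuous_on_ev])
      show "continuous_on toda_dom (\<sigma> L)" unfolding \<sigma>_def[abs_def] by (intro continuous_intros continuous_sc)
      show "\<sigma> L ` toda_dom \<subseteq> toda_dom" using \<sigma>_toda_dom[OF L] by blast
    qed
    fix e assume e: "e \<in> Dirs"
    obtain k where "\<And>x t. \<sigma> L (x + t *\<^sub>R e) = \<sigma> L x + (k * t) *\<^sub>R e" using \<sigma>_shift[OF e] by blast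
    from has_partial_\<sigma>[OF L e this, of u] have "has_partial e g (\<lambda>x. k * ev (partial e u) (\<sigma> L x))" by (simp add: g)
    moreover have "(\<lambda>x. k * ev (partial e u) (\<sigma> L x)) \<in> ringgen G"
      by (intro ringgen.mult ringgen.const ringgen.gen) (auto simp: G_def)
    ultimately show "\<exists>g'\<in>ringgen G. has_partial e g g'" by blast
  qed
  moreover have "(\<lambda>x. ev u (\<sigma> L x)) \<in> ringgen G" by (rule ringgen.gen) (auto simp: G_def)
  ultimately show ?thesis by blast
qed

lemma yr_\<sigma>: assumes "L > 0" "x \<in> toda_dom" shows "yr (\<sigma> L x) = L * yr x"
proof (rule P_unique[OF \<sigma>_toda_dom[OF assms]])
  have "P (\<sigma> L x) (L * yr x) = L * P x (yr x)"
    using assms(1) by (simp add: P_def \<sigma>_def sc_def UNIV_bool power_mult_distrib algebra_simps)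
  then show "P (\<sigma> L x) (yr (\<sigma> L x)) = P (\<sigma> L x) (L * yr x)"
    using yr(3)[OF assms(2)] yr(3)[OF \<sigma>_toda_dom[OF assms]] by (simp add: \<sigma>_def)
qed (use yr[OF \<sigma>_toda_dom[OF assms]] yr[OF assms(2)] assms in auto)

lemma F_homogeneous:
  assumes L: "L > 0" and x: "x \<in> toda_dom"
  shows "L * ev (F $ m) x = L ^ m * ev (F $ m) (\<sigma> L x)"
proof -
  define h where "h u = mk_sfun (\<lambda>x. ev u (\<sigma> L x))" for u
  have ev_h: "ev (h u) x = ev u (\<sigma> L x)" if "x \<in> toda_dom" for u x
    unfolding h_def by (rule ev_mk_sfun[OF smooth_\<sigma>[OF L] that])
  have "cst L * F $ m = cst (L ^ m) * h (F $ m)"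
  proof (rule homogeneous)
    show "dW (h u) = cst L * h (dW u)" for u
    proof (rule partial_eqI)
      have "has_partial eW (\<lambda>x. ev u (\<sigma> L x)) (\<lambda>x. L * ev (dW u) (\<sigma> L x))"
        by (rule has_partial_\<sigma>[OF L eW_Dirs]) (simp add: \<sigma>_def sc_def eW_def algebra_simps)
      then show "has_partial eW (ev (h u)) (ev (cst L * h (dW u)))"
        by (rule has_partial_cong[rotated 2]) (simp_all add: ev_h)
    qed simp
  qed (use L in \<open>auto intro!: sfun_eqI simp: ev_h \<sigma>_toda_dom[OF L] ev_mk_sfun smooth_fst smooth_yr smooth_sc yr_\<sigma>[OF L], auto simp: \<sigma>_def sc_def\<close>)
  then have "ev (cst L * F $ m) x = ev (cst (L ^ m) * h (F $ m)) x" by simp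
  then show ?thesis using x by (simp add: ev_h)
qed

end

subsection \<open>Asymptotic expansions of the truncated formal solution\<close>

locale root_at = root +
  fixes s1 s2 :: real
  assumes s: "s1 \<le> 0" "s2 \<le> 0"
begin

definition pt :: "sfun \<Rightarrow> real \<Rightarrow> real" where "pt u w = ev u (w, s1, s2)"

lemma toda_dom_at: "w > 0 \<Longrightarrow> (w, s1, s2) \<in> toda_dom" using s by (simp add: toda_dom_def)

text \<open>The interval exceeds \<open>[1/2, 3/2]\<close> by 1/4 at both ends, room for shifts by
  \<open>n / k\<close> once \<open>k\<close> is large.\<close>

lemma pt_bounded: "\<exists>B>0. \<forall>w\<in>{1/4..7/4}. \<bar>pt u w\<bar> \<le> B"
proof -
  have "continuous_on {1/4..7/4} (pt u)"
    unfolding pt_def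
    by (rule continuous_on_compose2[OF continuous_on_ev[of u]]) (auto intro!: continuous_intros toda_dom_at)
  then have "bounded (pt u ` {1/4..7/4})"
    by (intro compact_imp_bounded compact_continuous_image) auto
  then show ?thesis unfolding bounded_pos by auto
qed

text \<open>\<open>has_expansion M X A\<close>: the function \<open>X\<close> of \<open>k\<close> and \<open>w\<close> has the expansion \<open>\<Sum> A\<^sub>m(w) k\<^bsup>-m\<^esup>\<close> up to
  order \<open>k\<^bsup>-M\<^esup>\<close>, uniformly for \<open>w\<close> in a neighbourhood of \<open>1\<close>.\<close>

definition has_expansion :: "nat \<Rightarrow> (nat \<Rightarrow> real \<Rightarrow> real) \<Rightarrow> sfun fps \<Rightarrow> bool" where
  "has_expansion M X A \<longleftrightarrow> (\<exists>C k0. \<forall>k\<ge>k0. \<forall>w\<in>{1/2..3/2}. \<bar>X k w - (\<Sum>m<M. pt (A $ m) w / real k ^ m)\<bar> \<le> C / real k ^ M)"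

lemma has_expansionI:
  assumes "\<And>k w. k \<ge> K \<Longrightarrow> w \<in> {1/2..3/2} \<Longrightarrow> \<bar>X k w - (\<Sum>m<M. pt (A $ m) w / real k ^ m)\<bar> \<le> C / real k ^ M"
  shows "has_expansion M X A"
  using assms unfolding has_expansion_def by blast

lemma has_expansionE:
  assumes "has_expansion M X A"
  shows "\<exists>C>0. \<exists>k0\<ge>1. \<forall>k\<ge>k0. \<forall>w\<in>{1/2..3/2}. \<bar>X k w - (\<Sum>m<M. pt (A $ m) w / real k ^ m)\<bar> \<le> C / real k ^ M"
proof -
  obtain C k0 where C: "\<forall>k\<ge>k0. \<forall>w\<in>{1/2..3/2}. \<bar>X k w - (\<Sum>m<M. pt (A $ m) w / real k ^ m)\<bar> \<le> C / real k ^ M"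
    using assms unfolding has_expansion_def by blast
  have "\<bar>X k w - (\<Sum>m<M. pt (A $ m) w / real k ^ m)\<bar> \<le> max C 1 / real k ^ M" if "k \<ge> max k0 1" "w \<in> {1/2..3/2}" for k w
  proof -
    have "\<bar>X k w - (\<Sum>m<M. pt (A $ m) w / real k ^ m)\<bar> \<le> C / real k ^ M" using C that by simp
    also have "\<dots> \<le> max C 1 / real k ^ M" by (intro divide_right_mono) auto
    finally show ?thesis .
  qed
  then show ?thesis by (intro exI[of _ "max C 1"] conjI exI[of _ "max k0 1"]) auto
qed

lemma has_expansion_cong: assumes "\<And>m. m < M \<Longrightarrow> A $ m = B $ m" "has_expansion M X A" shows "has_expansion M X B"
  using assms unfolding has_expansion_def by simp

lemma pt_add: "pt (u + v) w = pt u w + pt v w" and pt_mult: "pt (u * v) w = pt u w * pt v w"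
  and pt_0[simp]: "pt 0 w = 0"
  by (simp_all add: pt_def)

lemma pt_sum: "pt (\<Sum>i\<in>I. f i) w = (\<Sum>i\<in>I. pt (f i) w)" by (simp add: pt_def ev_sum)

lemma has_expansion_add: assumes "has_expansion M X A" "has_expansion M Y B" shows "has_expansion M (\<lambda>k w. X k w + Y k w) (A + B)"
proof -
  obtain C k0 where "C > 0" "k0 \<ge> 1" and C: "\<And>k w. k \<ge> k0 \<Longrightarrow> w \<in> {1/2..3/2} \<Longrightarrow> \<bar>X k w - (\<Sum>m<M. pt (A $ m) w / real k ^ m)\<bar> \<le> C / real k ^ M"
    using has_expansionE[OF assms(1)] by blast
  obtain D k1 where "D > 0" "k1 \<ge> 1" and D: "\<And>k w. k \<ge> k1 \<Longrightarrow> w \<in> {1/2..3/2} \<Longrightarrow> \<bar>Y k w - (\<Sum>m<M. pt (B $ m) w / real k ^ m)\<bar> \<le> D / real k ^ M"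
    using has_expansionE[OF assms(2)] by blast
  show ?thesis
  proof (rule has_expansionI[where K = "max k0 k1" and C = "C + D"])
    fix k w assume k: "max k0 k1 \<le> k" and w: "w \<in> {1/2..3/2 :: real}"
    have "\<bar>X k w - (\<Sum>m<M. pt (A $ m) w / real k ^ m)\<bar> \<le> C / real k ^ M"
      "\<bar>Y k w - (\<Sum>m<M. pt (B $ m) w / real k ^ m)\<bar> \<le> D / real k ^ M"
      using k by (intro C D w; simp)+
    then show "\<bar>X k w + Y k w - (\<Sum>m<M. pt ((A + B) $ m) w / real k ^ m)\<bar> \<le> (C + D) / real k ^ M"
      unfolding fps_add_nth pt_add add_divide_distrib sum.distrib by linarith
  qed
qed

lemma has_expansion_zero: "has_expansion M (\<lambda>k w. 0) 0"
  by (rule has_expansionI[where K = 0 and C = 0]) simp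

lemma has_expansion_sum: "(\<And>i. i \<in> I \<Longrightarrow> has_expansion M (X i) (A i)) \<Longrightarrow> has_expansion M (\<lambda>k w. \<Sum>i\<in>I. X i k w) (\<Sum>i\<in>I. A i)"
  by (induction I rule: infinite_finite_induct) (simp_all add: has_expansion_zero has_expansion_add)

lemma trunc_bounded:
  "\<exists>B>0. \<forall>k\<ge>1. \<forall>w\<in>{1/4..7/4}. \<bar>\<Sum>m<M. pt (A $ m) w / real k ^ m\<bar> \<le> B"
proof -
  have "\<forall>m. \<exists>B>0. \<forall>w\<in>{1/4..7/4}. \<bar>pt (A $ m) w\<bar> \<le> B" using pt_bounded by blast
  then obtain B where B: "\<And>m. B m > 0" "\<And>m w. w \<in> {1/4..7/4} \<Longrightarrow> \<bar>pt (A $ m) w\<bar> \<le> B m" by metis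
  have "\<bar>\<Sum>m<M. pt (A $ m) w / real k ^ m\<bar> \<le> (\<Sum>m<M. B m) + 1" if k: "k \<ge> 1" and w: "w \<in> {1/4..7/4}" for k w
  proof -
    have "\<bar>\<Sum>m<M. pt (A $ m) w / real k ^ m\<bar> \<le> (\<Sum>m<M. \<bar>pt (A $ m) w / real k ^ m\<bar>)" by (rule sum_abs)
    also have "\<dots> \<le> (\<Sum>m<M. B m)"
    proof (rule sum_mono)
      fix m
      have "real k ^ m \<ge> 1" using k by simp
      then have "\<bar>pt (A $ m) w\<bar> / real k ^ m \<le> \<bar>pt (A $ m) w\<bar> / 1" using k by (intro divide_left_mono) auto
      then show "\<bar>pt (A $ m) w / real k ^ m\<bar> \<le> B m" using B(2)[OF w, of m] by (simp add: abs_divide)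
    qed
    finally show ?thesis by simp
  qed
  moreover have "(\<Sum>m<M. B m) + 1 > 0" by (intro add_nonneg_pos sum_nonneg) (auto intro: less_imp_le B(1))
  ultimately show ?thesis by blast
qed

lemma has_expansion_mult: assumes "has_expansion M X A" "has_expansion M Y B" shows "has_expansion M (\<lambda>k w. X k w * Y k w) (A * B)"
proof -
  obtain C k0 where C: "C > 0" "k0 \<ge> 1" "\<And>k w. k \<ge> k0 \<Longrightarrow> w \<in> {1/2..3/2} \<Longrightarrow> \<bar>X k w - (\<Sum>m<M. pt (A $ m) w / real k ^ m)\<bar> \<le> C / real k ^ M"
    using has_expansionE[OF assms(1)] by blast
  obtain D k1 where D: "D > 0" "k1 \<ge> 1" "\<And>k w. k \<ge> k1 \<Longrightarrow> w \<in> {1/2..3/2} \<Longrightarrow> \<bar>Y k w - (\<Sum>m<M. pt (B $ m) w / real k ^ m)\<bar> \<le> D / real k ^ M"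
    using has_expansionE[OF assms(2)] by blast
  obtain BA where BA: "BA > 0" "\<And>k w. k \<ge> 1 \<Longrightarrow> w \<in> {1/4..7/4} \<Longrightarrow> \<bar>\<Sum>m<M. pt (A $ m) w / real k ^ m\<bar> \<le> BA"
    using trunc_bounded by blast
  obtain BB where BB: "BB > 0" "\<And>k w. k \<ge> 1 \<Longrightarrow> w \<in> {1/4..7/4} \<Longrightarrow> \<bar>\<Sum>m<M. pt (B $ m) w / real k ^ m\<bar> \<le> BB"
    using trunc_bounded by blast
  \<comment> \<open>The products of total order at least \<open>M\<close> form \<open>k^(-M)\<close>
    times another truncated series, so \<open>trunc_bounded\<close> covers them.\<close>
  obtain BT where BT: "BT > 0" "\<And>k w. k \<ge> 1 \<Longrightarrow> w \<in> {1/4..7/4} \<Longrightarrow>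
      \<bar>\<Sum>m<M. pt (Abs_fps (\<lambda>m. \<Sum>i<M. if m + M - i < M then A $ i * B $ (m + M - i) else 0) $ m) w / real k ^ m\<bar> \<le> BT"
    using trunc_bounded by blast
  show ?thesis
  proof (rule has_expansionI[where K = "max k0 k1" and C = "C * (BB + D) + BA * D + BT"])
    fix k w assume k: "max k0 k1 \<le> k" and w: "w \<in> {1/2..3/2 :: real}"
    define a where "a = (\<Sum>m<M. pt (A $ m) w / real k ^ m)"
    define b where "b = (\<Sum>m<M. pt (B $ m) w / real k ^ m)"
    define e where "e = 1 / real k ^ M"
    have k1: "k \<ge> 1" using k C(2) by auto
    have e: "0 \<le> e" "e \<le> 1" using k1 by (simp_all add: e_def)
    have w': "w \<in> {1/4..7/4}" using w by auto
    have X: "\<bar>X k w - a\<bar> \<le> C * e"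
      using C(3)[OF _ w, of k] k by (simp only: a_def e_def) simp
    have Y: "\<bar>Y k w - b\<bar> \<le> D * e"
      using D(3)[OF _ w, of k] k by (simp only: b_def e_def) simp
    have ab: "\<bar>a\<bar> \<le> BA" "\<bar>b\<bar> \<le> BB" using BA(2)[OF k1 w'] BB(2)[OF k1 w'] by (auto simp: a_def b_def)
    have "D * e \<le> D" using D(1) e by (simp add: mult_left_le)
    then have "\<bar>Y k w\<bar> \<le> BB + D" using Y ab by linarith
    then have 1: "\<bar>(X k w - a) * Y k w\<bar> \<le> C * e * (BB + D)"
      unfolding abs_mult using X C(1) e by (intro mult_mono) auto
    have 2: "\<bar>a * (Y k w - b)\<bar> \<le> BA * (D * e)"
      unfolding abs_mult using Y ab BA(1) by (intro mult_mono) auto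
    let ?f = "\<lambda>i j. pt (A $ i) w * pt (B $ j) w / real k ^ (i + j)"
    have "a * b = (\<Sum>i<M. \<Sum>j<M. ?f i j)"
      unfolding a_def b_def sum_product by (simp add: power_add)
    also have "\<dots> = (\<Sum>(i,j)\<in>{..<M} \<times> {..<M}. ?f i j)" by (simp add: sum.cartesian_product)
    also have "\<dots> = (\<Sum>(i,j)\<in>{(i,j). i + j < M}. ?f i j) + (\<Sum>(i,j)\<in>{(i,j). i < M \<and> j < M \<and> M \<le> i + j}. ?f i j)"
    proof (subst sum.union_disjoint[symmetric])
      show "finite {(i,j). i + j < M}" by (rule finite_subset[of _ "{..<M} \<times> {..<M}"]) auto
      show "finite {(i,j). i < M \<and> j < M \<and> M \<le> i + j}" by (rule finite_subset[of _ "{..<M} \<times> {..<M}"]) auto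
      show "(\<Sum>(i,j)\<in>{..<M} \<times> {..<M}. ?f i j) = (\<Sum>(i,j)\<in>{(i,j). i + j < M} \<union> {(i,j). i < M \<and> j < M \<and> M \<le> i + j}. ?f i j)"
        by (rule sum.cong) auto
    qed auto
    also have "(\<Sum>(i,j)\<in>{(i,j). i + j < M}. ?f i j) = (\<Sum>m<M. pt ((A * B) $ m) w / real k ^ m)"
    proof -
      have "(\<Sum>(i,j)\<in>{(i,j). i + j < M}. ?f i j) = (\<Sum>m<M. \<Sum>i\<le>m. ?f i (m - i))"
        by (rule sum.triangle_reindex)
      also have "\<dots> = (\<Sum>m<M. pt ((A * B) $ m) w / real k ^ m)"
        by (intro sum.cong refl) (simp add: fps_mult_nth pt_sum pt_mult sum_divide_distrib atLeast0AtMost)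
      finally show ?thesis .
    qed
    also have "(\<Sum>(i,j)\<in>{(i,j). i < M \<and> j < M \<and> M \<le> i + j}. ?f i j)
      = e * (\<Sum>m<M. pt (Abs_fps (\<lambda>m. \<Sum>i<M. if m + M - i < M then A $ i * B $ (m + M - i) else 0) $ m) w / real k ^ m)"
    proof -
      have "(\<Sum>(i,j)\<in>{(i,j). i < M \<and> j < M \<and> M \<le> i + j}. ?f i j)
         = (\<Sum>(m,i)\<in>{(m,i). m < M \<and> i < M \<and> m + M - i < M}. ?f i (m + M - i))"
        by (rule sum.reindex_bij_witness[of _ "\<lambda>(m,i). (i, m + M - i)" "\<lambda>(i,j). (i + j - M, i)"]) auto
      also have "\<dots> = (\<Sum>(m,i)\<in>{..<M} \<times> {..<M}. if m + M - i < M then ?f i (m + M - i) else 0)"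
        by (rule sum.mono_neutral_cong_left) (auto split: if_splits)
      also have "\<dots> = (\<Sum>m<M. \<Sum>i<M. if m + M - i < M then ?f i (m + M - i) else 0)"
        by (simp add: sum.cartesian_product)
      also have "\<dots> = (\<Sum>m<M. e * (pt (\<Sum>i<M. if m + M - i < M then A $ i * B $ (m + M - i) else 0) w / real k ^ m))"
        unfolding pt_sum sum_divide_distrib sum_distrib_left
        by (intro sum.cong refl) (auto simp: e_def pt_mult power_add)
      finally show ?thesis by (simp add: sum_distrib_left)
    qed
    finally have 3: "\<bar>a * b - (\<Sum>m<M. pt ((A * B) $ m) w / real k ^ m)\<bar> \<le> e * BT"
      using BT(2)[OF k1 w'] e by (simp add: abs_mult mult_left_mono)
    have "X k w * Y k w - (\<Sum>m<M. pt ((A * B) $ m) w / real k ^ m)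
      = (X k w - a) * Y k w + a * (Y k w - b) + (a * b - (\<Sum>m<M. pt ((A * B) $ m) w / real k ^ m))"
      by (simp add: algebra_simps)
    also have "\<bar>\<dots>\<bar> \<le> C * e * (BB + D) + BA * (D * e) + e * BT"
      using 1 2 3 by linarith
    also have "\<dots> = (C * (BB + D) + BA * D + BT) / real k ^ M" by (simp add: e_def field_simps add_divide_distrib)
    finally show "\<bar>X k w * Y k w - (\<Sum>m<M. pt ((A * B) $ m) w / real k ^ m)\<bar> \<le> (C * (BB + D) + BA * D + BT) / real k ^ M" .
  qed
qed

lemma DERIV_pt: "w > 0 \<Longrightarrow> (pt u has_real_derivative pt (dW u) w) (at w)"
  using has_derivative_ev_W[OF _ s, of w u] unfolding pt_def[abs_def] .

lemma pt_cst[simp]: "w > 0 \<Longrightarrow> pt (cst c) w = c"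
  by (simp add: pt_def toda_dom_at)

lemma has_expansion_const: "has_expansion M (\<lambda>k w. pt u w) (fps_const u)"
proof (cases M)
  case 0
  obtain B where "\<forall>w\<in>{1/4..7/4}. \<bar>pt u w\<bar> \<le> B" using pt_bounded by blast
  then show ?thesis by (intro has_expansionI[where K = 0 and C = B]) (auto simp: 0)
next
  case (Suc M')
  have "(\<Sum>m<M. pt (fps_const u $ m) w / real k ^ m) = pt u w" for k w
    unfolding Suc sum.lessThan_Suc_shift by simp
  then show ?thesis by (intro has_expansionI[where K = 0 and C = 0]) simp
qed

lemma has_expansion_X: "has_expansion M (\<lambda>k w. 1 / real k) fps_X"
proof -
  have "\<bar>1 / real k - (\<Sum>m<M. pt (fps_X $ m) w / real k ^ m)\<bar> \<le> 1 / real k ^ M" if "k \<ge> 1" "w \<in> {1/2..3/2}" for k w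
  proof (cases "M \<ge> 2")
    case True
    have "(\<Sum>m<M. pt (fps_X $ m) w / real k ^ m) = (\<Sum>m<M. if m = 1 then 1 / real k else 0)"
      using that by (intro sum.cong) (auto simp: fps_X_def cst_1[symmetric])
    then show ?thesis using True by simp
  next
    case False
    then consider "M = 0" | "M = 1" by linarith
    then show ?thesis using that by cases simp_all
  qed
  then show ?thesis by (intro has_expansionI[where K = 1 and C = 1])
qed

lemma has_expansion_X_pow: "has_expansion M (\<lambda>k w. 1 / real k ^ n) (fps_X ^ n)"
proof (induction n)
  case 0
  have "has_expansion M (\<lambda>k w. pt (cst 1) w) 1" using has_expansion_const[of M "cst 1"] by (simp add: cst_1)
  then show ?case unfolding has_expansion_def by simp
next
  case (Suc n)
  then show ?case using has_expansion_mult[OF has_expansion_X Suc] by simp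
qed

lemma shift_small:
  assumes "nat (4 * \<bar>n\<bar>) + 1 \<le> k" shows "\<bar>of_int n / real k\<bar> \<le> 1 / 4"
proof -
  have "4 * \<bar>n\<bar> \<le> int k" using assms by linarith
  then have "4 * \<bar>of_int n\<bar> \<le> real k" by linarith
  then show ?thesis using assms by (simp add: abs_divide divide_le_eq)
qed

lemma has_expansion_taylor: "has_expansion M (\<lambda>k w. pt u (w + of_int n / real k)) (taylor n u)"
proof (cases M)
  case 0
  obtain B where B: "\<forall>w\<in>{1/4..7/4}. \<bar>pt u w\<bar> \<le> B" using pt_bounded by blast
  show ?thesis
  proof (rule has_expansionI[where K = "nat (4 * \<bar>n\<bar>) + 1" and C = B])
    fix k w assume k: "nat (4 * \<bar>n\<bar>) + 1 \<le> k" and w: "w \<in> {1/2..3/2 :: real}"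
    have "\<bar>of_int n / real k\<bar> \<le> 1 / 4" by (rule shift_small[OF k])
    then have "w + of_int n / real k \<in> {1/4..7/4}" using w by (simp only: atLeastAtMost_iff) linarith
    then show "\<bar>pt u (w + of_int n / real k) - (\<Sum>m<M. pt (taylor n u $ m) w / real k ^ m)\<bar> \<le> B / real k ^ M"
      using B 0 by simp
  qed
next
  case (Suc M')
  obtain B where B: "B > 0" "\<forall>w\<in>{1/4..7/4}. \<bar>pt ((dW ^^ M) u) w\<bar> \<le> B" using pt_bounded by blast
  show ?thesis
  proof (rule has_expansionI[where K = "nat (4 * \<bar>n\<bar>) + 1" and C = "B / fact M * \<bar>of_int n\<bar> ^ M"])
    fix k w assume k: "nat (4 * \<bar>n\<bar>) + 1 \<le> k" and w: "w \<in> {1/2..3/2 :: real}"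
    have w0: "w > 0" and k0: "k > 0" using w k by auto
    define h where "h = of_int n / real k"
    have h: "\<bar>h\<bar> \<le> 1 / 4" unfolding h_def by (rule shift_small[OF k])
    have tay: "(\<Sum>m<M. pt (taylor n u $ m) w / real k ^ m) = (\<Sum>m<M. pt ((dW ^^ m) u) w / fact m * h ^ m)"
      using w0 by (intro sum.cong) (simp_all add: taylor_def pt_mult h_def power_divide)
    have "\<bar>pt u (w + h) - (\<Sum>m<M. pt ((dW ^^ m) u) w / fact m * h ^ m)\<bar> \<le> B / fact M * \<bar>h\<bar> ^ M"
    proof (cases "h = 0")
      case True
      have "(\<Sum>m<M. pt ((dW ^^ m) u) w / fact m * h ^ m) = pt u w"
        unfolding Suc sum.lessThan_Suc_shift using True by simp
      then show ?thesis using True B by (simp add: Suc)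
    next
      case False
      have "\<exists>t. (if w + h < w then w + h < t \<and> t < w else w < t \<and> t < w + h) \<and>
         pt u (w + h) = (\<Sum>m<M. pt ((dW ^^ m) u) w / fact m * ((w + h) - w) ^ m) + pt ((dW ^^ M) u) t / fact M * ((w + h) - w) ^ M"
      proof (rule Taylor[where diff = "\<lambda>m. pt ((dW ^^ m) u)" and a = "1/4" and b = "7/4"])
        show "\<forall>m t. m < M \<and> 1 / 4 \<le> t \<and> t \<le> 7 / 4 \<longrightarrow> (pt ((dW ^^ m) u) has_real_derivative pt ((dW ^^ Suc m) u) t) (at t)"
          using DERIV_pt by simp
      qed (use w h False Suc in \<open>auto simp: abs_le_iff\<close>)
      then obtain t where t: "if w + h < w then w + h < t \<and> t < w else w < t \<and> t < w + h"
        "pt u (w + h) = (\<Sum>m<M. pt ((dW ^^ m) u) w / fact m * h ^ m) + pt ((dW ^^ M) u) t / fact M * h ^ M" by auto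
      have "t \<in> {1/4..7/4}" using t(1) w h by (auto simp: abs_le_iff split: if_splits)
      then have "\<bar>pt ((dW ^^ M) u) t\<bar> \<le> B" using B by blast
      then have "\<bar>pt ((dW ^^ M) u) t / fact M * h ^ M\<bar> \<le> B / fact M * \<bar>h\<bar> ^ M"
        by (simp add: abs_mult abs_divide power_abs) (intro mult_right_mono divide_right_mono; simp)
      then show ?thesis using t(2) by simp
    qed
    also have "B / fact M * \<bar>h\<bar> ^ M = B / fact M * \<bar>of_int n\<bar> ^ M / real k ^ M"
      by (simp add: h_def abs_divide power_divide)
    finally show "\<bar>pt u (w + of_int n / real k) - (\<Sum>m<M. pt (taylor n u $ m) w / real k ^ m)\<bar> \<le> B / fact M * \<bar>of_int n\<bar> ^ M / real k ^ M"
      unfolding tay h_def[symmetric] .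
  qed
qed

definition trunc :: "nat \<Rightarrow> nat \<Rightarrow> real \<Rightarrow> real" where
  "trunc M k w = (\<Sum>m<M. pt (F $ m) w / real k ^ m)"

text \<open>Coefficients of order below \<open>M\<close> of the shifted series involve only the
  first \<open>M\<close> coefficients of \<open>F\<close>, so truncation first and shift afterwards
  gives the same expansion.\<close>

lemma has_expansion_trunc: "has_expansion M (\<lambda>k w. trunc M k (w + of_int n / real k)) (r n)"
proof (rule has_expansion_cong)
  have "has_expansion M (\<lambda>k w. \<Sum>m<M. (1 / real k ^ m) * pt (F $ m) (w + of_int n / real k)) (\<Sum>m<M. fps_X ^ m * taylor n (F $ m))"
    by (intro has_expansion_sum has_expansion_mult has_expansion_X_pow has_expansion_taylor)
  then show "has_expansion M (\<lambda>k w. trunc M k (w + of_int n / real k)) (\<Sum>m<M. fps_X ^ m * taylor n (F $ m))"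
    by (simp add: trunc_def)
  fix p assume p: "p < M"
  have "(\<Sum>m<M. fps_X ^ m * taylor n (F $ m)) $ p = (\<Sum>m<M. if m \<le> p then taylor n (F $ m) $ (p - m) else 0)"
    by (simp add: fps_sum_nth fps_X_power_mult_nth) (intro sum.cong, auto)
  also have "\<dots> = (\<Sum>m\<le>p. taylor n (F $ m) $ (p - m))"
    by (rule sum.mono_neutral_cong_right) (use p in auto)
  also have "\<dots> = (\<Sum>j\<le>p. taylor n (F $ (p - j)) $ j)"
    by (rule sum.reindex_bij_witness[of _ "\<lambda>j. p - j" "\<lambda>j. p - j"]) auto
  also have "\<dots> = r n $ p" by (simp add: tshift_def taylor_def)
  finally show "(\<Sum>m<M. fps_X ^ m * taylor n (F $ m)) $ p = r n $ p" .
qed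

lemma has_expansion_jpow:
  assumes "\<And>n. has_expansion M (\<lambda>k w. X n k w) (A n)"
  shows "has_expansion M (\<lambda>k w. jpow (\<lambda>n. X n k w) p n m) (jpow A p n m)"
proof (induction p arbitrary: n)
  case 0
  have "has_expansion M (\<lambda>k w. 1) 1" using has_expansion_X_pow[of M 0] by simp
  then show ?case by (simp add: of_bool_def has_expansion_zero)
next
  case (Suc p)
  show ?case unfolding jpow.simps by (intro has_expansion_add has_expansion_mult Suc assms)
qed

definition vr :: "bool \<Rightarrow> real" where "vr i = - 2 * real (\<nu> i) * (if i then s1 else s2)"

lemma pt_vv: "w > 0 \<Longrightarrow> pt (vv i) w = vr i"
  unfolding vv_def vr_def pt_mult by (simp add: pt_def ev_mk_sfun smooth_sc toda_dom_at sc_def)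

text \<open>Sums and products respect expansions, so the truncation inherits the formal identity
  \<open>St F = W\<close> up to order \<open>M\<close>.\<close>

lemma has_expansion_string:
  "has_expansion M (\<lambda>k w. string_op UNIV vr deg (\<lambda>n. trunc M k (w + of_int n / real k)) 0) (fps_const (mk_sfun fst))"
proof -
  have "has_expansion M (\<lambda>k w. trunc M k (w + of_int 0 / real k)
     + (\<Sum>i\<in>UNIV. pt (vv i) w * jpow (\<lambda>n. trunc M k (w + of_int n / real k)) (deg i) 0 (- 1)))
     (r 0 + (\<Sum>i\<in>UNIV. fps_const (vv i) * jpow r (deg i) 0 (- 1)))"
    by (intro has_expansion_add has_expansion_sum has_expansion_mult has_expansion_const has_expansion_jpow has_expansion_trunc)
  moreover have "r 0 + (\<Sum>i\<in>UNIV. fps_const (vv i) * jpow r (deg i) 0 (- 1)) = fps_const (mk_sfun fst)"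
    using St_F by (simp add: St_def string_op_def)
  ultimately have "has_expansion M (\<lambda>k w. trunc M k (w + of_int 0 / real k)
     + (\<Sum>i\<in>UNIV. pt (vv i) w * jpow (\<lambda>n. trunc M k (w + of_int n / real k)) (deg i) 0 (- 1))) (fps_const (mk_sfun fst))"
    by (simp only:)
  then show ?thesis unfolding has_expansion_def string_op_def by (simp add: pt_vv)
qed

lemma trunc_string:
  assumes M: "M \<ge> 1"
  shows "\<exists>C k0. \<forall>k\<ge>k0. \<forall>l. int k \<le> 2 * l \<longrightarrow> 2 * l \<le> 3 * int k \<longrightarrow>
     \<bar>string_op UNIV vr deg (\<lambda>l. trunc M k (of_int l / real k)) l - of_int l / real k\<bar> \<le> C / real k ^ M"
proof -
  obtain C k0 where "C > 0" and k0: "k0 \<ge> 1" and C: "\<And>k w. k \<ge> k0 \<Longrightarrow> w \<in> {1/2..3/2} \<Longrightarrow>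
     \<bar>string_op UNIV vr deg (\<lambda>n. trunc M k (w + of_int n / real k)) 0 - (\<Sum>m<M. pt (fps_const (mk_sfun fst) $ m) w / real k ^ m)\<bar> \<le> C / real k ^ M"
    using has_expansionE[OF has_expansion_string[of M]] by blast
  show ?thesis
  proof (intro exI allI impI)
    fix k l assume k: "k0 \<le> k" and l: "int k \<le> 2 * l" "2 * l \<le> 3 * int k"
    define w where "w = of_int l / real k"
    have k1: "k > 0" using k k0 by simp
    have "real k \<le> 2 * of_int l" "2 * of_int l \<le> 3 * real k" using l by linarith+
    then have w: "w \<in> {1/2..3/2}" using k1 by (simp add: w_def field_simps)
    have wn: "w + of_int n / real k = of_int (n + l) / real k" for n by (simp add: w_def add_divide_distrib)
    have "string_op UNIV vr deg (\<lambda>n. trunc M k (w + of_int n / real k)) 0 = string_op UNIV vr deg (\<lambda>l. trunc M k (of_int l / real k)) l"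
      unfolding string_op_def wn jpow_shift[of "\<lambda>l. trunc M k (of_int l / real k)"] by simp
    moreover have "(\<Sum>m<M. pt (fps_const (mk_sfun fst) $ m) w / real k ^ m) = w"
    proof -
      have "(\<Sum>m<M. pt (fps_const (mk_sfun fst) $ m) w / real k ^ m) = (\<Sum>m<M. if m = 0 then pt (mk_sfun fst) w else 0)"
        by (intro sum.cong) auto
      also have "\<dots> = w" using M w by (simp add: pt_def ev_mk_sfun smooth_fst toda_dom_at)
      finally show ?thesis .
    qed
    ultimately show "\<bar>string_op UNIV vr deg (\<lambda>l. trunc M k (of_int l / real k)) l - of_int l / real k\<bar> \<le> C / real k ^ M"
      using C[OF k w] by (simp add: w_def)
  qed
qed

text \<open>The leading term is positive on a compact interval, and the rest is of order
  \<open>1/k\<close>.\<close>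

lemma trunc_bounds:
  assumes M: "M \<ge> 1"
  shows "\<exists>c B k0. 0 < c \<and> c \<le> B \<and> (\<forall>k\<ge>k0. \<forall>l. int k \<le> 2 * l \<longrightarrow> 2 * l \<le> 3 * int k \<longrightarrow>
     c \<le> trunc M k (of_int l / real k) \<and> trunc M k (of_int l / real k) \<le> B)"
proof -
  have pty: "pt (F $ 0) w = yr (w, s1, s2)" if "w > 0" for w
    using that by (simp add: F_nth0 pt_def ev_mk_sfun smooth_yr toda_dom_at)
  have "continuous_on {1/2..3/2} (pt (F $ 0))"
    unfolding pt_def
    by (rule continuous_on_compose2[OF continuous_on_ev[of "F $ 0"]]) (auto intro!: continuous_intros toda_dom_at)
  then obtain w0 where w0: "w0 \<in> {1/2..3/2}" "\<And>w. w \<in> {1/2..3/2} \<Longrightarrow> pt (F $ 0) w0 \<le> pt (F $ 0) w"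
    using continuous_attains_inf[of "{1/2..3/2 :: real}" "pt (F $ 0)"] by auto
  define c where "c = pt (F $ 0) w0"
  have c: "c > 0" using w0(1) yr(1)[OF toda_dom_at[of w0]] by (simp add: c_def pty)
  obtain M' where M': "M = Suc M'" using M by (cases M) auto
  obtain BB where BB: "BB > 0" "\<And>k w. k \<ge> 1 \<Longrightarrow> w \<in> {1/4..7/4} \<Longrightarrow> \<bar>\<Sum>m<M'. pt (fps_shift 1 F $ m) w / real k ^ m\<bar> \<le> BB"
    using trunc_bounded by blast
  obtain k1 :: nat where k1: "2 * BB / c \<le> real k1" using real_arch_simple by blast
  show ?thesis
  proof (intro exI conjI allI impI)
    show "0 < c / 2" "c / 2 \<le> max (c / 2) (3 / 2 + BB)" using c by auto
    fix k l assume k: "max k1 1 \<le> k" and l: "int k \<le> 2 * l" "2 * l \<le> 3 * int k"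
    define w where "w = of_int l / real k"
    have k1': "k > 0" using k by simp
    have "real k \<le> 2 * of_int l" "2 * of_int l \<le> 3 * real k" using l by linarith+
    then have w: "w \<in> {1/2..3/2}" using k1' by (simp add: w_def field_simps)
    define R where "R = (\<Sum>m<M'. pt (fps_shift 1 F $ m) w / real k ^ m)"
    have R: "\<bar>R\<bar> \<le> BB" unfolding R_def by (rule BB(2)) (use k w in auto)
    have tr: "trunc M k w = pt (F $ 0) w + R / real k"
      unfolding trunc_def M' sum.lessThan_Suc_shift R_def by (simp add: sum_divide_distrib mult.commute)
    have *: "\<bar>R / real k\<bar> \<le> c / 2"
    proof -
      have "2 * BB / c \<le> real k" using k1 k by linarith
      then have "BB \<le> c / 2 * real k" using c by (simp add: field_simps)
      then show ?thesis using R k1' by (simp add: abs_divide divide_le_eq)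
    qed
    moreover have "\<bar>R / real k\<bar> \<le> BB"
    proof -
      have "BB * 1 \<le> BB * real k" using BB(1) k1' by (intro mult_left_mono) auto
      then show ?thesis using R k1' by (simp add: abs_divide divide_le_eq)
    qed
    moreover have "c \<le> pt (F $ 0) w" using w0(2)[OF w] by (simp add: c_def)
    moreover have "pt (F $ 0) w \<le> 3 / 2" using yr(2)[OF toda_dom_at[of w]] w by (simp add: pty)
    ultimately have "c / 2 \<le> trunc M k w" "trunc M k w \<le> 3 / 2 + BB"
      unfolding tr by linarith+
    then have "c / 2 \<le> trunc M k w" "trunc M k w \<le> max (c / 2) (3 / 2 + BB)" by auto
    then show "c / 2 \<le> trunc M k (of_int l / real k)" "trunc M k (of_int l / real k) \<le> max (c / 2) (3 / 2 + BB)"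
      by (simp_all add: w_def)
  qed
qed

end

subsection \<open>The scheme for the coefficients\<close>

text \<open>Substituting \<open>h = \<epsilon>\<^sup>2\<close>.\<close>

definition chi :: "real fps fps \<Rightarrow> real fps" where
  "chi B = Abs_fps (\<lambda>m. \<Sum>i\<le>m. if even (m - i) then B $ i $ ((m - i) div 2) else 0)"

lemma chi_add: "chi (A + B) = chi A + chi B"
  by (rule fps_ext) (simp add: chi_def sum.distrib[symmetric], intro sum.cong, auto)

lemma chi_X: "chi (fps_X * A) = fps_X * chi A"
proof (rule fps_ext)
  fix n show "chi (fps_X * A) $ n = (fps_X * chi A) $ n"
  proof (cases n)
    case (Suc m)
    then show ?thesis unfolding Suc chi_def fps_nth_Abs_fps sum.atMost_Suc_shift by (simp cong: if_cong)
  qed (simp add: chi_def)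
qed

lemma chi_const_nth: "chi (fps_const b) $ m = (if even m then b $ (m div 2) else 0)"
proof -
  have "chi (fps_const b) $ m = (\<Sum>i\<le>m. if i = 0 then (if even m then b $ (m div 2) else 0) else 0)"
    unfolding chi_def fps_nth_Abs_fps by (intro sum.cong) auto
  then show ?thesis by simp
qed

lemma chi_const_mult: "chi (fps_const (a * b)) = chi (fps_const a) * chi (fps_const b)"
proof (rule fps_ext)
  fix m
  have "(chi (fps_const a) * chi (fps_const b)) $ m
     = (\<Sum>i\<in>{0..m}. if even i \<and> even (m - i) then a $ (i div 2) * b $ ((m - i) div 2) else 0)"
    unfolding fps_mult_nth chi_const_nth by (intro sum.cong) auto
  also have "\<dots> = (if even m then (a * b) $ (m div 2) else 0)"
  proof (cases "even m")
    case True
    then obtain k where k: "m = 2 * k" by (auto elim: evenE)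
    have "(\<Sum>i\<in>{0..m}. if even i \<and> even (m - i) then a $ (i div 2) * b $ ((m - i) div 2) else 0)
       = (\<Sum>i\<in>(\<lambda>j. 2 * j) ` {0..k}. a $ (i div 2) * b $ ((m - i) div 2))"
    proof (rule sum.mono_neutral_cong_right)
      show "\<forall>i\<in>{0..m} - (\<lambda>j. 2 * j) ` {0..k}. (if even i \<and> even (m - i) then a $ (i div 2) * b $ ((m - i) div 2) else 0) = 0"
        by (auto simp: k elim!: evenE)
    qed (auto simp: k)
    also have "\<dots> = (\<Sum>j\<in>{0..k}. a $ j * b $ (k - j))"
      by (subst sum.reindex) (auto simp: inj_on_def k diff_mult_distrib2[symmetric] intro!: sum.cong)
    finally show ?thesis using k by (simp add: fps_mult_nth)
  next
    case False
    then have "\<not> (even i \<and> even (m - i))" if "i \<in> {0..m}" for i using that by auto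
    then show ?thesis using False by (intro trans[OF sum.neutral]) auto
  qed
  finally show "chi (fps_const (a * b)) $ m = (chi (fps_const a) * chi (fps_const b)) $ m"
    by (simp add: chi_const_nth)
qed

lemma chi_mult: "chi (A * B) = chi A * chi B"
  by (rule fps_multiplicative[OF chi_add chi_X chi_const_mult])

lemma chi_0: "chi 0 = 0" by (rule fps_ext) (simp add: chi_def cong: if_cong)

lemma chi_1: "chi 1 = 1"
  by (rule fps_ext) (use chi_const_nth[of 1] in \<open>auto elim!: evenE\<close>)

lemma chi_diff: "chi (A - B) = chi A - chi B"
  using chi_add[of "A - B" B] by simp

text \<open>After the substitution, \<epsilon> to the power \<open>2 n + 1\<close> collects the
  monomials \<open>\<epsilon>^(2g+1) h^(n-g)\<close>, which is how the scheme groups the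
  \<open>F_g\<close> at order \<open>h^n\<close>.\<close>

lemma chi_odd: "chi B $ (2 * n + 1) = (\<Sum>g\<le>n. B $ (2 * g + 1) $ (n - g))"
proof -
  have "chi B $ (2 * n + 1) = (\<Sum>i\<in>(\<lambda>g. 2 * g + 1) ` {..n}. B $ i $ ((2 * n + 1 - i) div 2))"
    unfolding chi_def fps_nth_Abs_fps
  proof (rule sum.mono_neutral_cong_right)
    show "\<forall>i\<in>{..2 * n + 1} - (\<lambda>g. 2 * g + 1) ` {..n}. (if even (2 * n + 1 - i) then B $ i $ ((2 * n + 1 - i) div 2) else 0) = 0"
    proof
      fix i assume i: "i \<in> {..2 * n + 1} - (\<lambda>g. 2 * g + 1) ` {..n}"
      have "\<not> odd i"
      proof
        assume "odd i"
        then obtain g where "i = 2 * g + 1" by (auto elim: oddE)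
        then show False using i by auto
      qed
      then show "(if even (2 * n + 1 - i) then B $ i $ ((2 * n + 1 - i) div 2) else 0) = 0" using i by auto
    qed
  qed auto
  also have "\<dots> = (\<Sum>g\<le>n. B $ (2 * g + 1) $ (n - g))"
    by (subst sum.reindex) (auto simp: inj_on_def diff_mult_distrib2[symmetric] intro!: sum.cong)
  finally show ?thesis .
qed

text \<open>The generating series in \<epsilon> of the differential polynomials; its coefficient at
  \<open>g = 0\<close> is the leading term of the scheme.\<close>

definition toda_Y :: "nat \<Rightarrow> (nat \<Rightarrow> real fps) \<Rightarrow> real fps fps" where
  "toda_Y \<nu> a = jpow (taylor_shift a) (2 * \<nu>) 1 (- 1) - jpow (taylor_shift a) (2 * \<nu>) 0 (- 2)"

lemma diff_poly_Y: "diff_poly \<nu> g a = toda_Y \<nu> a $ (2 * g + 1)"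
  unfolding diff_poly_def toda_Y_def sum_subtractf
  using sum_down_steps[of "taylor_shift a" 1 \<nu>] sum_down_steps[of "taylor_shift a" 0 \<nu>]
  by (simp add: add.commute)

lemma djpow_shift: "djpow (\<lambda>l. r (l + c)) (\<lambda>l. \<rho> (l + c)) p n m = djpow r \<rho> p (n + c) (m + c)"
  by (induction p arbitrary: n) (simp_all add: jpow_shift algebra_simps)

lemma toda_const_eq: "\<nu> \<ge> 1 \<Longrightarrow> toda_const \<nu> = real ((\<nu> + 1) * ((2 * \<nu>) choose (\<nu> + 1)))"
proof -
  assume \<nu>: "\<nu> \<ge> 1"
  have "(\<nu> + 1) * ((2 * \<nu>) choose (\<nu> + 1)) = 2 * \<nu> * ((2 * \<nu> - 1) choose \<nu>)"
    using Suc_times_binomial_eq[of "2 * \<nu> - 1" \<nu>] \<nu> by (simp add: mult.commute)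
  also have "(2 * \<nu> - 1) choose \<nu> = (2 * \<nu> - 1) choose (\<nu> - 1)"
    using binomial_symmetric[of \<nu> "2 * \<nu> - 1"] \<nu> by simp
  finally show ?thesis by (simp add: toda_const_def)
qed

text \<open>Order 0 cancels between the two entries. At order 1 their linearizations differ by a
  variation that is the same at all sites, which \<open>djpow_const\<close> evaluates.\<close>

lemma toda_Y_1:
  assumes \<nu>: "\<nu> \<ge> 1" shows "toda_Y \<nu> a $ 1 = fps_const (toda_const \<nu>) * a 0 ^ \<nu> * a 1"
proof -
  define \<rho> where "\<rho> l = fps_shift 1 (taylor_shift a l)" for l
  have ts: "taylor_shift a = (\<lambda>l. fps_const (a 0) + fps_X * \<rho> l)"
  proof
    fix l
    show "taylor_shift a l = fps_const (a 0) + fps_X * \<rho> l"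
    proof (rule fps_ext)
      fix n show "taylor_shift a l $ n = (fps_const (a 0) + fps_X * \<rho> l) $ n"
        by (cases n) (simp_all add: \<rho>_def taylor_shift_def)
    qed
  qed
  have nth1: "jpow (taylor_shift a) p n m $ 1 = jpow (\<lambda>_. fps_const (a 0)) p n m $ 1 + djpow (\<lambda>_. a 0) (\<lambda>l. \<rho> l $ 0) p n m" for p n m
  proof -
    obtain c where c: "jpow (taylor_shift a) p n m
        = jpow (\<lambda>_. fps_const (a 0)) p n m + fps_X * djpow (\<lambda>_. fps_const (a 0)) \<rho> p n m + fps_X\<^sup>2 * c"
      unfolding ts using jpow_perturb[of "\<lambda>_. fps_const (a 0)" fps_X \<rho> p n m] by blast
    have "djpow (\<lambda>_. fps_const (a 0)) \<rho> p n m $ 0 = djpow (\<lambda>_. fps_const (a 0) $ 0) (\<lambda>l. \<rho> l $ 0) p n m"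
      by (rule djpow_hom) simp_all
    then show ?thesis unfolding c by (simp add: power2_eq_square mult.assoc)
  qed
  have \<rho>0: "\<rho> l $ 0 = fps_const (of_int l) * a 1" for l by (simp add: \<rho>_def taylor_shift_def)
  have "djpow (\<lambda>_. a 0) (\<lambda>l. \<rho> l $ 0) (2 * \<nu>) 1 (- 1) = djpow (\<lambda>_. a 0) (\<lambda>l. \<rho> (l + 1) $ 0) (2 * \<nu>) 0 (- 2)"
    using djpow_shift[of "\<lambda>_. a 0" 1 "\<lambda>l. \<rho> l $ 0" "2 * \<nu>" 0 "- 2"] by simp
  moreover have "djpow (\<lambda>_. a 0) (\<lambda>l. \<rho> (l + 1) $ 0) (2 * \<nu>) 0 (- 2) - djpow (\<lambda>_. a 0) (\<lambda>l. \<rho> l $ 0) (2 * \<nu>) 0 (- 2)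
      = djpow (\<lambda>_. a 0) (\<lambda>_. a 1) (2 * \<nu>) 0 (- 2)"
    unfolding djpow_diff[symmetric] by (simp add: \<rho>0 fps_const_add[symmetric] ring_distribs del: fps_const_add)
  moreover have "djpow (\<lambda>_. a 0) (\<lambda>_. a 1) (2 * \<nu>) 0 (- 2)
      = of_nat ((\<nu> + 1) * ((2 * \<nu>) choose (\<nu> + 1))) * a 0 ^ (\<nu> + 1 - 1) * a 1"
    by (rule djpow_const) simp
  moreover have "jpow (\<lambda>_. fps_const (a 0)) (2 * \<nu>) 1 (- 1) = jpow (\<lambda>_. fps_const (a 0)) (2 * \<nu>) 0 (- 2)"
    using jpow_shift[of "\<lambda>_. fps_const (a 0)" 1 "2 * \<nu>" 0 "- 2"] by simp
  ultimately have "toda_Y \<nu> a $ 1 = of_nat ((\<nu> + 1) * ((2 * \<nu>) choose (\<nu> + 1))) * a 0 ^ \<nu> * a 1"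
    unfolding toda_Y_def fps_sub_nth nth1 by (simp add: algebra_simps)
  then show ?thesis unfolding toda_const_eq[OF \<nu>] by (simp only: fps_of_nat)
qed

lemma toda_rhs_eq:
  assumes "\<nu> \<ge> 1" shows "toda_rhs \<nu> a n = (\<Sum>g\<le>n. toda_Y \<nu> a $ (2 * g + 1) $ (n - g))"
proof -
  have "{..n} = insert 0 {1..n}" by auto
  then have "(\<Sum>g\<le>n. toda_Y \<nu> a $ (2 * g + 1) $ (n - g)) = toda_Y \<nu> a $ 1 $ n + (\<Sum>g=1..n. toda_Y \<nu> a $ (2 * g + 1) $ (n - g))"
    by simp
  then show ?thesis unfolding toda_rhs_def diff_poly_Y toda_Y_1[OF assms] by simp
qed

lemma iterated_deriv_eq:
  assumes f: "\<And>w. w > 0 \<Longrightarrow> f w = u 0 w" and u: "\<And>j w. w > 0 \<Longrightarrow> (u j has_real_derivative u (Suc j) w) (at w)"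
  shows "w > 0 \<Longrightarrow> (deriv ^^ j) f w = u j w"
proof (induction j arbitrary: w)
  case (Suc j)
  have "((deriv ^^ j) f has_real_derivative u (Suc j) w) (at w)"
    by (rule has_field_derivative_transform_within_open[OF u[OF Suc.prems], of "{0<..}"])
       (use Suc in auto)
  then show ?case by (simp add: DERIV_imp_deriv)
qed (simp add: f)

section \<open>The coefficients \<open>z\<close> and their scheme\<close>

context root
begin

definition z :: "nat \<Rightarrow> real \<Rightarrow> real \<Rightarrow> real" where "z g s1 s2 = ev (F $ (2 * g)) (1, s1, s2)"

lemma smooth_z: "smooth_on_quadrant (z g)"
proof -
  define D where "D i j s t = ev ((dS True ^^ i) ((dS False ^^ j) (F $ (2 * g)))) (1, s, t)" for i j s t
  have comm: "dS False ((dS True ^^ i) u) = (dS True ^^ i) (dS False u)" for i u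
    by (induction i) (simp_all add: partial_commute[of "eS True" "eS False"])
  have cont: "continuous_on ({..0} \<times> {..0}) (\<lambda>(s, t). D i j s t)" for i j
    unfolding D_def case_prod_beta
    by (rule continuous_on_compose2[OF continuous_on_ev]) (auto intro!: continuous_intros simp: toda_dom_def)
  have "((\<lambda>x. D i j x t) has_real_derivative D (Suc i) j s t) (at s within {..0})"
    "((\<lambda>y. D i j s y) has_real_derivative D i (Suc j) s t) (at t within {..0})" if "s \<le> 0" "t \<le> 0" for i j s t
    using has_derivative_ev_S[of 1 s t "(dS True ^^ i) ((dS False ^^ j) (F $ (2 * g)))"] that
    by (simp_all add: D_def comm)
  moreover have "D 0 0 s t = z g s t" for s t by (simp add: D_def z_def)
  ultimately show ?thesis unfolding smooth_on_quadrant_def using cont by blast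
qed

text \<open>\<open>F_homogeneous\<close> with \<open>L = w\<close>, at the point that
  \<open>\<sigma> w\<close> maps to \<open>(w, s1, s2)\<close>.\<close>

lemma z_scaled:
  assumes "w > 0" "s1 \<le> 0" "s2 \<le> 0"
  shows "scaled_term (\<nu> True) (\<nu> False) z g s1 s2 w = ev (F $ (2 * g)) (w, s1, s2)"
proof -
  define x where "x = (1 :: real, w ^ (\<nu> True - 1) * s1, w ^ (\<nu> False - 1) * s2)"
  have x: "x \<in> toda_dom" using assms by (simp add: x_def toda_dom_def mult_nonneg_nonpos)
  have jpow: "w / w ^ \<nu> i * (w ^ (\<nu> i - 1) * a) = a" for i a
    using assms(1) \<nu>[of i] by (cases "\<nu> i") simp_all
  have "\<sigma> w x = (w, s1, s2)" unfolding \<sigma>_def x_def sc_def by (simp add: jpow[simplified])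
  then have "w * ev (F $ (2 * g)) x = w ^ (2 * g) * ev (F $ (2 * g)) (w, s1, s2)"
    using F_homogeneous[OF assms(1) x, of "2 * g"] by simp
  then have "w / w ^ (2 * g) * ev (F $ (2 * g)) x = ev (F $ (2 * g)) (w, s1, s2)"
    using assms(1) by simp
  moreover have "w powi (1 - 2 * int g) = w / w ^ (2 * g)"
  proof -
    have "w powi (1 - int (2 * g)) = w powi 1 / w powi int (2 * g)"
      by (rule power_int_diff) (use assms(1) in simp)
    then show ?thesis using power_int_of_nat[of w "2 * g"] by simp
  qed
  ultimately show ?thesis by (simp only: scaled_term_def z_def x_def)
qed

end

context root_at
begin

lemma z_jet: "scaled_jet (\<nu> True) (\<nu> False) z s1 s2 1 j $ g = pt ((dW ^^ j) (F $ (2 * g))) 1"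
proof -
  have "(deriv ^^ j) (scaled_term (\<nu> True) (\<nu> False) z g s1 s2) 1 = pt ((dW ^^ j) (F $ (2 * g))) 1"
    by (rule iterated_deriv_eq[where u = "\<lambda>j. pt ((dW ^^ j) (F $ (2 * g)))"])
       (use z_scaled s DERIV_pt in \<open>auto simp: pt_def\<close>)
  then show ?thesis by (simp add: scaled_jet_def)
qed

definition E :: "sfun fps \<Rightarrow> real fps" where "E A = Abs_fps (\<lambda>m. pt (A $ m) 1)"

lemma E_mult: "E (A * B) = E A * E B"
  by (rule fps_ext) (simp add: E_def fps_mult_nth pt_sum pt_mult)
lemma E_add: "E (A + B) = E A + E B" by (rule fps_ext) (simp add: E_def pt_add)
lemma E_1: "E 1 = 1" by (rule fps_ext) (simp add: E_def cst_1[symmetric])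
lemma E_0: "E 0 = 0" by (rule fps_ext) (simp add: E_def)
lemma E_jpow: "E (jpow R p n m) = jpow (\<lambda>n. E (R n)) p n m"
  by (rule jpow_hom) (simp_all add: E_0 E_1 E_add E_mult)

text \<open>The odd coefficients of \<open>F\<close> vanish, so the series in \<open>h\<close> built
  from the \<open>z g\<close> turns into \<open>F\<close> under
  \<open>h = \<epsilon>^2\<close>.\<close>

lemma chi_jet: "chi (taylor_shift (scaled_jet (\<nu> True) (\<nu> False) z s1 s2 1) l) = E (r l)"
proof (rule fps_ext)
  fix m
  have "chi (taylor_shift (scaled_jet (\<nu> True) (\<nu> False) z s1 s2 1) l) $ m
     = (\<Sum>i\<le>m. of_int l ^ i / fact i * pt ((dW ^^ i) (F $ (m - i))) 1)"
    unfolding chi_def fps_nth_Abs_fps taylor_shift_def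
  proof (intro sum.cong refl)
    fix i
    show "(if even (m - i) then (fps_const (of_int l ^ i / fact i) * scaled_jet (\<nu> True) (\<nu> False) z s1 s2 1 i) $ ((m - i) div 2) else 0)
       = of_int l ^ i / fact i * pt ((dW ^^ i) (F $ (m - i))) 1"
      by (cases "even (m - i)") (simp_all add: z_jet F_odd)
  qed
  also have "\<dots> = E (r l) $ m" by (simp add: E_def tshift_def pt_sum pt_mult)
  finally show "chi (taylor_shift (scaled_jet (\<nu> True) (\<nu> False) z s1 s2 1) l) $ m = E (r l) $ m" .
qed

lemma z_toda: "toda_rhs (\<nu> i) (scaled_jet (\<nu> True) (\<nu> False) z s1 s2 1) n = ev (dS i (F $ (2 * n))) (1, s1, s2)"
proof -
  let ?a = "scaled_jet (\<nu> True) (\<nu> False) z s1 s2 1"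
  have chi_jpow: "chi (jpow R p n m) = jpow (\<lambda>n. chi (R n)) p n m" for R p n m
    by (rule jpow_hom) (simp_all add: chi_0 chi_1 chi_add chi_mult)
  have "chi (toda_Y (\<nu> i) ?a) = E (jpow r (2 * \<nu> i) 1 (- 1)) - E (jpow r (2 * \<nu> i) 0 (- 2))"
    unfolding toda_Y_def chi_diff chi_jpow chi_jet E_jpow ..
  also have "\<dots> = E (fps_X * \<Delta> i F)"
    unfolding toda using E_add[of "jpow r (2 * \<nu> i) 1 (- 1) - jpow r (2 * \<nu> i) 0 (- 2)" "jpow r (2 * \<nu> i) 0 (- 2)"] by simp
  finally have "toda_rhs (\<nu> i) ?a n = E (fps_X * \<Delta> i F) $ (2 * n + 1)"
    unfolding toda_rhs_eq[OF \<nu>] chi_odd[symmetric] by simp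
  then show ?thesis by (simp add: E_def \<Delta>_def pt_def)
qed

text \<open>With both times 0 the string equation reads \<open>r = w\<close>.\<close>

lemma z_init: "s1 = 0 \<Longrightarrow> s2 = 0 \<Longrightarrow> pt (F $ m) 1 = (if m = 0 then 1 else 0)"
proof -
  assume s0: "s1 = 0" "s2 = 0"
  have "vr i = 0" for i unfolding vr_def by (simp add: s0)
  then have vv0: "E (fps_const (vv i)) = 0" for i
    by (intro fps_ext) (simp add: E_def pt_vv)
  have "E (St F) = E F"
    unfolding St_def string_op_def UNIV_bool by (simp add: E_add E_mult vv0 tshift_0)
  then have "E F $ m = E (fps_const (mk_sfun fst)) $ m" by (simp add: St_F)
  then show ?thesis by (auto simp: E_def pt_def ev_mk_sfun smooth_fst toda_dom_at)
qed

end

lemma (in root) toda_solution_z: "toda_solution (\<nu> True) (\<nu> False) z"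
  unfolding toda_solution_def toda_scheme_def
proof (intro conjI allI impI smooth_z)
  interpret r0: root_at \<nu> 0 0 by unfold_locales simp_all
  show "z 0 0 0 = 1" using r0.z_init[of 0] by (simp add: z_def r0.pt_def)
  show "z g 0 0 = 0" if "g \<ge> 1" for g using r0.z_init[of "2 * g"] that by (simp add: z_def r0.pt_def)
  fix s1 s2 :: real and n assume s: "s1 \<le> 0" "s2 \<le> 0"
  interpret rs: root_at \<nu> s1 s2 by unfold_locales (use s in auto)
  have t: "scaled_term (\<nu> True) (\<nu> False) z n a b 1 = ev (F $ (2 * n)) (1, a, b)" for a b
    by (simp add: scaled_term_def z_def)
  show "((\<lambda>s. scaled_term (\<nu> True) (\<nu> False) z n s s2 1) has_real_derivative
      toda_rhs (\<nu> True) (scaled_jet (\<nu> True) (\<nu> False) z s1 s2 1) n) (at s1 within {..0})"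
    unfolding rs.z_toda t by (rule has_derivative_ev_S) (use s in auto)
  show "((\<lambda>s. scaled_term (\<nu> True) (\<nu> False) z n s1 s 1) has_real_derivative
      toda_rhs (\<nu> False) (scaled_jet (\<nu> True) (\<nu> False) z s1 s2 1) n) (at s2 within {..0})"
    unfolding rs.z_toda t by (rule has_derivative_ev_S) (use s in auto)
qed

subsection \<open>Uniqueness\<close>

text \<open>With \<open>M\<close> a bound for \<open>\<alpha>\<close>, the nonnegative function
  \<open>v^2 exp (- 2 M t)\<close> is nonincreasing and starts at 0.\<close>

lemma linear_ode_zero:
  fixes v \<alpha> :: "real \<Rightarrow> real"
  assumes v: "\<And>t. t \<in> {0..1} \<Longrightarrow> (v has_real_derivative \<alpha> t * v t) (at t within {0..1})"
    and \<alpha>: "continuous_on {0..1} \<alpha>" and "v 0 = 0"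
  shows "v 1 = 0"
proof -
  have "bounded (\<alpha> ` {0..1})" by (intro compact_imp_bounded compact_continuous_image \<alpha>) auto
  then obtain M where "\<forall>x\<in>\<alpha> ` {0..1}. norm x \<le> M" unfolding bounded_iff by blast
  then have M: "\<And>t. t \<in> {0..1} \<Longrightarrow> \<bar>\<alpha> t\<bar> \<le> M" by simp
  define g where "g t = (v t)\<^sup>2 * exp (- (2 * M) * t)" for t
  have g': "(g has_real_derivative 2 * (\<alpha> t - M) * g t) (at t within {0..1})" if "t \<in> {0..1}" for t
    unfolding g_def by (auto intro!: derivative_eq_intros v[OF that] simp: power2_eq_square algebra_simps)
  have "g 1 \<le> g 0"
  proof (rule DERIV_nonpos_imp_decreasing_open[where f = g and a = 0 and b = 1])
    show "continuous_on {0..1} g" by (rule DERIV_continuous_on) (rule g')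
    fix t :: real assume t: "0 < t" "t < 1"
    have "(g has_real_derivative 2 * (\<alpha> t - M) * g t) (at t)"
      using g'[of t] t by (simp add: at_within_Icc_at)
    moreover have "\<bar>\<alpha> t\<bar> \<le> M" by (rule M) (use t in simp)
    then have "\<alpha> t - M \<le> 0" by linarith
    then have "2 * (\<alpha> t - M) * g t \<le> 0" 
      using mult_nonpos_nonneg[of "2 * (\<alpha> t - M)" "g t"] by (simp add: g_def)
    ultimately show "\<exists>y. (g has_real_derivative y) (at t) \<and> y \<le> 0" by blast
  qed simp
  then have "(v 1)\<^sup>2 * exp (- (2 * M)) \<le> 0" using assms(3) by (simp add: g_def)
  then show ?thesis by (simp add: mult_le_0_iff)
qed

lemma DERIV_unique_atMost:
  fixes f :: "real \<Rightarrow> real"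
  assumes "(f has_real_derivative a) (at s within {..0})" "(f has_real_derivative b) (at s within {..0})" "s \<le> 0"
  shows "a = b"
proof (rule tendsto_unique)
  have "s islimpt {s - 1<..<s}" by (rule islimpt_greaterThanLessThan2) simp
  then have "s islimpt {..0}" by (rule islimpt_subset) (use assms(3) in auto)
  then show "at s within {..0} \<noteq> bot" by (simp add: trivial_limit_within)
qed (use assms(1,2) in \<open>auto simp: has_field_derivative_iff\<close>)

text \<open>The path may run along the boundary of the quadrant, where only one-sided partial
  derivatives exist; continuity of one of them yields total differentiability within the
  quadrant.\<close>

lemma quadrant_path:
  fixes u u1 u2 :: "real \<Rightarrow> real \<Rightarrow> real"
  assumes c: "continuous_on ({..0} \<times> {..0}) (\<lambda>(s, t). u2 s t)"
    and d: "\<And>s t. s \<le> 0 \<Longrightarrow> t \<le> 0 \<Longrightarrow> ((\<lambda>x. u x t) has_real_derivative u1 s t) (at s within {..0})"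
      "\<And>s t. s \<le> 0 \<Longrightarrow> t \<le> 0 \<Longrightarrow> ((\<lambda>y. u s y) has_real_derivative u2 s t) (at t within {..0})"
    and ab: "(a has_real_derivative a') (at \<tau> within S)" "(b has_real_derivative b') (at \<tau> within S)"
      "\<And>t. t \<in> S \<Longrightarrow> a t \<le> 0" "\<And>t. t \<in> S \<Longrightarrow> b t \<le> 0" "\<tau> \<in> S"
  shows "((\<lambda>t. u (a t) (b t)) has_real_derivative u1 (a \<tau>) (b \<tau>) * a' + u2 (a \<tau>) (b \<tau>) * b') (at \<tau> within S)"
proof -
  define x where "x = a \<tau>" define y where "y = b \<tau>"
  have xy: "x \<le> 0" "y \<le> 0" using ab by (auto simp: x_def y_def)
  have "((\<lambda>(x, y). u x y) has_derivative (\<lambda>(tx, ty). u1 x y * tx + blinfun_apply (u2 x y *\<^sub>R id_blinfun) ty)) (at (x, y) within {..0} \<times> {..0})"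
  proof (rule has_derivative_partialsI[where fy = "\<lambda>x y. u2 x y *\<^sub>R id_blinfun"])
    show "((\<lambda>x. u x y) has_derivative (\<lambda>tx. u1 x y * tx)) (at x within {..0})"
      using d(1)[OF xy] by (simp add: has_field_derivative_def)
    show "((\<lambda>y. u x y) has_derivative blinfun_apply (u2 x y *\<^sub>R id_blinfun)) (at y within {..0})"
      if "x \<in> {..0}" "y \<in> {..0}" for x y
      using d(2)[of x y] that by (simp add: has_field_derivative_def scaleR_blinfun.rep_eq id_blinfun.rep_eq)
    have "continuous_on ({..0} \<times> {..0}) (\<lambda>p. (\<lambda>(s, t). u2 s t) p *\<^sub>R (id_blinfun :: real \<Rightarrow>\<^sub>L real))"
      by (intro continuous_intros c)
    then show "continuous (at (x, y) within {..0} \<times> {..0}) (\<lambda>(x, y). u2 x y *\<^sub>R (id_blinfun :: real \<Rightarrow>\<^sub>L real))"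
      using xy unfolding continuous_on_eq_continuous_within by (simp add: split_beta')
  qed (use xy in auto)
  then have U: "((\<lambda>(x, y). u x y) has_derivative (\<lambda>(tx, ty). u1 x y * tx + u2 x y * ty)) (at (a \<tau>, b \<tau>) within {..0} \<times> {..0})"
    by (simp add: x_def y_def scaleR_blinfun.rep_eq id_blinfun.rep_eq)
  have "((\<lambda>t. (a t, b t)) has_derivative (\<lambda>t. (a' * t, b' * t))) (at \<tau> within S)"
    using ab(1,2) by (intro has_derivative_Pair) (simp_all add: has_field_derivative_def)
  moreover have "((\<lambda>(x, y). u x y) has_derivative (\<lambda>(tx, ty). u1 x y * tx + u2 x y * ty))
      (at (a \<tau>, b \<tau>) within (\<lambda>t. (a t, b t)) ` S)"
    by (rule has_derivative_subset[OF U]) (use ab in auto)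
  ultimately have "((\<lambda>t. (\<lambda>(x, y). u x y) (a t, b t)) has_derivative
      (\<lambda>t. (\<lambda>(tx, ty). u1 x y * tx + u2 x y * ty) (a' * t, b' * t))) (at \<tau> within S)"
    by (rule has_derivative_in_compose)
  then have "((\<lambda>t. u (a t) (b t)) has_derivative (\<lambda>t. u1 x y * (a' * t) + u2 x y * (b' * t))) (at \<tau> within S)"
    by simp
  moreover have "(\<lambda>t. u1 x y * (a' * t) + u2 x y * (b' * t)) = (*) (u1 x y * a' + u2 x y * b')"
    by (rule ext) (simp add: algebra_simps)
  ultimately show ?thesis by (simp add: has_field_derivative_def x_def y_def)
qed

text \<open>Only the two extreme terms of the Cauchy product see the coefficients of order
  \<open>n\<close>.\<close>

lemma fps_mult_nth_diff:
  fixes A A' B B' :: "real fps"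
  assumes "n \<ge> 1" "\<And>g. g < n \<Longrightarrow> A' $ g = A $ g" "\<And>g. g < n \<Longrightarrow> B' $ g = B $ g"
  shows "(A' * B') $ n - (A * B) $ n = A $ 0 * (B' $ n - B $ n) + (A' $ n - A $ n) * B $ 0"
proof -
  have split: "(X * Y) $ n = X $ 0 * Y $ n + X $ n * Y $ 0 + (\<Sum>i\<in>{1..<n}. X $ i * Y $ (n - i))" for X Y :: "real fps"
  proof -
    have "{0..n} = insert 0 (insert n {1..<n})" using assms(1) by auto
    then show ?thesis using assms(1) by (simp add: fps_mult_nth)
  qed
  have "(\<Sum>i\<in>{1..<n}. A' $ i * B' $ (n - i)) = (\<Sum>i\<in>{1..<n}. A $ i * B $ (n - i))"
    by (intro sum.cong refl) (use assms in auto)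
  then show ?thesis using assms by (simp add: split algebra_simps)
qed

lemma fps_mult_nth_eq:
  fixes A A' B B' :: "real fps"
  assumes "\<And>g. g < n \<Longrightarrow> A' $ g = A $ g" "\<And>g. g < n \<Longrightarrow> B' $ g = B $ g" "g < n"
  shows "(A' * B') $ g = (A * B) $ g"
  unfolding fps_mult_nth by (intro sum.cong refl) (use assms in auto)

lemma fps_power_nth_diff:
  fixes A A' :: "real fps"
  assumes "n \<ge> 1" "\<And>g. g < n \<Longrightarrow> A' $ g = A $ g"
  shows "g < n \<Longrightarrow> (A' ^ p) $ g = (A ^ p) $ g"
    and "(A' ^ p) $ n - (A ^ p) $ n = real p * (A $ 0) ^ (p - 1) * (A' $ n - A $ n)"
proof -
  have *: "g < n \<Longrightarrow> (A' ^ p) $ g = (A ^ p) $ g" for g p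
    by (induction p arbitrary: g) (auto intro: fps_mult_nth_eq[OF assms(2)])
  show "g < n \<Longrightarrow> (A' ^ p) $ g = (A ^ p) $ g" by (rule *)
  show "(A' ^ p) $ n - (A ^ p) $ n = real p * (A $ 0) ^ (p - 1) * (A' $ n - A $ n)"
  proof (induction p)
    case (Suc p)
    have "(A' ^ Suc p) $ n - (A ^ Suc p) $ n = A $ 0 * ((A' ^ p) $ n - (A ^ p) $ n) + (A' $ n - A $ n) * (A ^ p) $ 0"
      unfolding power_Suc by (rule fps_mult_nth_diff[OF assms(1,2) *]) auto
    also have "\<dots> = real (Suc p) * (A $ 0) ^ p * (A' $ n - A $ n)"
      unfolding Suc by (cases p) (simp_all add: algebra_simps fps_power_zeroth)
    finally show ?case by simp
  qed simp
qed

text \<open>The \<open>F_g\<close> with \<open>g \<ge> 1\<close> enter at order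
  \<open>n - g < n\<close> and cancel; only the leading term sees the coefficients of order
  \<open>n\<close>, and it does so linearly.\<close>

lemma toda_rhs_diff:
  assumes n: "n \<ge> 1" and a: "\<And>j g. g < n \<Longrightarrow> a' j $ g = a j $ g"
  shows "toda_rhs \<nu> a' n - toda_rhs \<nu> a n = toda_const \<nu> *
     ((a 0 $ 0) ^ \<nu> * (a' 1 $ n - a 1 $ n) + real \<nu> * (a 0 $ 0) ^ (\<nu> - 1) * (a' 0 $ n - a 0 $ n) * a 1 $ 0)"
proof -
  define rel where "rel A B \<longleftrightarrow> (\<forall>i g. g < n \<longrightarrow> A $ i $ g = B $ i $ g)" for A B :: "real fps fps"
  have rel_mult: "rel (A * B) (A' * B')" if "rel A A'" "rel B B'" for A A' B B'
    unfolding rel_def fps_mult_nth[of _ _ "_ :: nat"]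
  proof (intro allI impI)
    fix i g assume "g < n"
    then show "(\<Sum>j = 0..i. A $ j * B $ (i - j)) $ g = (\<Sum>j = 0..i. A' $ j * B' $ (i - j)) $ g"
      unfolding fps_sum_nth by (intro sum.cong refl fps_mult_nth_eq[of n]) (use that in \<open>auto simp: rel_def\<close>)
  qed
  have rel_add: "rel (A + B) (A' + B')" if "rel A A'" "rel B B'" for A A' B B'
    using that by (simp add: rel_def)
  have ts: "rel (taylor_shift a' l) (taylor_shift a l)" for l
    using a by (simp add: rel_def taylor_shift_def)
  have "rel (jpow (taylor_shift a') p m l) (jpow (taylor_shift a) p m l)" for p m l
    by (induction p arbitrary: m) (simp_all add: rel_add rel_mult ts, simp add: rel_def)
  then have "diff_poly \<nu> g a' $ (n - g) = diff_poly \<nu> g a $ (n - g)" if "g \<in> {1..n}" for g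
    using that n by (simp add: diff_poly_Y toda_Y_def rel_def)
  then have "(\<Sum>g=1..n. diff_poly \<nu> g a' $ (n - g)) = (\<Sum>g=1..n. diff_poly \<nu> g a $ (n - g))"
    by (rule sum.cong[OF refl])
  then have "toda_rhs \<nu> a' n - toda_rhs \<nu> a n
     = toda_const \<nu> * ((a' 0 ^ \<nu> * a' 1) $ n - (a 0 ^ \<nu> * a 1) $ n)"
    by (simp add: toda_rhs_def mult.assoc right_diff_distrib)
  also have "(a' 0 ^ \<nu> * a' 1) $ n - (a 0 ^ \<nu> * a 1) $ n
     = (a 0 ^ \<nu>) $ 0 * (a' 1 $ n - a 1 $ n) + ((a' 0 ^ \<nu>) $ n - (a 0 ^ \<nu>) $ n) * a 1 $ 0"
    by (rule fps_mult_nth_diff[OF n]) (use a fps_power_nth_diff(1)[OF n, of "a' 0" "a 0"] in auto)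
  also have "(a' 0 ^ \<nu>) $ n - (a 0 ^ \<nu>) $ n = real \<nu> * (a 0 $ 0) ^ (\<nu> - 1) * (a' 0 $ n - a 0 $ n)"
    by (rule fps_power_nth_diff(2)[OF n]) (use a in auto)
  finally show ?thesis by (simp add: fps_power_zeroth)
qed

text \<open>The last equation is the Euler relation of the scaling. It expresses the derivative in
  \<open>w\<close> at 1 by time derivatives and so turns each order of the scheme into a first-order
  system in the times alone.\<close>

definition first_order_data where
  "first_order_data \<nu>1 \<nu>2 z P1 P2 \<longleftrightarrow>
     (\<forall>n. continuous_on ({..0} \<times> {..0}) (\<lambda>(s, t). z n s t) \<and> continuous_on ({..0} \<times> {..0}) (\<lambda>(s, t). P2 n s t)) \<and>
     (\<forall>n s t. s \<le> 0 \<longrightarrow> t \<le> 0 \<longrightarrow>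
        ((\<lambda>x. z n x t) has_real_derivative P1 n s t) (at s within {..0}) \<and>
        ((\<lambda>y. z n s y) has_real_derivative P2 n s t) (at t within {..0}) \<and>
        P1 n s t = toda_rhs \<nu>1 (scaled_jet \<nu>1 \<nu>2 z s t 1) n \<and>
        P2 n s t = toda_rhs \<nu>2 (scaled_jet \<nu>1 \<nu>2 z s t 1) n \<and>
        scaled_jet \<nu>1 \<nu>2 z s t 1 0 $ n = z n s t \<and>
        scaled_jet \<nu>1 \<nu>2 z s t 1 1 $ n =
          (1 - 2 * real n) * z n s t + real (\<nu>1 - 1) * s * P1 n s t + real (\<nu>2 - 1) * t * P2 n s t)"

lemma first_order_dataD:
  assumes "first_order_data \<nu>1 \<nu>2 z P1 P2" "s \<le> 0" "t \<le> 0"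
  shows "P1 n s t = toda_rhs \<nu>1 (scaled_jet \<nu>1 \<nu>2 z s t 1) n"
    "P2 n s t = toda_rhs \<nu>2 (scaled_jet \<nu>1 \<nu>2 z s t 1) n"
    "scaled_jet \<nu>1 \<nu>2 z s t 1 0 $ n = z n s t"
    "scaled_jet \<nu>1 \<nu>2 z s t 1 1 $ n =
          (1 - 2 * real n) * z n s t + real (\<nu>1 - 1) * s * P1 n s t + real (\<nu>2 - 1) * t * P2 n s t"
  using assms unfolding first_order_data_def by blast+

lemma ray_derivative:
  assumes data: "first_order_data \<nu>1 \<nu>2 z P1 P2" and s: "s1 \<le> 0" "s2 \<le> 0" and t: "t \<in> {0..1}"
  shows "((\<lambda>t. z n (t * s1) (t * s2)) has_real_derivative
     P1 n (t * s1) (t * s2) * s1 + P2 n (t * s1) (t * s2) * s2) (at t within {0..1})"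
proof (rule quadrant_path[where u = "z n" and a = "\<lambda>t. t * s1" and b = "\<lambda>t. t * s2"])
  show "continuous_on ({..0} \<times> {..0}) (\<lambda>(s, t). P2 n s t)"
    using data unfolding first_order_data_def by blast
  show "((\<lambda>x. z n x b) has_real_derivative P1 n a b) (at a within {..0})"
    "((\<lambda>y. z n a y) has_real_derivative P2 n a b) (at b within {..0})" if "a \<le> 0" "b \<le> 0" for a b
    using data that unfolding first_order_data_def by blast+
  show "t * s1 \<le> 0" "t * s2 \<le> 0" if "t \<in> {0..1}" for t using s that by (auto simp: mult_nonneg_nonpos)
qed (use t in \<open>auto intro!: derivative_eq_intros\<close>)

lemma ray_continuous:
  assumes "first_order_data \<nu>1 \<nu>2 z P1 P2" "s1 \<le> 0" "s2 \<le> 0"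
  shows "continuous_on {0..1} (\<lambda>t. z n (t * s1) (t * s2))"
  by (rule DERIV_continuous_on) (rule ray_derivative[OF assms])

lemma toda_solution_data:
  assumes sol: "toda_solution \<nu>1 \<nu>2 z"
  shows "\<exists>P1 P2. first_order_data \<nu>1 \<nu>2 z P1 P2"
proof -
  define Q where "Q g D \<longleftrightarrow> (\<forall>s\<le>0. \<forall>t\<le>0. D 0 0 s t = z g s t) \<and>
        (\<forall>i j. continuous_on ({..0} \<times> {..0}) (\<lambda>(s, t). D i j s t) \<and>
          (\<forall>s\<le>0. \<forall>t\<le>0.
             ((\<lambda>x. D i j x t) has_real_derivative D (Suc i) j s t) (at s within {..0}) \<and>
             ((\<lambda>y. D i j s y) has_real_derivative D i (Suc j) s t) (at t within {..0})))"
    for g and D :: "nat \<Rightarrow> nat \<Rightarrow> real \<Rightarrow> real \<Rightarrow> real"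
  have "\<forall>g. \<exists>D. Q g D" using sol by (simp add: toda_solution_def smooth_on_quadrant_def Q_def)
  then obtain D where Q: "\<And>g. Q g (D g)" using choice[of Q] by blast
  have D0: "D g 0 0 s t = z g s t" if "s \<le> 0" "t \<le> 0" for g s t using Q[of g] that unfolding Q_def by blast
  have Dc: "continuous_on ({..0} \<times> {..0}) (\<lambda>(s, t). D g i j s t)" for g i j using Q[of g] unfolding Q_def by blast
  have Dd: "((\<lambda>x. D g i j x t) has_real_derivative D g (Suc i) j s t) (at s within {..0})"
      "((\<lambda>y. D g i j s y) has_real_derivative D g i (Suc j) s t) (at t within {..0})"
    if "s \<le> 0" "t \<le> 0" for g i j s t using Q[of g] that unfolding Q_def by blast+
  define P1 where "P1 n = D n 1 0" for n
  define P2 where "P2 n = D n 0 1" for n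
  have zc: "continuous_on ({..0} \<times> {..0}) (\<lambda>(s, t). z n s t)" for n
    using Dc[of n 0 0] by (rule continuous_on_cong[THEN iffD1, rotated 2]) (auto simp: D0)
  have P2c: "continuous_on ({..0} \<times> {..0}) (\<lambda>(s, t). P2 n s t)" for n
    using Dc[of n 0 1] by (simp add: P2_def)
  have d1: "((\<lambda>x. z n x t) has_real_derivative P1 n s t) (at s within {..0})" if st: "s \<le> 0" "t \<le> 0" for n s t
    by (rule has_field_derivative_transform_within[where d = 1 and f = "\<lambda>x. D n 0 0 x t"])
       (use Dd(1)[OF st, of n 0 0] st in \<open>auto simp: P1_def D0\<close>)
  have d2: "((\<lambda>y. z n s y) has_real_derivative P2 n s t) (at t within {..0})" if st: "s \<le> 0" "t \<le> 0" for n s t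
    by (rule has_field_derivative_transform_within[where d = 1 and f = "\<lambda>y. D n 0 0 s y"])
       (use Dd(2)[OF st, of n 0 0] st in \<open>auto simp: P2_def D0\<close>)
  have t1: "scaled_term \<nu>1 \<nu>2 z n a b 1 = z n a b" for n a b by (simp add: scaled_term_def)
  have rhs: "P1 n s t = toda_rhs \<nu>1 (scaled_jet \<nu>1 \<nu>2 z s t 1) n" "P2 n s t = toda_rhs \<nu>2 (scaled_jet \<nu>1 \<nu>2 z s t 1) n"
    if st: "s \<le> 0" "t \<le> 0" for n s t
  proof -
    have "((\<lambda>x. z n x t) has_real_derivative toda_rhs \<nu>1 (scaled_jet \<nu>1 \<nu>2 z s t 1) n) (at s within {..0})"
      "((\<lambda>y. z n s y) has_real_derivative toda_rhs \<nu>2 (scaled_jet \<nu>1 \<nu>2 z s t 1) n) (at t within {..0})"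
      using sol st unfolding toda_solution_def toda_scheme_def t1 by blast+
    then show "P1 n s t = toda_rhs \<nu>1 (scaled_jet \<nu>1 \<nu>2 z s t 1) n" "P2 n s t = toda_rhs \<nu>2 (scaled_jet \<nu>1 \<nu>2 z s t 1) n"
      by (auto intro: DERIV_unique_atMost[OF d1[OF st, of n]] DERIV_unique_atMost[OF d2[OF st, of n]] st)
  qed
  have jet0: "scaled_jet \<nu>1 \<nu>2 z s t 1 0 $ n = z n s t" for s t n
    by (simp add: scaled_jet_def t1)
  have jet1: "scaled_jet \<nu>1 \<nu>2 z s t 1 1 $ n =
      (1 - 2 * real n) * z n s t + real (\<nu>1 - 1) * s * P1 n s t + real (\<nu>2 - 1) * t * P2 n s t"
    if st: "s \<le> 0" "t \<le> 0" for n s t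
  proof -
    have "((\<lambda>w. z n (w ^ (\<nu>1 - 1) * s) (w ^ (\<nu>2 - 1) * t)) has_real_derivative
       P1 n (1 ^ (\<nu>1 - 1) * s) (1 ^ (\<nu>2 - 1) * t) * (real (\<nu>1 - 1) * s)
       + P2 n (1 ^ (\<nu>1 - 1) * s) (1 ^ (\<nu>2 - 1) * t) * (real (\<nu>2 - 1) * t)) (at 1 within {0<..})"
      by (rule quadrant_path[OF P2c d1 d2])
         (use st in \<open>auto intro!: derivative_eq_intros simp: mult_nonneg_nonpos\<close>)
    then have 1: "((\<lambda>w. z n (w ^ (\<nu>1 - 1) * s) (w ^ (\<nu>2 - 1) * t)) has_real_derivative
       P1 n s t * (real (\<nu>1 - 1) * s) + P2 n s t * (real (\<nu>2 - 1) * t)) (at 1)"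
      by (simp add: at_within_open[of 1 "{0<..}"])
    have 2: "((\<lambda>w. w powi (1 - 2 * int n)) has_real_derivative (1 - 2 * real n)) (at 1)"
      by (auto intro!: derivative_eq_intros)
    have "(scaled_term \<nu>1 \<nu>2 z n s t has_real_derivative
      (1 - 2 * real n) * z n s t + real (\<nu>1 - 1) * s * P1 n s t + real (\<nu>2 - 1) * t * P2 n s t) (at 1)"
      unfolding scaled_term_def[abs_def] using DERIV_mult[OF 2 1] by (simp add: algebra_simps)
    then show ?thesis by (simp add: scaled_jet_def DERIV_imp_deriv)
  qed
  show ?thesis
    unfolding first_order_data_def
    by (intro exI[of _ P1] exI[of _ P2] conjI allI impI zc P2c d1 d2 rhs jet0 jet1)
qed

context root
begin

lemma bool_sum: "(\<Sum>i\<in>UNIV. f i) = f False + f True" for f :: "bool \<Rightarrow> real"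
  by (simp add: UNIV_bool)

text \<open>Along a ray the leading term satisfies a linear equation for the residual of the
  algebraic equation \<open>z\<^sub>0 - \<Sum> c\<^sub>i s\<^sub>i z\<^sub>0\<^bsup>\<nu>\<^sub>i\<^esup> = 1\<close>.\<close>

lemma leading_residual:
  assumes data: "first_order_data (\<nu> True) (\<nu> False) z' P1 P2" and z00: "z' 0 0 0 = 1"
    and s: "s1 \<le> 0" "s2 \<le> 0"
  shows "P (1, s1, s2) (z' 0 s1 s2) = 1"
proof -
  let ?c1 = "cc True" and ?c2 = "cc False" and ?n1 = "\<nu> True" and ?n2 = "\<nu> False"
  define Y where "Y t = z' 0 (t * s1) (t * s2)" for t
  define q where "q t = ?c1 * s1 * Y t ^ ?n1 + ?c2 * s2 * Y t ^ ?n2" for t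
  define rr where "rr t = ?c1 * s1 * real ?n1 * Y t ^ (?n1 - 1) + ?c2 * s2 * real ?n2 * Y t ^ (?n2 - 1)" for t
  \<comment> \<open>The factor left when the Euler relation, with \<open>f_w\<close> on both sides,
    is solved for \<open>M = f_w\<close>.\<close>
  define Dn where "Dn t = 1 - t * (rr t * Y t - q t)" for t
  define \<Psi> where "\<Psi> t = Y t - t * q t" for t
  have ts: "t * s1 \<le> 0" "t * s2 \<le> 0" if "t \<in> {0..1}" for t using s that by (auto simp: mult_nonneg_nonpos)
  define M where "M t = scaled_jet ?n1 ?n2 z' (t * s1) (t * s2) 1 1 $ 0" for t
  have jet: "M t = Y t + real (?n1 - 1) * (t * s1) * P1 0 (t * s1) (t * s2) + real (?n2 - 1) * (t * s2) * P2 0 (t * s1) (t * s2)"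
    and p1: "P1 0 (t * s1) (t * s2) = ?c1 * Y t ^ ?n1 * M t"
    and p2: "P2 0 (t * s1) (t * s2) = ?c2 * Y t ^ ?n2 * M t" if "t \<in> {0..1}" for t
    using first_order_dataD(1,2,4)[OF data ts[OF that], of 0] first_order_dataD(3)[OF data ts[OF that], of 0]
    unfolding toda_rhs_def by (simp_all add: M_def Y_def cc_def fps_power_zeroth)
  have pow: "Y t * Y t ^ (\<nu> i - 1) = Y t ^ \<nu> i" for t i
    using \<nu>[of i] by (cases "\<nu> i") simp_all
  have rY: "rr t * Y t = ?c1 * s1 * real ?n1 * Y t ^ ?n1 + ?c2 * s2 * real ?n2 * Y t ^ ?n2" for t
    unfolding rr_def pow[symmetric] by (simp add: algebra_simps)
  have n1: "real (\<nu> i - 1) = real (\<nu> i) - 1" for i using \<nu>[of i] by simp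
  have MD: "M t * Dn t = Y t" if t: "t \<in> {0..1}" for t
  proof -
    have "M t = Y t + t * (rr t * Y t - q t) * M t"
      using jet[OF t] unfolding p1[OF t] p2[OF t] n1 rY q_def by (simp add: algebra_simps)
    then show ?thesis by (simp add: Dn_def algebra_simps)
  qed
  \<comment> \<open>The sign of \<open>Y\<close> is not known yet, so a lower bound for
    \<open>Dn\<close> is out of reach; but a zero of \<open>Dn\<close> would be a zero of
    \<open>Y\<close>, where \<open>Dn\<close> is 1.\<close>
  have D0: "Dn t \<noteq> 0" if t: "t \<in> {0..1}" for t
  proof
    assume "Dn t = 0"
    then have "Y t = 0" using MD[OF t] by simp
    then have Z: "Y t ^ \<nu> i = 0" for i using \<nu>[of i] by simp
    have A: "rr t * Y t = 0" and B: "q t = 0" unfolding rY q_def Z by simp_all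
    have "Dn t = 1" unfolding Dn_def A B by simp
    then show False using \<open>Dn t = 0\<close> by simp
  qed
  have Yd: "(Y has_real_derivative M t * q t) (at t within {0..1})" if t: "t \<in> {0..1}" for t
  proof -
    have "(Y has_real_derivative P1 0 (t * s1) (t * s2) * s1 + P2 0 (t * s1) (t * s2) * s2) (at t within {0..1})"
      unfolding Y_def by (rule ray_derivative[OF data s t])
    then show ?thesis unfolding p1[OF t] p2[OF t] q_def by (simp add: algebra_simps)
  qed
  have Yc: "continuous_on {0..1} Y" using Yd by (rule DERIV_continuous_on)
  have qc: "continuous_on {0..1} q" unfolding q_def[abs_def] by (intro continuous_intros Yc)
  have rc: "continuous_on {0..1} rr" unfolding rr_def[abs_def] by (intro continuous_intros Yc)
  have Dc: "continuous_on {0..1} Dn" unfolding Dn_def[abs_def] by (intro continuous_intros Yc qc rc)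
  have \<Psi>d: "((\<lambda>t. \<Psi> t - 1) has_real_derivative q t / Dn t * (\<Psi> t - 1)) (at t within {0..1})" if t: "t \<in> {0..1}" for t
  proof -
    have "(q has_real_derivative rr t * (M t * q t)) (at t within {0..1})"
      unfolding q_def[abs_def] rr_def
      by (auto intro!: derivative_eq_intros Yd[OF t] simp: algebra_simps q_def)
    then have "((\<lambda>t. \<Psi> t - 1) has_real_derivative M t * q t - (q t + t * (rr t * (M t * q t)))) (at t within {0..1})"
      unfolding \<Psi>_def by (auto intro!: derivative_eq_intros Yd[OF t])
    moreover have "M t * q t - (q t + t * (rr t * (M t * q t))) = q t / Dn t * (\<Psi> t - 1)"
    proof -
      have "(M t * q t - (q t + t * (rr t * (M t * q t)))) * Dn t = q t * ((M t * Dn t) * (1 - t * rr t) - Dn t)"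
        by (simp add: algebra_simps)
      also have "\<dots> = q t * (\<Psi> t - 1)" unfolding MD[OF t] by (simp add: Dn_def \<Psi>_def algebra_simps)
      finally show ?thesis using D0[OF t] by (simp add: field_simps)
    qed
    ultimately show ?thesis by simp
  qed
  have "\<Psi> 1 - 1 = 0"
  proof (rule linear_ode_zero[OF \<Psi>d])
    show "continuous_on {0..1} (\<lambda>t. q t / Dn t)" by (intro continuous_on_divide qc Dc) (use D0 in auto)
    show "\<Psi> 0 - 1 = 0" by (simp add: \<Psi>_def Y_def z00)
  qed
  then show ?thesis by (simp add: \<Psi>_def Y_def q_def P_def bool_sum sc_def algebra_simps)
qed

text \<open>\<open>P_unique\<close> compares nonnegative roots only. By continuity along the ray a
  negative value would force a zero, at which the algebraic equation reads
  \<open>0 = 1\<close>.\<close>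

lemma leading_term:
  assumes data: "first_order_data (\<nu> True) (\<nu> False) z' P1 P2" and z00: "z' 0 0 0 = 1"
    and s: "s1 \<le> 0" "s2 \<le> 0"
  shows "z' 0 s1 s2 = yr (1, s1, s2)"
proof (rule P_unique)
  show x: "(1, s1, s2) \<in> toda_dom" using s by (simp add: toda_dom_def)
  show "yr (1, s1, s2) \<ge> 0" "P (1, s1, s2) (z' 0 s1 s2) = P (1, s1, s2) (yr (1, s1, s2))"
    using yr[OF x] leading_residual[OF assms] by simp_all
  define Y where "Y t = z' 0 (t * s1) (t * s2)" for t
  have Yc: "continuous_on {0..1} Y"
    unfolding Y_def[abs_def] by (rule ray_continuous[OF data s])
  have Y0: "Y t \<noteq> 0" if "t \<in> {0..1}" for t
  proof
    assume "Y t = 0"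
    moreover have "P (1, t * s1, t * s2) (Y t) = 1"
      unfolding Y_def by (rule leading_residual[OF data z00]) (use s that in \<open>auto simp: mult_nonneg_nonpos\<close>)
    moreover have "(0 :: real) ^ \<nu> i = 0" for i using \<nu>[of i] by simp
    ultimately show False by (simp add: P_def)
  qed
  show "z' 0 s1 s2 \<ge> 0"
  proof (rule ccontr)
    assume "\<not> z' 0 s1 s2 \<ge> 0"
    then have "Y 1 \<le> 0" "0 \<le> Y 0" by (simp_all add: Y_def z00)
    then obtain t where "0 \<le> t" "t \<le> 1" "Y t = 0" using IVT2'[of Y 1 0 0] Yc by auto
    then show False using Y0[of t] by simp
  qed
qed

text \<open>Along a ray the difference \<open>v\<close> of two solutions satisfies a homogeneous
  linear equation: the lower orders agree, \<open>toda_rhs_diff\<close> is linear in the top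
  coefficients, and the Euler relation expresses the difference \<open>B\<close> of the
  \<open>w\<close>-derivatives by \<open>v\<close>.\<close>

lemma higher_term:
  assumes data: "first_order_data (\<nu> True) (\<nu> False) z1 P1 P2" "first_order_data (\<nu> True) (\<nu> False) z2 Q1 Q2"
    and n: "n \<ge> 1" and prev: "\<And>g s t. g < n \<Longrightarrow> s \<le> 0 \<Longrightarrow> t \<le> 0 \<Longrightarrow> z2 g s t = z1 g s t"
    and init: "z1 n 0 0 = 0" "z2 n 0 0 = 0" and z10: "z1 0 0 0 = 1"
    and s: "s1 \<le> 0" "s2 \<le> 0"
  shows "z2 n s1 s2 = z1 n s1 s2"
proof -
  let ?c1 = "cc True" and ?c2 = "cc False" and ?n1 = "\<nu> True" and ?n2 = "\<nu> False"
  define Y where "Y t = z1 0 (t * s1) (t * s2)" for t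
  define q where "q t = ?c1 * s1 * Y t ^ ?n1 + ?c2 * s2 * Y t ^ ?n2" for t
  define rr where "rr t = ?c1 * s1 * real ?n1 * Y t ^ (?n1 - 1) + ?c2 * s2 * real ?n2 * Y t ^ (?n2 - 1)" for t
  define r2 where "r2 t = ?c1 * s1 * real (?n1 - 1) * real ?n1 * Y t ^ (?n1 - 1) + ?c2 * s2 * real (?n2 - 1) * real ?n2 * Y t ^ (?n2 - 1)" for t
  define Dn where "Dn t = 1 - t * (?c1 * s1 * real (?n1 - 1) * Y t ^ ?n1 + ?c2 * s2 * real (?n2 - 1) * Y t ^ ?n2)" for t
  define v where "v t = z2 n (t * s1) (t * s2) - z1 n (t * s1) (t * s2)" for t
  have ts: "t * s1 \<le> 0" "t * s2 \<le> 0" if "t \<in> {0..1}" for t using s that by (auto simp: mult_nonneg_nonpos)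
  let ?J = "\<lambda>z t. scaled_jet ?n1 ?n2 z (t * s1) (t * s2) 1"
  define M where "M t = ?J z1 t 1 $ 0" for t
  define B where "B t = ?J z2 t 1 $ n - ?J z1 t 1 $ n" for t
  \<comment> \<open>Agreement on the whole quadrant makes the scaled terms agree for all
    \<open>w > 0\<close>, hence also their derivatives at 1.\<close>
  have jets: "?J z2 t j $ g = ?J z1 t j $ g" if t: "t \<in> {0..1}" and g: "g < n" for t j g
  proof -
    have eq: "scaled_term ?n1 ?n2 z2 g (t * s1) (t * s2) w = scaled_term ?n1 ?n2 z1 g (t * s1) (t * s2) w" if "w > 0" for w
      unfolding scaled_term_def using prev[OF g] ts[OF t] that by (simp add: mult_nonneg_nonpos)
    have "(deriv ^^ j) (scaled_term ?n1 ?n2 z2 g (t * s1) (t * s2)) w = (deriv ^^ j) (scaled_term ?n1 ?n2 z1 g (t * s1) (t * s2)) w" if "w > 0" for w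
      using that
    proof (induction j arbitrary: w)
      case (Suc j)
      have "\<forall>\<^sub>F w' in nhds w. w' \<in> {0<..}" using Suc.prems by (intro eventually_nhds_in_open) auto
      then have "\<forall>\<^sub>F w' in nhds w. (deriv ^^ j) (scaled_term ?n1 ?n2 z2 g (t * s1) (t * s2)) w' = (deriv ^^ j) (scaled_term ?n1 ?n2 z1 g (t * s1) (t * s2)) w'"
        by eventually_elim (use Suc.IH in simp)
      then show ?case by (simp add: deriv_cong_ev)
    qed (simp add: eq)
    then show ?thesis by (simp add: scaled_jet_def)
  qed
  have jet: "B t = (1 - 2 * real n) * v t + real (?n1 - 1) * (t * s1) * (Q1 n (t * s1) (t * s2) - P1 n (t * s1) (t * s2))
       + real (?n2 - 1) * (t * s2) * (Q2 n (t * s1) (t * s2) - P2 n (t * s1) (t * s2))"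
    if t: "t \<in> {0..1}" for t
    using first_order_dataD(4)[OF data(1) ts[OF t], of n] first_order_dataD(4)[OF data(2) ts[OF t], of n]
    unfolding B_def v_def by (simp only: right_diff_distrib)
  have j0: "?J z1 t 0 $ 0 = Y t" "?J z2 t 0 $ n - ?J z1 t 0 $ n = v t" if t: "t \<in> {0..1}" for t
    using first_order_dataD(3)[OF data(1) ts[OF t]] first_order_dataD(3)[OF data(2) ts[OF t]] by (simp_all add: Y_def v_def)
  have p1: "Q1 n (t * s1) (t * s2) - P1 n (t * s1) (t * s2) = ?c1 * (Y t ^ ?n1 * B t + real ?n1 * Y t ^ (?n1 - 1) * v t * M t)"
    and p2: "Q2 n (t * s1) (t * s2) - P2 n (t * s1) (t * s2) = ?c2 * (Y t ^ ?n2 * B t + real ?n2 * Y t ^ (?n2 - 1) * v t * M t)"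
    if t: "t \<in> {0..1}" for t
  proof -
    have r: "P1 n (t * s1) (t * s2) = toda_rhs ?n1 (?J z1 t) n" "Q1 n (t * s1) (t * s2) = toda_rhs ?n1 (?J z2 t) n"
       "P2 n (t * s1) (t * s2) = toda_rhs ?n2 (?J z1 t) n" "Q2 n (t * s1) (t * s2) = toda_rhs ?n2 (?J z2 t) n"
      by (rule first_order_dataD[OF data(1) ts[OF t]] first_order_dataD[OF data(2) ts[OF t]])+
    show "Q1 n (t * s1) (t * s2) - P1 n (t * s1) (t * s2) = ?c1 * (Y t ^ ?n1 * B t + real ?n1 * Y t ^ (?n1 - 1) * v t * M t)"
      unfolding r toda_rhs_diff[OF n jets[OF t], simplified] j0[OF t] B_def M_def cc_def by simp
    show "Q2 n (t * s1) (t * s2) - P2 n (t * s1) (t * s2) = ?c2 * (Y t ^ ?n2 * B t + real ?n2 * Y t ^ (?n2 - 1) * v t * M t)"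
      unfolding r toda_rhs_diff[OF n jets[OF t], simplified] j0[OF t] B_def M_def cc_def by simp
  qed
  have M: "M t * Dn t = Y t" if t: "t \<in> {0..1}" for t
  proof -
    have jet: "M t = Y t + real (?n1 - 1) * (t * s1) * P1 0 (t * s1) (t * s2) + real (?n2 - 1) * (t * s2) * P2 0 (t * s1) (t * s2)"
      and p1: "P1 0 (t * s1) (t * s2) = ?c1 * Y t ^ ?n1 * M t"
      and p2: "P2 0 (t * s1) (t * s2) = ?c2 * Y t ^ ?n2 * M t"
      using first_order_dataD(1,2,4)[OF data(1) ts[OF t], of 0] first_order_dataD(3)[OF data(1) ts[OF t], of 0]
      unfolding toda_rhs_def by (simp_all add: M_def Y_def cc_def fps_power_zeroth)
    show ?thesis using jet unfolding p1 p2 Dn_def by (simp add: algebra_simps)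
  qed
  have Ypos: "Y t > 0" if t: "t \<in> {0..1}" for t
    unfolding Y_def using leading_term[OF data(1) z10 ts[OF t]] yr(1)[of "(1, t * s1, t * s2)"] ts[OF t] by (simp add: toda_dom_def)
  have Dn: "Dn t \<ge> 1" if t: "t \<in> {0..1}" for t
  proof -
    have "cc i * a * real k * Y t ^ l \<le> 0" if "a \<le> 0" for i a k l
      using that cc_nonneg[of i] Ypos[OF t] by (intro mult_nonpos_nonneg mult_nonneg_nonpos) auto
    from this[OF s(1), of True "?n1 - 1" ?n1] this[OF s(2), of False "?n2 - 1" ?n2]
    show ?thesis unfolding Dn_def using t by (simp add: mult_nonneg_nonpos)
  qed
  \<comment> \<open>Solving the Euler relation for \<open>B\<close> gives
    \<open>B = (\<beta> / Dn) v\<close>.\<close>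
  define \<beta> where "\<beta> t = (1 - 2 * real n) + t * M t * r2 t" for t
  have BD: "B t * Dn t = \<beta> t * v t" if t: "t \<in> {0..1}" for t
  proof -
    have "B t = (1 - 2 * real n) * v t + real (?n1 - 1) * (t * s1) * (?c1 * (Y t ^ ?n1 * B t + real ?n1 * Y t ^ (?n1 - 1) * v t * M t))
       + real (?n2 - 1) * (t * s2) * (?c2 * (Y t ^ ?n2 * B t + real ?n2 * Y t ^ (?n2 - 1) * v t * M t))"
      using jet[OF t] unfolding p1[OF t] p2[OF t] .
    then show ?thesis unfolding Dn_def \<beta>_def r2_def by (simp add: algebra_simps)
  qed
  define \<alpha> where "\<alpha> t = q t * (\<beta> t / Dn t) + M t * rr t" for t
  have vd: "(v has_real_derivative \<alpha> t * v t) (at t within {0..1})" if t: "t \<in> {0..1}" for t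
  proof -
    have d1: "((\<lambda>t. z1 n (t * s1) (t * s2)) has_real_derivative P1 n (t * s1) (t * s2) * s1 + P2 n (t * s1) (t * s2) * s2) (at t within {0..1})"
      by (rule ray_derivative[OF data(1) s t])
    have d2: "((\<lambda>t. z2 n (t * s1) (t * s2)) has_real_derivative Q1 n (t * s1) (t * s2) * s1 + Q2 n (t * s1) (t * s2) * s2) (at t within {0..1})"
      by (rule ray_derivative[OF data(2) s t])
    have "(v has_real_derivative (Q1 n (t * s1) (t * s2) - P1 n (t * s1) (t * s2)) * s1 + (Q2 n (t * s1) (t * s2) - P2 n (t * s1) (t * s2)) * s2) (at t within {0..1})"
      unfolding v_def using DERIV_diff[OF d2 d1] by (simp add: algebra_simps)
    moreover have "(Q1 n (t * s1) (t * s2) - P1 n (t * s1) (t * s2)) * s1 + (Q2 n (t * s1) (t * s2) - P2 n (t * s1) (t * s2)) * s2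
        = q t * B t + M t * rr t * v t"
      unfolding p1[OF t] p2[OF t] q_def rr_def by (simp add: algebra_simps)
    moreover have "B t = \<beta> t / Dn t * v t" using BD[OF t] Dn[OF t] by (simp add: field_simps)
    ultimately show ?thesis by (simp add: \<alpha>_def algebra_simps)
  qed
  have Yc: "continuous_on {0..1} Y"
    unfolding Y_def[abs_def] by (rule ray_continuous[OF data(1) s])
  have Dc: "continuous_on {0..1} Dn" unfolding Dn_def[abs_def] by (intro continuous_intros Yc)
  have nz: "\<forall>t\<in>{0..1}. Dn t \<noteq> 0" using Dn by fastforce
  have Mc: "continuous_on {0..1} M"
  proof -
    have "continuous_on {0..1} (\<lambda>t. Y t / Dn t)" by (intro continuous_on_divide Yc Dc nz)
    then show ?thesis
    proof (rule continuous_on_eq)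
      show "Y t / Dn t = M t" if "t \<in> {0..1}" for t using M[OF that] Dn[OF that] by (simp add: field_simps)
    qed
  qed
  have "v 1 = 0"
  proof (rule linear_ode_zero[OF vd])
    show "continuous_on {0..1} \<alpha>"
      unfolding \<alpha>_def[abs_def] q_def \<beta>_def rr_def r2_def by (intro continuous_intros Yc Dc Mc nz)
    show "v 0 = 0" by (simp add: v_def init)
  qed
  then show ?thesis by (simp add: v_def)
qed

lemma toda_solution_unique:
  assumes sol: "toda_solution (\<nu> True) (\<nu> False) z'" and s: "s1 \<le> 0" "s2 \<le> 0"
  shows "z' g s1 s2 = z g s1 s2"
proof -
  obtain P1 P2 where d1: "first_order_data (\<nu> True) (\<nu> False) z P1 P2" using toda_solution_data[OF toda_solution_z] by blast
  obtain Q1 Q2 where d2: "first_order_data (\<nu> True) (\<nu> False) z' Q1 Q2" using toda_solution_data[OF sol] by blast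
  have i1: "z 0 0 0 = 1" "\<And>g. g \<ge> 1 \<Longrightarrow> z g 0 0 = 0" using toda_solution_z by (simp_all add: toda_solution_def)
  have i2: "z' 0 0 0 = 1" "\<And>g. g \<ge> 1 \<Longrightarrow> z' g 0 0 = 0" using sol by (simp_all add: toda_solution_def)
  show ?thesis
    using s
  proof (induction g arbitrary: s1 s2 rule: less_induct)
    case (less n)
    show ?case
    proof (cases "n = 0")
      case True
      then show ?thesis using leading_term[OF d1 i1(1) less.prems] leading_term[OF d2 i2(1) less.prems] by simp
    next
      case False
      then have n: "n \<ge> 1" by simp
      show ?thesis
        by (rule higher_term[OF d1 d2 n less.IH i1(2)[OF n] i2(2)[OF n] i1(1) less.prems])
    qed
  qed
qed

end

subsection \<open>The expansion\<close>

context root_at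
begin

lemma vr_nonneg: "vr i \<ge> 0"
  using s by (simp add: vr_def mult_nonneg_nonpos)

lemma trunc_even: "trunc (2 * n) k 1 = (\<Sum>g<n. z g s1 s2 / real k ^ (2 * g))"
proof (induction n)
  case (Suc n)
  have "trunc (2 * Suc n) k 1 = trunc (2 * n) k 1 + pt (F $ (2 * n)) 1 / real k ^ (2 * n) + pt (F $ Suc (2 * n)) 1 / real k ^ Suc (2 * n)"
    by (simp add: trunc_def)
  then show ?case using Suc by (simp add: F_odd z_def pt_def)
qed (simp add: trunc_def)

text \<open>For fixed times the parameters \<xi> vary with \<open>k\<close>, so each
  \<open>R k\<close> belongs to a different weight; after rescaling they all satisfy one string
  equation with coefficients \<open>vr\<close>.\<close>

lemma expansion:
  assumes b: "\<And>\<xi>1 \<xi>2. \<xi>1 \<le> 0 \<Longrightarrow> \<xi>2 \<le> 0 \<Longrightarrow>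
      recurrence_coeffs (toda_weight (\<nu> True) (\<nu> False) \<xi>1 \<xi>2) (b \<xi>1 \<xi>2)"
  shows "(\<lambda>k. (b (s1 / (2 * real k ^ (\<nu> True - 1))) (s2 / (2 * real k ^ (\<nu> False - 1))) k)\<^sup>2
     - real k * (\<Sum>g<K. z g s1 s2 / real k ^ (2 * g))) \<in> O(\<lambda>k. real k / real k ^ (2 * K))"
proof -
  \<comment> \<open>One even order more than claimed: stability loses a square root of
    \<open>k\<close>, and the extra term with \<open>z K\<close> is of the claimed size.\<close>
  define M where "M = 2 * (K + 1)"
  have M: "M \<ge> 1" by (simp add: M_def)
  define \<xi> where "\<xi> i k = (if i then s1 else s2) / (2 * real k ^ (\<nu> i - 1))" for i k
  have \<xi>: "\<xi> i k \<le> 0" for i k using s by (simp add: \<xi>_def divide_nonpos_nonneg)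
  define sq where "sq k = sqseq (b (\<xi> True k) (\<xi> False k))" for k
  define R where "R k l = 1 / real k * sq k l" for k l
  have string: "string_op UNIV vr deg (R k) l = of_int l / real k" if k: "k \<ge> 1" and l: "l \<ge> 1" for k l
  proof -
    have "jpow (R k) (deg i) l (l - 1) = (1 / real k) ^ \<nu> i * jpow (sq k) (deg i) l (l - 1)" for i
      unfolding R_def by (rule jpow_scale) (use \<nu>[of i] in simp)
    \<comment> \<open>Scaling the weights by \<open>1/k\<close> produces \<open>k^(-\<nu>)\<close>,
      and \<open>s = 2 k^(\<nu>-1) \<xi>\<close> leaves the common factor
      \<open>1/k\<close>.\<close>
    moreover have "vr i * (1 / real k) ^ \<nu> i = - (1 / real k) * (4 * real (\<nu> i) * \<xi> i k)" for i
    proof -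
      obtain n where n: "\<nu> i = Suc n" using \<nu>[of i] by (cases "\<nu> i") auto
      have "- 2 * a * x * (1 / c) ^ Suc n = - (1 / c) * (4 * a * (x / (2 * c ^ n)))" for a x c :: real
      proof -
        have "4 * a * (x / (2 * c ^ n)) = 2 * a * x * (1 / c) ^ n" by (simp add: power_one_over)
        then show ?thesis by simp
      qed
      then show ?thesis unfolding vr_def \<xi>_def n by (simp only: diff_Suc_1)
    qed
    ultimately have e: "vr i * jpow (R k) (deg i) l (l - 1) = - (1 / real k) * (4 * real (\<nu> i) * \<xi> i k * jpow (sq k) (deg i) l (l - 1))" for i
      by (simp only: mult.assoc[symmetric])
    have "sq k l - 4 * real (\<nu> True) * \<xi> True k * jpow (sq k) (deg True) l (l - 1)
        - 4 * real (\<nu> False) * \<xi> False k * jpow (sq k) (deg False) l (l - 1) = of_int l"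
      unfolding sq_def by (rule recurrence_coeffs_string[OF \<nu> \<nu> \<xi> \<xi> b[OF \<xi> \<xi>] l])
    then have "1 / real k * (sq k l - 4 * real (\<nu> True) * \<xi> True k * jpow (sq k) (deg True) l (l - 1)
        - 4 * real (\<nu> False) * \<xi> False k * jpow (sq k) (deg False) l (l - 1)) = of_int l / real k" by simp
    then show ?thesis
      unfolding string_op_def bool_sum e by (simp add: R_def right_diff_distrib)
  qed
  obtain C k1 where C: "\<forall>k\<ge>k1. \<forall>l. int k \<le> 2 * l \<longrightarrow> 2 * l \<le> 3 * int k \<longrightarrow>
     \<bar>string_op UNIV vr deg (\<lambda>l. trunc M k (of_int l / real k)) l - of_int l / real k\<bar> \<le> C / real k ^ M"
    using trunc_string[OF M] by blast
  obtain c B k2 where c: "0 < c" "c \<le> B" and cB: "\<forall>k\<ge>k2. \<forall>l. int k \<le> 2 * l \<longrightarrow> 2 * l \<le> 3 * int k \<longrightarrow>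
     c \<le> trunc M k (of_int l / real k) \<and> trunc M k (of_int l / real k) \<le> B"
    using trunc_bounds[OF M] by blast
  have "\<exists>B k1. \<forall>k\<ge>k1. (R k (int k) - trunc M k (of_int (int k) / real k))\<^sup>2 \<le> B * real k / real k ^ (2 * M)"
  proof (rule string_asymptotics[of "UNIV :: bool set" vr R deg c B "max k1 k2" "\<lambda>k l. trunc M k (of_int l / real k)" C M])
    show "R k l \<ge> 0" for k l by (simp add: R_def sq_def sqseq_def)
    show "l \<le> 0 \<Longrightarrow> R k l = 0" for k l by (simp add: R_def sq_def sqseq_def)
  qed (use string C cB c vr_nonneg in auto)
  then obtain B k3 where B: "\<And>k. k \<ge> k3 \<Longrightarrow> (R k (int k) - trunc M k (of_int (int k) / real k))\<^sup>2 \<le> B * real k / real k ^ (2 * M)"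
    by blast
  have bound: "\<bar>(b (\<xi> True k) (\<xi> False k) k)\<^sup>2 - real k * (\<Sum>g<K. z g s1 s2 / real k ^ (2 * g))\<bar>
      \<le> (sqrt \<bar>B\<bar> + \<bar>z K s1 s2\<bar>) * \<bar>real k / real k ^ (2 * K)\<bar>" if k: "k \<ge> max k3 1" for k
  proof -
    define t where "t = trunc M k (of_int (int k) / real k)"
    have k1: "real k \<ge> 1" using k by simp
    have t: "t = (\<Sum>g<K. z g s1 s2 / real k ^ (2 * g)) + z K s1 s2 / real k ^ (2 * K)"
      using k1 trunc_even[of "K + 1" k] by (simp add: t_def M_def)
    have "(b (\<xi> True k) (\<xi> False k) k)\<^sup>2 = real k * R k (int k)"
      using k by (simp add: R_def sq_def sqseq_def)
    then have "(b (\<xi> True k) (\<xi> False k) k)\<^sup>2 - real k * (\<Sum>g<K. z g s1 s2 / real k ^ (2 * g))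
        = real k * (R k (int k) - t) + z K s1 s2 * (real k / real k ^ (2 * K))"
      unfolding t by (simp add: algebra_simps)
    also have "\<bar>\<dots>\<bar> \<le> real k * \<bar>R k (int k) - t\<bar> + \<bar>z K s1 s2\<bar> * (real k / real k ^ (2 * K))"
      by (rule order_trans[OF abs_triangle_ineq]) (simp add: abs_mult)
    also have "\<bar>R k (int k) - t\<bar> \<le> sqrt \<bar>B\<bar> / real k ^ (2 * K)"
    proof -
      have "(R k (int k) - t)\<^sup>2 \<le> B * real k / real k ^ (2 * M)"
        unfolding t_def by (rule B) (use k in simp)
      \<comment> \<open>The crude \<open>k \<le> k^4\<close> makes the bound a perfect square, since
        \<open>2 M = 4 + 4 K\<close>.\<close>
      also have "\<dots> \<le> \<bar>B\<bar> * real k ^ 4 / real k ^ (2 * M)"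
      proof (intro divide_right_mono mult_mono)
        show "real k \<le> real k ^ 4" using power_increasing[of 1 4 "real k"] k1 by simp
      qed auto
      also have "\<dots> = (sqrt \<bar>B\<bar> / real k ^ (2 * K))\<^sup>2"
      proof -
        have "2 * M = 4 + 2 * (2 * K)" by (simp add: M_def)
        then have "real k ^ (2 * M) = real k ^ 4 * (real k ^ (2 * K))\<^sup>2"
          by (simp only: power_add power_mult[symmetric] mult.commute)
        then show ?thesis using k1 by (simp add: power_divide)
      qed
      finally have "\<bar>R k (int k) - t\<bar> \<le> \<bar>sqrt \<bar>B\<bar> / real k ^ (2 * K)\<bar>"
        by (simp only: abs_le_square_iff)
      then show ?thesis by simp
    qed
    finally show ?thesis using k1 by (simp add: algebra_simps add_divide_distrib)
  qed
  have "(\<lambda>k. (b (\<xi> True k) (\<xi> False k) k)\<^sup>2 - real k * (\<Sum>g<K. z g s1 s2 / real k ^ (2 * g))) \<in> O(\<lambda>k. real k / real k ^ (2 * K))"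
    by (rule bigoI[where c = "sqrt \<bar>B\<bar> + \<bar>z K s1 s2\<bar>"])
       (use bound in \<open>auto simp: eventually_sequentially intro!: exI[of _ "max k3 1"]\<close>)
  then show ?thesis by (simp add: \<xi>_def)
qed

end

theorem theorem5p3:
  fixes \<nu>1 \<nu>2 :: nat
    and b :: "real \<Rightarrow> real \<Rightarrow> nat \<Rightarrow> real"
  assumes "\<nu>1 \<ge> 1" and "\<nu>2 \<ge> 1" and "\<nu>1 \<noteq> \<nu>2"
    and b: "\<And>\<xi>1 \<xi>2. \<xi>1 \<le> 0 \<Longrightarrow> \<xi>2 \<le> 0 \<Longrightarrow>
              recurrence_coeffs (toda_weight \<nu>1 \<nu>2 \<xi>1 \<xi>2) (b \<xi>1 \<xi>2)"
  shows "\<exists>z :: nat \<Rightarrow> real \<Rightarrow> real \<Rightarrow> real.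
    (\<forall>s1\<le>0. \<forall>s2\<le>0. \<forall>N.
       (\<lambda>k. (b (s1 / (2 * real k ^ (\<nu>1 - 1))) (s2 / (2 * real k ^ (\<nu>2 - 1))) k)\<^sup>2
             - real k * (\<Sum>g<N. z g s1 s2 / real k ^ (2 * g)))
         \<in> O(\<lambda>k. real k / real k ^ (2 * N))) \<and>
    toda_solution \<nu>1 \<nu>2 z \<and>
    (\<forall>z'. toda_solution \<nu>1 \<nu>2 z' \<longrightarrow>
       (\<forall>g. \<forall>s1\<le>0. \<forall>s2\<le>0. z' g s1 s2 = z g s1 s2))"
proof -
  define \<nu> where "\<nu> i = (if i then \<nu>1 else \<nu>2)" for i
  interpret root \<nu> by unfold_locales (use assms(1,2) in \<open>simp add: \<nu>_def\<close>)
  have \<nu>12: "\<nu> True = \<nu>1" "\<nu> False = \<nu>2" by (simp_all add: \<nu>_def)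
  show ?thesis
  proof (intro exI[of _ z] conjI allI impI)
    fix s1 s2 :: real and N assume "s1 \<le> 0" "s2 \<le> 0"
    then interpret root_at \<nu> s1 s2 by unfold_locales
    show "(\<lambda>k. (b (s1 / (2 * real k ^ (\<nu>1 - 1))) (s2 / (2 * real k ^ (\<nu>2 - 1))) k)\<^sup>2
             - real k * (\<Sum>g<N. z g s1 s2 / real k ^ (2 * g)))
         \<in> O(\<lambda>k. real k / real k ^ (2 * N))"
      using expansion[of b N] b by (simp add: \<nu>12)
  next
    show "toda_solution \<nu>1 \<nu>2 z" using toda_solution_z by (simp only: \<nu>12)
  next
    fix z' g and s1 s2 :: real assume "toda_solution \<nu>1 \<nu>2 z'" "s1 \<le> 0" "s2 \<le> 0"
    then show "z' g s1 s2 = z g s1 s2" by (intro toda_solution_unique) (simp_all only: \<nu>12)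
  qed
qed

end
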